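(* Let $K$ be an algebraically closed field of characteristic zero and $S=K[x_1,x_2,x_3,x_4]$. If $I=(f_1,f_2,f_3,f_4)$ is an ideal generated by a regular sequence of homogeneous polynomials $f_1,f_2,f_3,f_4\in S$ of degree $2$ such that the algebra $S/I$ has the strong Lefschetz property, then the generic initial ideal of $I$ with respect to the reverse lexicographic order is $$J=(x_1^2,\ x_1x_2,\ x_2^2,\ x_1x_3,\ x_2x_3^2,\ x_3^3,\ x_2x_3x_4,\ x_3^2x_4,\ x_1x_4^3,\ x_2x_4^3,\ x_3x_4^3,\ x_4^5).$$ In particular, this assertion holds for a generic sequence of homogeneous polynomials $f_1,f_2,f_3,f_4\in S$ of degree $2$, or if $f_1,\ldots,f_4$ is a regular sequence of homogeneous polynomials of degree $2$ with $f_i\in K[x_i,\ldots,x_4]$ for $1\leq i\leq 4$.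
   Context: $S/I$ has the strong Lefschetz property (SLP) if there is a linear form $\ell\in S$ such that for all integers $b\geq 1$ and $t\geq 0$ the multiplication map $\ell^b:(S/I)_t\to(S/I)_{t+b}$ is injective or surjective. The generic initial ideal of $I$ is the common initial ideal, with respect to the graded reverse lexicographic order with $x_1>x_2>x_3>x_4$, of $\alpha I$ for all $\alpha$ in a nonempty Zariski open subset of $GL_4(K)$ acting by linear changes of coordinates. A property holds for a generic sequence of homogeneous polynomials of degree $2$ if there is a nonempty Zariski open subset $U\subset S_2\times S_2\times S_2\times S_2$ such that it holds for every $(f_1,f_2,f_3,f_4)\in U$. *)

theory Defs
  imports
    "HOL-Analysis.Determinants"
    "HOL-Library.Poly_Mapping"
    "HOL-Computational_Algebra.Polynomial"
begin

section \<open>Multivariate polynomials\<close>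

text \<open>
  A monomial is its exponent vector, and a polynomial is the finitely supported function sending
  a monomial to its coefficient. The multiplication on \<^type>\<open>poly_mapping\<close> is the convolution
  product, so this is the usual polynomial ring. The variables are indexed by a type; the
  polynomial ring in four variables is obtained from the four-element type \<open>4\<close>, whose elements
  in increasing order are \<open>0 < 1 < 2 < 3\<close> (note that \<open>4 = 0\<close> there). Thus the variables
  \<open>x\<^sub>1, x\<^sub>2, x\<^sub>3, x\<^sub>4\<close> have the indices \<open>0, 1, 2, 3\<close>.
\<close>

lemma four_order: "(0::4) < 1" "(1::4) < 2" "(2::4) < 3"
  by (simp_all add: less_bit0_def bit0.Rep_numeral bit0.Rep_1 bit0.Rep_0)

type_synonym 'v mon = "'v \<Rightarrow>\<^sub>0 nat"
type_synonym ('v, 'a) mpoly = "'v mon \<Rightarrow>\<^sub>0 'a"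

definition monom :: "'v mon \<Rightarrow> ('v, 'a::comm_ring_1) mpoly" where
  "monom m = Poly_Mapping.single m 1"

definition X :: "'v \<Rightarrow> ('v, 'a::comm_ring_1) mpoly" where
  "X i = monom (Poly_Mapping.single i 1)"

definition const :: "'a \<Rightarrow> ('v, 'a::comm_ring_1) mpoly" where
  "const c = Poly_Mapping.single 0 c"

definition mon_deg :: "'v mon \<Rightarrow> nat" where
  "mon_deg m = (\<Sum>i\<in>Poly_Mapping.keys m. Poly_Mapping.lookup m i)"

text \<open>The zero polynomial is homogeneous of every degree: \<open>{f. homogeneous d f}\<close> is \<open>S\<^sub>d\<close>.\<close>

definition homogeneous :: "nat \<Rightarrow> ('v, 'a::zero) mpoly \<Rightarrow> bool" where
  "homogeneous d f \<longleftrightarrow> (\<forall>m\<in>Poly_Mapping.keys f. mon_deg m = d)"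

definition vars :: "('v, 'a::zero) mpoly \<Rightarrow> 'v set" where
  "vars f = (\<Union>m\<in>Poly_Mapping.keys f. Poly_Mapping.keys m)"

text \<open>
  The value of \<open>p\<close> at \<open>x\<close>, where coefficients are mapped by \<open>h\<close>. It is evaluation at a point for
  \<open>h = id\<close>, and substitution of polynomials for the variables for \<open>h = const\<close>.
\<close>

definition insertion :: "('a::zero \<Rightarrow> 'b::comm_ring_1) \<Rightarrow> ('v \<Rightarrow> 'b) \<Rightarrow> ('v, 'a) mpoly \<Rightarrow> 'b" where
  "insertion h x p = (\<Sum>m\<in>Poly_Mapping.keys p. h (Poly_Mapping.lookup p m) *
     (\<Prod>i\<in>Poly_Mapping.keys m. x i ^ Poly_Mapping.lookup m i))"

text \<open>The ideal generated by \<open>F\<close>: the span of \<open>F\<close> in the ring as a module over itself.\<close>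

definition ideal_gen :: "'r::comm_ring_1 set \<Rightarrow> 'r set" where
  "ideal_gen F = module.span (*) F"

definition regular_sequence :: "('i::linorder \<Rightarrow> 'r::comm_ring_1) \<Rightarrow> bool" where
  "regular_sequence f \<longleftrightarrow>
     (\<forall>i g. g * f i \<in> ideal_gen (f ` {..<i}) \<longrightarrow> g \<in> ideal_gen (f ` {..<i})) \<and>
     ideal_gen (range f) \<noteq> UNIV"

section \<open>The strong Lefschetz property\<close>

text \<open>Elements of the quotient ring are cosets; \<open>quot_deg I t\<close> is \<open>(S/I)\<^sub>t\<close>, the image of \<open>S\<^sub>t\<close>.\<close>

definition quot_coset :: "'r::comm_ring_1 set \<Rightarrow> 'r \<Rightarrow> 'r set" where
  "quot_coset I f = {g. g - f \<in> I}"

definition quot_deg :: "('v, 'a::comm_ring_1) mpoly set \<Rightarrow> nat \<Rightarrow> ('v, 'a) mpoly set set" where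
  "quot_deg I t = quot_coset I ` {f. homogeneous t f}"

definition quot_mult :: "'r::comm_ring_1 set \<Rightarrow> 'r \<Rightarrow> 'r set \<Rightarrow> 'r set" where
  "quot_mult I p A = (\<Union>g\<in>A. quot_coset I (p * g))"

definition strong_lefschetz :: "('v, 'a::comm_ring_1) mpoly set \<Rightarrow> bool" where
  "strong_lefschetz I \<longleftrightarrow> (\<exists>l. homogeneous 1 l \<and> (\<forall>b\<ge>1. \<forall>t.
     inj_on (quot_mult I (l ^ b)) (quot_deg I t) \<or>
     quot_mult I (l ^ b) ` quot_deg I t = quot_deg I (t + b)))"

section \<open>Initial ideals\<close>

text \<open>
  \<open>revlex_less m n\<close> is \<open>m < n\<close> in the graded reverse lexicographic order in which variables with
  smaller index are larger.
\<close>

definition revlex_less :: "'v::linorder mon \<Rightarrow> 'v mon \<Rightarrow> bool" where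
  "revlex_less m n \<longleftrightarrow> mon_deg m < mon_deg n \<or> mon_deg m = mon_deg n \<and>
     (\<exists>i. Poly_Mapping.lookup m i > Poly_Mapping.lookup n i \<and>
          (\<forall>j>i. Poly_Mapping.lookup m j = Poly_Mapping.lookup n j))"

definition is_leading_mon :: "('v::linorder, 'a::zero) mpoly \<Rightarrow> 'v mon \<Rightarrow> bool" where
  "is_leading_mon f m \<longleftrightarrow> m \<in> Poly_Mapping.keys f \<and>
     (\<forall>n\<in>Poly_Mapping.keys f. n \<noteq> m \<longrightarrow> revlex_less n m)"

definition initial_ideal ::
    "('v::linorder, 'a::comm_ring_1) mpoly set \<Rightarrow> ('v, 'a) mpoly set" where
  "initial_ideal I = ideal_gen {monom m | f m. f \<in> I \<and> is_leading_mon f m}"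

section \<open>Zariski open sets and generic initial ideals\<close>

text \<open>
  The Zariski topology on a set \<open>Y\<close> that is embedded in an affine space by the coordinate
  functions \<open>y \<mapsto> coord y v\<close>: the open sets are the complements in \<open>Y\<close> of common zero sets of
  families of polynomials in the coordinates.
\<close>

definition zariski_open_in ::
    "'y set \<Rightarrow> ('y \<Rightarrow> 'v \<Rightarrow> 'a::comm_ring_1) \<Rightarrow> 'y set \<Rightarrow> bool" where
  "zariski_open_in Y coord U \<longleftrightarrow>
     (\<exists>P :: ('v, 'a) mpoly set. U = {y\<in>Y. \<exists>p\<in>P. insertion id (coord y) p \<noteq> 0})"

text \<open>
  \<open>GL\<close> is open in the affine space of all matrices, so its Zariski topology is the subspace
  topology and the inverse of the determinant is not needed as a coordinate.
\<close>

definition zariski_open_GL :: "('a::field ^ 'n ^ 'n) set \<Rightarrow> bool" where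
  "zariski_open_GL U \<longleftrightarrow>
     zariski_open_in {A. invertible A} (\<lambda>A (i, j). A $ i $ j) U"

text \<open>The algebra automorphism given by \<open>x\<^sub>j \<mapsto> \<Sum>\<^sub>i A\<^sub>i\<^sub>j x\<^sub>i\<close>, which is a left action of \<open>GL\<close>.\<close>

definition lin_act :: "'a::field ^ 'n ^ 'n \<Rightarrow> ('n, 'a) mpoly \<Rightarrow> ('n, 'a) mpoly" where
  "lin_act A f = insertion const (\<lambda>j. \<Sum>i\<in>UNIV. const (A $ i $ j) * X i) f"

definition is_generic_initial_ideal ::
    "('n::{finite,linorder}, 'a::field) mpoly set \<Rightarrow> ('n, 'a) mpoly set \<Rightarrow> bool" where
  "is_generic_initial_ideal I J \<longleftrightarrow>
     (\<exists>U. zariski_open_GL U \<and> U \<noteq> {} \<and> (\<forall>A\<in>U. initial_ideal (lin_act A ` I) = J))"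

text \<open>
  The coordinates of a sequence of forms of degree \<open>d\<close> are its coefficients. Coefficients at
  monomials of other degrees also occur as coordinates but are constantly zero there.
\<close>

definition generic_sequence ::
    "nat \<Rightarrow> (('i \<Rightarrow> ('v, 'a::field) mpoly) \<Rightarrow> bool) \<Rightarrow> bool" where
  "generic_sequence d \<Phi> \<longleftrightarrow>
     (\<exists>U. zariski_open_in {f. \<forall>i. homogeneous d (f i)}
            (\<lambda>f (i, m). Poly_Mapping.lookup (f i) m) U \<and>
          U \<noteq> {} \<and> (\<forall>f\<in>U. \<Phi> f))"

end

theory Submission
  imports Defs
begin

text \<open>
  Let \<open>I\<close> be generated by four quadrics. The monomials outside of the ideal \<open>J\<close> of the theorem,
  called standard, are 1, 4, 6, 4, 1 in number in degrees 0 to 4, and in every degree they are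
  the smallest monomials in the reverse lexicographic order. Therefore the initial ideal of \<open>I\<close>
  is \<open>J\<close> as soon as the standard monomials form a basis of the quotient ring by \<open>I\<close>. It suffices
  that they span the quotient in degrees 2 to 5 (\<open>good\<close>): the components of \<open>I\<close> of degree 2, 3, 4
  have dimension at most 4, 16 and 34, where the last number accounts for the relations
  \<open>f\<^sub>i f\<^sub>j = f\<^sub>j f\<^sub>i\<close>, so that independence follows by counting (\<open>std_independent\<close>,
  \<open>initial_ideal_eq\<close>). Being spanned is a Zariski open condition on the coefficients of the quadrics
  (\<open>spanning_open\<close>, a Gaussian elimination over a polynomial ring), and these are polynomials in the
  entries of the coordinate change (\<open>lin_act_generic\<close>). Hence a single good coordinate system gives
  the generic initial ideal (\<open>generic_initial_ideal_if_good\<close>), and a single good sequence settles the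
  generic case (\<open>generic_sequence_if_good\<close>).

  If \<open>I\<close> comes from a regular sequence, the quotient ring \<open>A\<close> has Hilbert function 1, 4, 6, 4, 1, and
  a strong Lefschetz element \<open>l\<close> yields \<open>A\<^sub>3 = l\<^sup>2 A\<^sub>1\<close> and \<open>A\<^sub>4 = l\<^sup>4 A\<^sub>0\<close>, while \<open>A\<^sub>2 / l A\<^sub>1\<close> has
  dimension 2. A polarization argument provides linear forms \<open>y, z\<close> such that \<open>y z\<close> and \<open>z\<^sup>2\<close> form a
  basis of the latter (\<open>square_and_product_not_in_subspace\<close>). The coordinate change that sends
  \<open>y, z, l\<close> to \<open>x\<^sub>2, x\<^sub>3, x\<^sub>4\<close> is then good (\<open>strong_lefschetz_good\<close>).

  The squares of the variables have good coordinates by an explicit computation with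
  \<open>l = x\<^sub>1 + x\<^sub>2 + x\<^sub>3 + x\<^sub>4\<close> (\<open>squares_good\<close>). In a regular sequence with \<open>f\<^sub>i \<in> K[x\<^sub>i, \<dots>, x\<^sub>4]\<close>,
  the coefficient of \<open>x\<^sub>i\<^sup>2\<close> in \<open>f\<^sub>i\<close> does not vanish, as otherwise the quadrics would have a common
  zero outside of the origin (\<open>triangular_diagonal\<close>). A one-parameter torus therefore degenerates the
  sequence to the squares of the variables up to scalars, and by openness it has good coordinates as
  well (\<open>triangular_degeneration\<close>). This avoids proving the strong Lefschetz property for such
  sequences.
\<close>

section \<open>Polynomials and their evaluation\<close>

abbreviation lookup :: "('b \<Rightarrow>\<^sub>0 'c::zero) \<Rightarrow> 'b \<Rightarrow> 'c" where
  "lookup \<equiv> Poly_Mapping.lookup"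

abbreviation keys :: "('b \<Rightarrow>\<^sub>0 'c::zero) \<Rightarrow> 'b set" where
  "keys \<equiv> Poly_Mapping.keys"

lemma const_0 [simp]: "const 0 = 0"
  and const_1 [simp]: "const 1 = 1"
  and const_add: "const (a + b) = const a + const b"
  and const_diff: "const (a - b) = const a - const b"
  and const_mult: "const (a * b) = const a * const b"
  and const_uminus: "const (- a) = - const a"
  by (simp_all add: const_def single_add single_diff single_uminus mult_single)

lemma const_numeral: "const (numeral k) = numeral k"
  by (simp add: const_def)

lemma const_sum: "const (sum f A) = (\<Sum>i\<in>A. const (f i))"
  by (induction A rule: infinite_finite_induct) (auto simp: const_add)

lemma const_power: "const (a ^ n) = const a ^ n"
  by (induction n) (auto simp: const_mult)

lemma monom_0 [simp]: "monom 0 = 1"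
  by (simp add: monom_def)

lemma monom_add: "monom (m + n) = monom m * monom n"
  by (simp add: monom_def mult_single)

lemma monom_neq_0 [simp]: "(monom m :: ('v, 'a::comm_ring_1) mpoly) \<noteq> 0"
  by (metis monom_def lookup_single_eq lookup_zero zero_neq_one)

lemma keys_monom [simp]: "keys (monom m :: ('v, 'a::comm_ring_1) mpoly) = {m}"
  by (simp add: monom_def)

lemma lookup_monom: "lookup (monom m) n = (if n = m then 1 else 0)"
  by (auto simp: monom_def lookup_single when_def)

lemma inj_monom: "inj (monom :: 'v mon \<Rightarrow> ('v, 'a::comm_ring_1) mpoly)"
  by (rule injI) (metis lookup_monom zero_neq_one)

lemma lookup_const_mult: "lookup (const c * p) m = c * lookup p m"
proof -
  have "const c * p = Poly_Mapping.map ((*) c) p"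
    by (simp add: const_def mult_map_scale_conv_mult)
  then show ?thesis by (simp add: Poly_Mapping.map.rep_eq when_def)
qed

lemma mpoly_eq_sum: "p = (\<Sum>m\<in>keys p. const (lookup p m) * monom m)"
proof (rule poly_mapping_eqI)
  fix k
  have "lookup (\<Sum>m\<in>keys p. const (lookup p m) * monom m) k
      = (\<Sum>m\<in>keys p. if k = m then lookup p m else 0)"
    by (simp add: lookup_sum lookup_const_mult lookup_monom if_distrib cong: if_cong)
  also have "\<dots> = lookup p k"
    by (simp add: sum.delta' in_keys_iff)
  finally show "lookup p k = lookup (\<Sum>m\<in>keys p. const (lookup p m) * monom m) k" ..
qed

lemma mpoly_eq_sum_superset:
  assumes "finite M" "keys p \<subseteq> M"
  shows "p = (\<Sum>m\<in>M. const (lookup p m) * monom m)"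
proof -
  have "(\<Sum>m\<in>M. const (lookup p m) * monom m) = (\<Sum>m\<in>keys p. const (lookup p m) * monom m)"
    by (rule sum.mono_neutral_right) (use assms in \<open>auto simp: in_keys_iff\<close>)
  then show ?thesis using mpoly_eq_sum[of p] by simp
qed

lemma mpoly_induct [case_names monom add]:
  fixes p :: "('v, 'a::comm_ring_1) mpoly"
  assumes "\<And>c m. P (const c * monom m)" "\<And>p q. P p \<Longrightarrow> P q \<Longrightarrow> P (p + q)"
  shows "P p"
proof -
  have "P (\<Sum>m\<in>M. const (c m) * monom m)" if "finite M" for c and M :: "'v mon set"
    using that
  proof (induction M rule: finite_induct)
    case empty
    show ?case using assms(1)[of 0] by simp
  next
    case (insert x F)
    then show ?case using assms by simp
  qed
  then show ?thesis by (metis mpoly_eq_sum finite_keys)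
qed

lemma lookup_monom_mult:
  "lookup (monom m * p) e = (if \<exists>n. e = m + n then lookup p (e - m) else 0)"
  for p :: "('v, 'a::comm_ring_1) mpoly"
proof (induction p rule: mpoly_induct)
  case (monom c k)
  have "monom m * (const c * monom k) = const c * monom (m + k)"
    by (simp add: monom_add algebra_simps)
  then show ?case by (auto simp: lookup_const_mult lookup_monom)
next
  case (add p q)
  then show ?case by (simp add: lookup_add distrib_left)
qed

text \<open>The value of a monomial at the point \<open>x\<close>.\<close>

definition mon_val :: "('v \<Rightarrow> 'b::comm_ring_1) \<Rightarrow> 'v mon \<Rightarrow> 'b" where
  "mon_val x m = (\<Prod>i\<in>keys m. x i ^ lookup m i)"

lemma mon_val_superset:
  assumes "finite V" "keys m \<subseteq> V"
  shows "mon_val x m = (\<Prod>i\<in>V. x i ^ lookup m i)"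
  unfolding mon_val_def
  by (rule prod.mono_neutral_left) (use assms in \<open>auto simp: in_keys_iff\<close>)

lemma mon_val_0 [simp]: "mon_val x 0 = 1"
  by (simp add: mon_val_def)

lemma mon_val_add: "mon_val x (m + n) = mon_val x m * mon_val x n"
proof -
  let ?V = "keys m \<union> keys n"
  have "mon_val x (m + n) = (\<Prod>i\<in>?V. x i ^ lookup (m + n) i)"
    by (rule mon_val_superset) (auto simp: in_keys_iff lookup_add)
  also have "\<dots> = (\<Prod>i\<in>?V. x i ^ lookup m i) * (\<Prod>i\<in>?V. x i ^ lookup n i)"
    by (simp add: lookup_add power_add prod.distrib)
  finally show ?thesis by (simp add: mon_val_superset[of ?V])
qed

lemma mon_val_single [simp]: "mon_val x (Poly_Mapping.single i k) = x i ^ k"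
  by (simp add: mon_val_def)

lemma mon_val_X: "mon_val X m = (monom m :: ('v, 'a::comm_ring_1) mpoly)"
proof -
  have X: "(X i :: ('v, 'a) mpoly) ^ k = monom (Poly_Mapping.single i k)" for i k
    by (induction k) (simp_all add: X_def monom_add[symmetric] single_add[symmetric])
  have *: "(\<Prod>i\<in>V. monom (Poly_Mapping.single i (lookup m i)) :: ('v, 'a) mpoly)
      = monom (\<Sum>i\<in>V. Poly_Mapping.single i (lookup m i))" for V
    by (induction V rule: infinite_finite_induct) (auto simp: monom_add)
  have "(\<Sum>i\<in>keys m. Poly_Mapping.single i (lookup m i)) = m"
    by (rule poly_mapping_eqI) (simp add: lookup_sum lookup_single when_def sum.delta' in_keys_iff)
  then show ?thesis by (simp add: mon_val_def X *)
qed

text \<open>Homomorphisms of commutative rings, such as the coefficient maps in \<open>insertion\<close>.\<close>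

definition is_hom :: "('a::comm_ring_1 \<Rightarrow> 'b::comm_ring_1) \<Rightarrow> bool" where
  "is_hom h \<longleftrightarrow> h 0 = 0 \<and> h 1 = 1 \<and> (\<forall>x y. h (x + y) = h x + h y) \<and> (\<forall>x y. h (x * y) = h x * h y)"

lemma is_homD:
  assumes "is_hom h"
  shows "h 0 = 0" "h 1 = 1" "h (x + y) = h x + h y" "h (x * y) = h x * h y"
    "h (x - y) = h x - h y" "h (- x) = - h x" "h (x ^ n) = h x ^ n"
    "h (sum f A) = (\<Sum>i\<in>A. h (f i))" "h (prod f A) = (\<Prod>i\<in>A. h (f i))"
proof -
  note h = assms[unfolded is_hom_def]
  show "h 0 = 0" "h 1 = 1" "h (x + y) = h x + h y" "h (x * y) = h x * h y" using h by auto
  show um: "h (- x) = - h x" for x using h by (metis add.right_inverse add_eq_0_iff)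
  show "h (x - y) = h x - h y" using h um by (metis diff_conv_add_uminus)
  show "h (x ^ n) = h x ^ n" by (induction n) (use h in auto)
  show "h (sum f A) = (\<Sum>i\<in>A. h (f i))"
    by (induction A rule: infinite_finite_induct) (use h in auto)
  show "h (prod f A) = (\<Prod>i\<in>A. h (f i))"
    by (induction A rule: infinite_finite_induct) (use h in auto)
qed

lemma is_hom_id [simp]: "is_hom id"
  by (simp add: is_hom_def)

lemma is_hom_const [simp]: "is_hom const"
  by (simp add: is_hom_def const_add const_mult)

lemma is_hom_comp: "is_hom g \<Longrightarrow> is_hom h \<Longrightarrow> is_hom (g \<circ> h)"
  by (simp add: is_hom_def)

lemma insertion_superset:
  assumes "is_hom h" "finite M" "keys p \<subseteq> M"
  shows "insertion h x p = (\<Sum>m\<in>M. h (lookup p m) * mon_val x m)"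
  unfolding insertion_def mon_val_def
  by (rule sum.mono_neutral_left) (use assms in \<open>auto simp: in_keys_iff is_homD\<close>)

lemma insertion_single:
  assumes "is_hom h"
  shows "insertion h x (const c * monom m) = h c * mon_val x m"
proof -
  have "insertion h x (const c * monom m) = (\<Sum>n\<in>{m}. h (lookup (const c * monom m) n) * mon_val x n)"
    by (rule insertion_superset) (auto simp: assms in_keys_iff lookup_const_mult lookup_monom split: if_splits)
  then show ?thesis by (simp add: lookup_const_mult lookup_monom)
qed

lemma insertion_add:
  assumes "is_hom h"
  shows "insertion h x (p + q) = insertion h x p + insertion h x q"
  using assms keys_add[of p q]
  by (simp add: insertion_superset[of h "keys p \<union> keys q"] lookup_add is_homD algebra_simps sum.distrib)

lemma insertion_mult:
  assumes h: "is_hom h"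
  shows "insertion h x (p * q) = insertion h x p * insertion h x q"
proof (induction p rule: mpoly_induct)
  case (monom c m)
  show ?case
  proof (induction q rule: mpoly_induct)
    case (monom d n)
    have "const c * monom m * (const d * monom n) = const (c * d) * monom (m + n)"
      by (simp add: const_mult monom_add algebra_simps)
    then show ?case
      by (simp only: insertion_single[OF h] mon_val_add is_homD[OF h]) (simp add: algebra_simps)
  next
    case (add p q)
    then show ?case by (simp add: insertion_add h distrib_left)
  qed
next
  case (add p q)
  then show ?case by (simp add: insertion_add h distrib_right)
qed

lemma insertion_const: "is_hom h \<Longrightarrow> insertion h x (const c) = h c"
  using insertion_single[of h x c 0] by simp

lemma insertion_monom: "is_hom h \<Longrightarrow> insertion h x (monom m) = mon_val x m"
  using insertion_single[of h x 1 m] by (simp add: is_homD)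

lemma insertion_X: "is_hom h \<Longrightarrow> insertion h x (X i) = x i"
  by (simp add: X_def insertion_monom)

lemma is_hom_insertion: "is_hom h \<Longrightarrow> is_hom (insertion h x)"
  unfolding is_hom_def[of "insertion h x"]
  using insertion_const[of h x 0] insertion_const[of h x 1]
  by (simp add: insertion_add insertion_mult is_homD)

text \<open>Homomorphisms commute with substitution.\<close>

lemma hom_insertion:
  assumes "is_hom g" "is_hom h"
  shows "g (insertion h x p) = insertion (g \<circ> h) (\<lambda>v. g (x v)) p"
  by (simp add: insertion_def is_homD[OF assms(1)])

lemma insertion_const_X: "insertion const X p = p"
  by (subst (3) mpoly_eq_sum) (simp add: insertion_def mon_val_def[symmetric] mon_val_X)

lemma insertion_insertion:
  assumes "is_hom h"
  shows "insertion h x (insertion const q p) = insertion h (\<lambda>v. insertion h x (q v)) p"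
proof -
  have "insertion h x \<circ> const = h" by (auto simp: insertion_const assms)
  then show ?thesis by (simp add: hom_insertion is_hom_insertion assms)
qed

section \<open>Homogeneous polynomials\<close>

lemma mon_deg_superset:
  assumes "finite V" "keys m \<subseteq> V"
  shows "mon_deg m = (\<Sum>i\<in>V. lookup m i)"
  unfolding mon_deg_def
  by (rule sum.mono_neutral_left) (use assms in \<open>auto simp: in_keys_iff\<close>)

lemma mon_deg_0 [simp]: "mon_deg 0 = 0"
  by (simp add: mon_deg_def)

lemma mon_deg_single [simp]: "mon_deg (Poly_Mapping.single i k) = k"
  by (simp add: mon_deg_def)

lemma mon_deg_add: "mon_deg (m + n) = mon_deg m + mon_deg n"
proof -
  let ?V = "keys m \<union> keys n"
  have "mon_deg (m + n) = (\<Sum>i\<in>?V. lookup (m + n) i)"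
    by (rule mon_deg_superset) (auto simp: in_keys_iff lookup_add)
  then show ?thesis by (simp add: lookup_add sum.distrib mon_deg_superset[of ?V])
qed

lemma mon_deg_eq_0_iff: "mon_deg m = 0 \<longleftrightarrow> m = 0"
  by (auto simp: mon_deg_def in_keys_iff intro!: poly_mapping_eqI)

lemma mon_split:
  fixes m :: "'v mon"
  assumes "k \<le> lookup m i"
  shows "m = Poly_Mapping.single i k + (m - Poly_Mapping.single i k)"
  by (rule poly_mapping_eqI) (use assms in \<open>auto simp: lookup_add lookup_minus lookup_single when_def\<close>)

lemma mon_deg_1E:
  assumes "mon_deg m = 1"
  obtains i where "m = Poly_Mapping.single i 1"
proof -
  have "m \<noteq> 0" using assms by auto
  then obtain i where i: "lookup m i \<noteq> 0" by (metis poly_mapping_eqI lookup_zero)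
  define n where "n = m - Poly_Mapping.single i 1"
  have m: "m = Poly_Mapping.single i 1 + n"
    unfolding n_def by (rule mon_split) (use i in simp)
  then have "mon_deg n = 0" using assms by (simp add: mon_deg_add)
  then show ?thesis using that m by (simp add: mon_deg_eq_0_iff)
qed

lemma single_1_eq_iff: "Poly_Mapping.single k (1::nat) = Poly_Mapping.single i 1 \<longleftrightarrow> k = i"
  by (metis lookup_single_eq lookup_single_not_eq zero_neq_one)

lemma homogeneousI:
  "(\<And>m. lookup p m \<noteq> 0 \<Longrightarrow> mon_deg m = d) \<Longrightarrow> homogeneous d p"
  by (simp add: homogeneous_def in_keys_iff)

lemma homogeneousD: "homogeneous d p \<Longrightarrow> lookup p m \<noteq> 0 \<Longrightarrow> mon_deg m = d"
  by (simp add: homogeneous_def in_keys_iff)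

lemma homogeneous_0 [simp]: "homogeneous d 0"
  by (simp add: homogeneous_def)

lemma homogeneous_add: "homogeneous d p \<Longrightarrow> homogeneous d q \<Longrightarrow> homogeneous d (p + q)"
  by (rule homogeneousI) (metis lookup_add add_0 homogeneousD)

lemma homogeneous_uminus: "homogeneous d p \<Longrightarrow> homogeneous d (- p)"
  for p :: "('v, 'a::comm_ring_1) mpoly"
  by (simp add: homogeneous_def)

lemma homogeneous_diff: "homogeneous d p \<Longrightarrow> homogeneous d q \<Longrightarrow> homogeneous d (p - q)"
  for p :: "('v, 'a::comm_ring_1) mpoly"
  using homogeneous_add[of d p "- q"] homogeneous_uminus by auto

lemma homogeneous_sum: "(\<And>i. i \<in> A \<Longrightarrow> homogeneous d (f i)) \<Longrightarrow> homogeneous d (sum f A)"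
  by (induction A rule: infinite_finite_induct) (auto intro: homogeneous_add)

lemma homogeneous_monom: "mon_deg m = d \<Longrightarrow> homogeneous d (monom m)"
  by (rule homogeneousI) (auto simp: lookup_monom split: if_splits)

lemma homogeneous_mult:
  fixes p q :: "('v, 'a::comm_ring_1) mpoly"
  assumes "homogeneous d p" "homogeneous e q"
  shows "homogeneous (d + e) (p * q)"
  unfolding homogeneous_def
proof
  fix m assume "m \<in> keys (p * q)"
  then obtain a b where "m = a + b" "a \<in> keys p" "b \<in> keys q"
    using keys_mult[of p q] by blast
  then show "mon_deg m = d + e" using assms by (simp add: mon_deg_add homogeneous_def)
qed

lemma homogeneous_const [simp]: "homogeneous 0 (const c)"
  by (rule homogeneousI) (auto simp: const_def lookup_single when_def split: if_splits)

lemma homogeneous_const_mult: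
  fixes p :: "('v, 'a::comm_ring_1) mpoly"
  shows "homogeneous d p \<Longrightarrow> homogeneous d (const c * p)"
  using homogeneous_mult[of 0 "const c" d p] by simp

lemma homogeneous_X [simp]: "homogeneous 1 (X i)" "homogeneous (Suc 0) (X i)"
  by (simp_all add: X_def homogeneous_monom)

lemma homogeneous_power: "homogeneous d (p :: ('v, 'a::comm_ring_1) mpoly) \<Longrightarrow> homogeneous (n * d) (p ^ n)"
proof (induction n)
  case 0
  show ?case using homogeneous_const[of 1] by simp
next
  case (Suc n)
  then show ?case using homogeneous_mult by auto
qed

lemma homogeneous_prod:
  fixes f :: "'i \<Rightarrow> ('v, 'a::comm_ring_1) mpoly"
  assumes "\<And>i. i \<in> A \<Longrightarrow> homogeneous (d i) (f i)"
  shows "homogeneous (sum d A) (prod f A)"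
  using assms
proof (induction A rule: infinite_finite_induct)
  case (insert x F)
  then show ?case by (auto intro: homogeneous_mult)
qed (use homogeneous_const[of 1] in auto)

lemma homogeneous_0_const: "homogeneous 0 p \<Longrightarrow> p = const (lookup p 0)"
proof (rule poly_mapping_eqI)
  fix m assume "homogeneous 0 p"
  then show "lookup p m = lookup (const (lookup p 0)) m"
    using homogeneousD[of 0 p m] by (auto simp: const_def lookup_single when_def mon_deg_eq_0_iff)
qed

text \<open>The homogeneous component of degree \<open>d\<close>.\<close>

definition hcomp :: "nat \<Rightarrow> ('v, 'a::comm_ring_1) mpoly \<Rightarrow> ('v, 'a) mpoly" where
  "hcomp d p = Poly_Mapping.mapp (\<lambda>m c. if mon_deg m = d then c else 0) p"

lemma lookup_hcomp: "lookup (hcomp d p) m = (if mon_deg m = d then lookup p m else 0)"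
  by (auto simp: hcomp_def lookup_mapp in_keys_iff when_def)

lemma hcomp_add: "hcomp d (p + q) = hcomp d p + hcomp d q"
  by (rule poly_mapping_eqI) (simp add: lookup_hcomp lookup_add)

lemma hcomp_0 [simp]: "hcomp d 0 = 0"
  by (rule poly_mapping_eqI) (simp add: lookup_hcomp)

lemma homogeneous_hcomp [simp]: "homogeneous d (hcomp d p)"
  by (rule homogeneousI) (simp add: lookup_hcomp split: if_splits)

lemma hcomp_homogeneous: "homogeneous d p \<Longrightarrow> hcomp e p = (if d = e then p else 0)"
  by (rule poly_mapping_eqI) (auto simp: lookup_hcomp dest: homogeneousD)

lemma hcomp_mult:
  fixes p q :: "('v, 'a::comm_ring_1) mpoly"
  assumes "homogeneous e q"
  shows "hcomp d (p * q) = (if e \<le> d then hcomp (d - e) p * q else 0)"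
proof (induction p rule: mpoly_induct)
  case (monom c m)
  have h: "homogeneous (mon_deg m) (const c * monom m)"
    by (intro homogeneous_const_mult homogeneous_monom refl)
  show ?case
    using hcomp_homogeneous[OF homogeneous_mult[OF h assms], of d] hcomp_homogeneous[OF h, of "d - e"]
    by auto
next
  case (add p q)
  then show ?case by (simp add: hcomp_add distrib_right)
qed

section \<open>Linear substitutions\<close>

lemma lin_act_hom: "is_hom (lin_act A)"
  unfolding lin_act_def[abs_def] by (simp add: is_hom_insertion)

lemma lin_act_const [simp]: "lin_act A (const c) = const c"
  by (simp add: lin_act_def insertion_const)

lemma lin_act_X: "lin_act A (X j) = (\<Sum>i\<in>UNIV. const (A $ i $ j) * X i)"
  by (simp add: lin_act_def insertion_X)

lemma lin_act_mult_matrix: "lin_act A (lin_act B f) = lin_act (A ** B) f"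
proof -
  have "(\<Sum>i\<in>UNIV. const (B $ i $ j) * (\<Sum>k\<in>UNIV. const (A $ k $ i) * X k))
      = (\<Sum>k\<in>UNIV. const ((A ** B) $ k $ j) * X k)" for j
    unfolding matrix_matrix_mult_def
    by (simp add: const_sum const_mult sum_distrib_left sum_distrib_right, subst sum.swap)
       (simp add: algebra_simps)
  then have "lin_act A (\<Sum>i\<in>UNIV. const (B $ i $ j) * X i)
      = (\<Sum>k\<in>UNIV. const ((A ** B) $ k $ j) * X k)" for j
    by (simp add: is_homD[OF lin_act_hom] lin_act_X)
  then show ?thesis
    unfolding lin_act_def[of B] lin_act_def[of "A ** B"]
    using hom_insertion[OF lin_act_hom is_hom_const, of A "\<lambda>j. \<Sum>i\<in>UNIV. const (B $ i $ j) * X i" f]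
    by (simp add: comp_def)
qed

lemma lin_act_mat_1: "lin_act (mat 1) f = f"
proof -
  have "(\<lambda>j::'a. \<Sum>i\<in>UNIV. const (mat 1 $ i $ j :: 'b) * X i) = X"
    by (auto simp: mat_def if_distrib[of const] if_distrib[of "\<lambda>a. a * _"] cong: if_cong)
  then show ?thesis by (simp add: lin_act_def insertion_const_X)
qed

lemma homogeneous_lin_act:
  assumes "homogeneous d f"
  shows "homogeneous d (lin_act A f)"
proof -
  have l: "homogeneous 1 (\<Sum>i\<in>UNIV. const (A $ i $ j) * X i)" for j
    by (intro homogeneous_sum homogeneous_const_mult homogeneous_X)
  have "homogeneous d (\<Prod>j\<in>keys m. (\<Sum>i\<in>UNIV. const (A $ i $ j) * X i) ^ lookup m j)"
    if "m \<in> keys f" for m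
  proof -
    have "homogeneous (\<Sum>j\<in>keys m. lookup m j * 1)
      (\<Prod>j\<in>keys m. (\<Sum>i\<in>UNIV. const (A $ i $ j) * X i) ^ lookup m j)"
      by (intro homogeneous_prod homogeneous_power l)
    moreover have "(\<Sum>j\<in>keys m. lookup m j * 1) = d"
      using assms that by (simp add: homogeneous_def mon_deg_def)
    ultimately show ?thesis by simp
  qed
  then show ?thesis unfolding lin_act_def insertion_def
    by (intro homogeneous_sum homogeneous_const_mult)
qed

section \<open>Ideals\<close>

interpretation ring_module: module "(*) :: 'r::comm_ring_1 \<Rightarrow> 'r \<Rightarrow> 'r"
  by unfold_locales (auto simp: algebra_simps)

(* As a rewrite rule this would reassociate every product. *)
declare ring_module.scale_scale [simp del]

lemma ideal_base: "f \<in> F \<Longrightarrow> f \<in> ideal_gen F"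
  by (simp add: ideal_gen_def ring_module.span_base)

lemma ideal_0 [simp]: "0 \<in> ideal_gen F"
  by (simp add: ideal_gen_def ring_module.span_zero)

lemma ideal_add: "p \<in> ideal_gen F \<Longrightarrow> q \<in> ideal_gen F \<Longrightarrow> p + q \<in> ideal_gen F"
  by (simp add: ideal_gen_def ring_module.span_add)

lemma ideal_diff: "p \<in> ideal_gen F \<Longrightarrow> q \<in> ideal_gen F \<Longrightarrow> p - q \<in> ideal_gen F"
  by (simp add: ideal_gen_def ring_module.span_diff)

lemma ideal_mult: "p \<in> ideal_gen F \<Longrightarrow> r * p \<in> ideal_gen F"
  by (simp add: ideal_gen_def ring_module.span_scale)

lemma ideal_mult_right: "p \<in> ideal_gen F \<Longrightarrow> p * r \<in> ideal_gen F"
  using ideal_mult[of p F r] by (simp add: mult.commute)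

lemma ideal_sum: "(\<And>i. i \<in> A \<Longrightarrow> f i \<in> ideal_gen F) \<Longrightarrow> sum f A \<in> ideal_gen F"
  by (simp add: ideal_gen_def ring_module.span_sum)

lemma ideal_gen_subset: "G \<subseteq> ideal_gen F \<Longrightarrow> ideal_gen G \<subseteq> ideal_gen F"
  unfolding ideal_gen_def by (metis ring_module.span_minimal ring_module.subspace_span)

lemma ideal_gen_range:
  fixes g :: "'i::finite \<Rightarrow> 'r::comm_ring_1"
  shows "ideal_gen (range g) = range (\<lambda>q. \<Sum>i\<in>UNIV. q i * g i)" (is "_ = ?R")
proof
  have "p \<in> ?R" if "p \<in> ideal_gen (range g)" for p
    using that unfolding ideal_gen_def
  proof (induction rule: ring_module.span_induct_alt)
    case base
    show ?case by (rule range_eqI[of _ _ "\<lambda>_. 0"]) simp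
  next
    case (step c x y)
    then obtain j q where jq: "x = g j" "y = (\<Sum>i\<in>UNIV. q i * g i)" by auto
    have "(\<Sum>i\<in>UNIV. (if i = j then c else 0) * g i) = c * x"
      by (simp add: jq if_distrib[of "\<lambda>a. a * _"] cong: if_cong)
    then have "c * x + y = (\<Sum>i\<in>UNIV. (q i + (if i = j then c else 0)) * g i)"
      by (simp add: jq(2) distrib_right sum.distrib)
    then show ?case by (intro image_eqI[where x = "\<lambda>i. q i + (if i = j then c else 0)"] UNIV_I)
  qed
  then show "ideal_gen (range g) \<subseteq> ?R" by blast
  show "?R \<subseteq> ideal_gen (range g)" 
  proof
    fix p assume "p \<in> ?R"
    then obtain q where "p = (\<Sum>i\<in>UNIV. q i * g i)" by blast
    then show "p \<in> ideal_gen (range g)" by (simp add: ideal_sum ideal_mult ideal_base)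
  qed
qed

lemma ideal_gen_range_scale:
  fixes g :: "'i \<Rightarrow> ('v, 'a::field) mpoly"
  assumes "\<And>i. c i \<noteq> 0"
  shows "ideal_gen (range (\<lambda>i. const (c i) * g i)) = ideal_gen (range g)"
proof
  show "ideal_gen (range (\<lambda>i. const (c i) * g i)) \<subseteq> ideal_gen (range g)"
    by (rule ideal_gen_subset) (auto intro: ideal_mult ideal_base)
  have "g i \<in> ideal_gen (range (\<lambda>i. const (c i) * g i))" for i
  proof -
    have "const (inverse (c i)) * (const (c i) * g i) \<in> ideal_gen (range (\<lambda>i. const (c i) * g i))"
      by (intro ideal_mult ideal_base rangeI)
    moreover have "const (inverse (c i)) * (const (c i) * g i) = g i"
      using assms[of i] by (simp add: mult.assoc[symmetric] const_mult[symmetric])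
    ultimately show ?thesis by simp
  qed
  then show "ideal_gen (range g) \<subseteq> ideal_gen (range (\<lambda>i. const (c i) * g i))"
    by (intro ideal_gen_subset) auto
qed

lemma hom_image_ideal:
  fixes g :: "'i::finite \<Rightarrow> 'r::comm_ring_1"
  assumes h: "is_hom h" and s: "surj h"
  shows "h ` ideal_gen (range g) = ideal_gen (range (\<lambda>i. h (g i)))"
proof
  show "h ` ideal_gen (range g) \<subseteq> ideal_gen (range (\<lambda>i. h (g i)))"
    by (auto simp: ideal_gen_range is_homD[OF h])
  show "ideal_gen (range (\<lambda>i. h (g i))) \<subseteq> h ` ideal_gen (range g)"
  proof
    fix p assume "p \<in> ideal_gen (range (\<lambda>i. h (g i)))"
    then obtain q where q: "p = (\<Sum>i\<in>UNIV. q i * h (g i))" by (auto simp: ideal_gen_range)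
    have "p = h (\<Sum>i\<in>UNIV. inv h (q i) * g i)"
      by (simp add: q is_homD[OF h] surj_f_inv_f[OF s])
    then show "p \<in> h ` ideal_gen (range g)" by (auto simp: ideal_gen_range)
  qed
qed

lemma hcomp_sum: "hcomp d (sum f A) = (\<Sum>i\<in>A. hcomp d (f i))"
  by (induction A rule: infinite_finite_induct) (auto simp: hcomp_add)

lemma hcomp_ideal:
  assumes F: "\<And>f. f \<in> F \<Longrightarrow> homogeneous e f" and p: "p \<in> ideal_gen F"
  shows "hcomp d p \<in> ideal_gen F"
  using p unfolding ideal_gen_def
proof (induction rule: ring_module.span_induct_alt)
  case base
  show ?case by (simp add: ring_module.span_zero)
next
  case (step c x y)
  then have "hcomp d (c * x) \<in> ring_module.span F"
    by (auto simp: hcomp_mult[OF F] intro: ring_module.span_scale ring_module.span_base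
        ring_module.span_zero)
  with step show ?case by (simp add: hcomp_add ring_module.span_add)
qed

lemma ideal_low_degree:
  assumes F: "\<And>f. f \<in> F \<Longrightarrow> homogeneous e f" and p: "p \<in> ideal_gen F"
    and "homogeneous d p" "d < e"
  shows "p = 0"
proof -
  have "hcomp d p = 0"
    using p unfolding ideal_gen_def
    by (induction rule: ring_module.span_induct_alt)
       (use assms in \<open>auto simp: hcomp_add hcomp_mult[OF F]\<close>)
  then show ?thesis using hcomp_homogeneous[OF assms(3), of d] by simp
qed

lemma homogeneous_in_ideal_gen_range:
  fixes g :: "'i::finite \<Rightarrow> ('v, 'a::comm_ring_1) mpoly"
  assumes g: "\<And>i. homogeneous e (g i)" and p: "p \<in> ideal_gen (range g)" "homogeneous d p"
    and ed: "e \<le> d"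
  obtains q where "\<And>i. homogeneous (d - e) (q i)" "p = (\<Sum>i\<in>UNIV. q i * g i)"
proof -
  obtain q where q: "p = (\<Sum>i\<in>UNIV. q i * g i)" using p(1) by (auto simp: ideal_gen_range)
  have "p = hcomp d p" using p(2) by (simp add: hcomp_homogeneous)
  also have "\<dots> = (\<Sum>i\<in>UNIV. hcomp (d - e) (q i) * g i)"
    using ed by (simp add: q hcomp_sum hcomp_mult[OF g])
  finally show ?thesis by (intro that[of "\<lambda>i. hcomp (d - e) (q i)"]) auto
qed

section \<open>Spanning is an open condition\<close>

lemma sum_pivot:
  fixes p z :: "'a::comm_ring_1"
  shows "(\<Sum>t\<in>T. b t * (p * x t - y t * z)) = p * (\<Sum>t\<in>T. b t * x t) - (\<Sum>t\<in>T. b t * y t) * z"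
  by (simp add: right_diff_distrib sum_subtractf sum_distrib_left sum_distrib_right mult_ac)

text \<open>
  Gaussian elimination with a pivot that does not vanish at \<open>x0\<close>: if vectors with polynomial
  entries span the space of all vectors at one point, they span it wherever a suitable polynomial
  does not vanish.
\<close>

lemma spanning_open:
  fixes v :: "'t \<Rightarrow> 'e \<Rightarrow> ('c, 'a::field) mpoly"
  assumes "finite E" "finite T"
    and "\<forall>u. \<exists>a. \<forall>e\<in>E. u e = (\<Sum>t\<in>T. a t * insertion id x0 (v t e))"
  shows "\<exists>P. insertion id x0 P \<noteq> 0 \<and> (\<forall>x. insertion id x P \<noteq> 0 \<longrightarrow>
           (\<forall>u. \<exists>a. \<forall>e\<in>E. u e = (\<Sum>t\<in>T. a t * insertion id x (v t e))))"
  using assms(1,3)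
proof (induction E arbitrary: v rule: finite_induct)
  case empty
  show ?case by (rule exI[of _ "const 1"]) (simp only: insertion_const is_hom_id, simp)
next
  case (insert k E)
  note hom = is_homD[OF is_hom_insertion[OF is_hom_id]]
  define ev where "ev x = (insertion id x :: ('c, 'a) mpoly \<Rightarrow> 'a)" for x
  have ev: "ev x (p - q) = ev x p - ev x q" "ev x (p * q) = ev x p * ev x q" for x p q
    by (simp_all add: ev_def hom)
  obtain a where a: "1 = (\<Sum>t\<in>T. a t * ev x0 (v t k))"
    using insert.prems[rule_format, of "\<lambda>_. 1"] by (auto simp: ev_def)
  obtain s where s: "s \<in> T" "ev x0 (v s k) \<noteq> 0"
  proof (rule ccontr)
    assume "\<not> thesis"
    with that have "ev x0 (v t k) = 0" if "t \<in> T" for t using that by blast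
    with a show False by simp
  qed
  \<comment> \<open>The entry \<open>v s k\<close> is the pivot; the vectors \<open>w t\<close> vanish at \<open>k\<close>.\<close>
  define w where "w t e = v s k * v t e - v t k * v s e" for t e
  have sumw: "(\<Sum>t\<in>T. b t * ev x (w t e))
      = ev x (v s k) * (\<Sum>t\<in>T. b t * ev x (v t e)) - (\<Sum>t\<in>T. b t * ev x (v t k)) * ev x (v s e)" for b x e
    unfolding w_def ev by (rule sum_pivot)
  have "\<exists>a. \<forall>e\<in>E. u e = (\<Sum>t\<in>T. a t * ev x0 (w t e))" for u
  proof -
    obtain b where b: "\<forall>e\<in>insert k E. (if e = k then 0 else u e) = (\<Sum>t\<in>T. b t * ev x0 (v t e))"
      using insert.prems[rule_format, of "\<lambda>e. if e = k then 0 else u e"] by (auto simp: ev_def)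
    have bk: "(\<Sum>t\<in>T. b t * ev x0 (v t k)) = 0" using b by auto
    have "u e = (\<Sum>t\<in>T. (b t / ev x0 (v s k)) * ev x0 (w t e))" if e: "e \<in> E" for e
    proof -
      have "(\<Sum>t\<in>T. b t * ev x0 (w t e)) = ev x0 (v s k) * (\<Sum>t\<in>T. b t * ev x0 (v t e))"
        by (simp add: sumw bk)
      also have "(\<Sum>t\<in>T. b t * ev x0 (v t e)) = u e" using b e insert.hyps
        by (metis insertCI)
      finally have "(\<Sum>t\<in>T. b t * ev x0 (w t e)) / ev x0 (v s k) = u e" using s by simp
      then show ?thesis by (simp add: sum_divide_distrib)
    qed
    then show ?thesis by (intro exI[of _ "\<lambda>t. b t / ev x0 (v s k)"] ballI)
  qed
  then have "\<exists>P. ev x0 P \<noteq> 0 \<and> (\<forall>x. ev x P \<noteq> 0 \<longrightarrow>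
           (\<forall>u. \<exists>a. \<forall>e\<in>E. u e = (\<Sum>t\<in>T. a t * ev x (w t e))))"
    unfolding ev_def by (intro insert.IH allI)
  then obtain P where P': "ev x0 P \<noteq> 0 \<and> (\<forall>x. ev x P \<noteq> 0 \<longrightarrow>
           (\<forall>u. \<exists>a. \<forall>e\<in>E. u e = (\<Sum>t\<in>T. a t * ev x (w t e))))" ..
  note P = P'[THEN conjunct1] P'[THEN conjunct2, rule_format]
  show ?case
  proof (intro exI[of _ "P * v s k"] conjI allI impI)
    show "insertion id x0 (P * v s k) \<noteq> 0" using P(1) s unfolding ev_def[symmetric] by (simp add: ev)
    fix x u assume "insertion id x (P * v s k) \<noteq> 0"
    then have x: "ev x P \<noteq> 0" "ev x (v s k) \<noteq> 0" unfolding ev_def[symmetric] by (simp_all add: ev)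
    define c where "c = u k / ev x (v s k)"
    obtain a where a: "\<forall>e\<in>E. u e - c * ev x (v s e) = (\<Sum>t\<in>T. a t * ev x (w t e))"
      using P(2)[OF x(1), of "\<lambda>e. u e - c * ev x (v s e)"] by (rule exE)
    define A where "A = (\<Sum>t\<in>T. a t * ev x (v t k))"
    define b where "b t = a t * ev x (v s k) + (if t = s then c - A else 0)" for t
    have sumb: "(\<Sum>t\<in>T. b t * ev x (v t e)) = (\<Sum>t\<in>T. a t * ev x (w t e)) + c * ev x (v s e)" for e
    proof -
      have "(\<Sum>t\<in>T. b t * ev x (v t e))
         = (\<Sum>t\<in>T. a t * ev x (v s k) * ev x (v t e)) + (\<Sum>t\<in>T. if t = s then (c - A) * ev x (v s e) else 0)"
        unfolding sum.distrib[symmetric] by (rule sum.cong[OF refl]) (simp add: b_def distrib_right)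
      also have "\<dots> = (\<Sum>t\<in>T. a t * ev x (v s k) * ev x (v t e)) + (c - A) * ev x (v s e)"
        using s assms(2) by simp
      also have "(\<Sum>t\<in>T. a t * ev x (v s k) * ev x (v t e)) = ev x (v s k) * (\<Sum>t\<in>T. a t * ev x (v t e))"
        by (subst sum_distrib_left) (intro sum.cong refl, simp only: mult_ac)
      finally show ?thesis unfolding sumw A_def by (simp only: left_diff_distrib diff_add_eq add_diff_eq)
    qed
    have "(\<Sum>t\<in>T. a t * ev x (w t k)) = 0" by (simp add: sumw)
    then have "u e = (\<Sum>t\<in>T. b t * ev x (v t e))" if "e \<in> insert k E" for e
      using that a x by (auto simp: sumb c_def) (metis c_def diff_add_cancel)
    then show "\<exists>a. \<forall>e\<in>insert k E. u e = (\<Sum>t\<in>T. a t * insertion id x (v t e))"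
      unfolding ev_def by (intro exI[of _ b] ballI)
  qed
qed

text \<open>The monomials of degree \<open>d\<close>.\<close>

definition mons :: "nat \<Rightarrow> 'v mon set" where
  "mons d = {m. mon_deg m = d}"

lemma finite_mons: "finite (mons d :: 'v::finite mon set)"
proof -
  have "lookup m i \<le> mon_deg m" for m :: "'v mon" and i
    using member_le_sum[of i UNIV "lookup m"] by (simp add: mon_deg_superset[of UNIV])
  then have "Poly_Mapping.lookup ` (mons d :: 'v mon set) \<subseteq> {f. \<forall>i. (i \<in> UNIV \<longrightarrow> f i \<in> {..d}) \<and> (i \<notin> UNIV \<longrightarrow> f i = 0)}"
    by (auto simp: mons_def)
  then have "finite (Poly_Mapping.lookup ` (mons d :: 'v mon set))"
    by (rule finite_subset) (rule finite_set_of_finite_funs; simp)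
  then show ?thesis by (rule finite_imageD) (simp add: inj_on_def)
qed

lemma homogeneous_eq_sum:
  fixes p :: "('v::finite, 'a::comm_ring_1) mpoly"
  assumes "homogeneous d p"
  shows "p = (\<Sum>m\<in>mons d. const (lookup p m) * monom m)"
  by (rule mpoly_eq_sum_superset[OF finite_mons]) (use assms in \<open>auto simp: homogeneous_def mons_def\<close>)

lemma lookup_sum_monom:
  assumes "finite M"
  shows "lookup (\<Sum>m\<in>M. const (c m) * monom m) n = (if n \<in> M then c n else 0)"
proof -
  have "lookup (\<Sum>m\<in>M. const (c m) * monom m) n = (\<Sum>m\<in>M. if n = m then c m else 0)"
    by (simp add: lookup_sum lookup_const_mult lookup_monom if_distrib cong: if_cong)
  with assms show ?thesis by simp
qed

lemma homogeneous_sum_monom: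
  "M \<subseteq> mons d \<Longrightarrow> homogeneous d (\<Sum>m\<in>M. const (c m) * monom m)"
  by (intro homogeneous_sum homogeneous_const_mult homogeneous_monom) (auto simp: mons_def)

lemma homogeneous_eqI:
  assumes "homogeneous d p" "homogeneous d q" "\<And>m. m \<in> mons d \<Longrightarrow> lookup p m = lookup q m"
  shows "p = q"
proof (rule poly_mapping_eqI)
  fix m show "lookup p m = lookup q m"
    by (cases "m \<in> mons d") (metis assms homogeneousD mem_Collect_eq mons_def)+
qed

text \<open>The monomials in \<open>B\<close> span the component of degree \<open>d\<close> of the quotient ring by \<open>I\<close>.\<close>

definition spans_mod :: "('v, 'a::comm_ring_1) mpoly set \<Rightarrow> 'v mon set \<Rightarrow> nat \<Rightarrow> bool" where
  "spans_mod I B d \<longleftrightarrow>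
     (\<forall>u. homogeneous d u \<longrightarrow> (\<exists>b. homogeneous d b \<and> keys b \<subseteq> B \<and> u - b \<in> I))"

text \<open>The coordinates of a sequence of polynomials are their coefficients.\<close>

definition coords :: "('i \<Rightarrow> ('v, 'a::comm_ring_1) mpoly) \<Rightarrow> 'i \<times> 'v mon \<Rightarrow> 'a" where
  "coords g = (\<lambda>(i, m). lookup (g i) m)"

lemma spans_mod_open:
  fixes g0 :: "'i::finite \<Rightarrow> ('v::finite, 'a::field) mpoly"
  assumes g0: "\<And>i. homogeneous e (g0 i)" and ed: "e \<le> d"
    and sp: "spans_mod (ideal_gen (range g0)) B d"
  shows "\<exists>P. insertion id (coords g0) P \<noteq> 0 \<and>
     (\<forall>g. (\<forall>i. homogeneous e (g i)) \<longrightarrow> insertion id (coords g) P \<noteq> 0 \<longrightarrow>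
        spans_mod (ideal_gen (range g)) B d)"
proof -
  define T1 where "T1 = (UNIV :: 'i set) \<times> (mons (d - e) :: 'v mon set)"
  define T2 where "T2 = B \<inter> mons d"
  define T where "T = T1 <+> T2"
  have fin: "finite T1" "finite T2" "finite T"
    by (simp_all add: T1_def T2_def T_def finite_mons)
  define v :: "('i \<times> 'v mon) + 'v mon \<Rightarrow> 'v mon \<Rightarrow> ('i \<times> 'v mon, 'a) mpoly" where
    "v t m = (case t of Inl (i, n) \<Rightarrow> if \<exists>k. m = n + k then X (i, m - n) else 0
              | Inr b \<Rightarrow> if m = b then 1 else 0)" for t m
  have ev: "insertion id (coords g) (v (Inl (i, n)) m) = lookup (monom n * g i) m"
    "insertion id (coords g) (v (Inr b) m) = (if m = b then 1 else 0)" for g i n m b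
    by (auto simp: v_def insertion_X coords_def lookup_monom_mult is_homD[OF is_hom_insertion[OF is_hom_id]])
  have sumT: "(\<Sum>t\<in>T. a t * insertion id (coords g) (v t m)) =
      (\<Sum>i\<in>UNIV. \<Sum>n\<in>mons (d - e). a (Inl (i, n)) * lookup (monom n * g i) m) +
      (if m \<in> B then a (Inr m) else 0)" if "m \<in> mons d" for a g m
  proof -
    have "(\<Sum>t\<in>T1. a (Inl t) * insertion id (coords g) (v (Inl t) m)) =
      (\<Sum>i\<in>UNIV. \<Sum>n\<in>mons (d - e). a (Inl (i, n)) * lookup (monom n * g i) m)"
      by (simp add: T1_def sum.cartesian_product split_def ev[symmetric])
    moreover have "(\<Sum>t\<in>T2. a (Inr t) * insertion id (coords g) (v (Inr t) m)) =
      (if m \<in> B then a (Inr m) else 0)"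
      using that fin(2) by (auto simp: ev if_distrib[of "\<lambda>x. _ * x"] T2_def cong: if_cong)
    ultimately show ?thesis
      unfolding T_def using fin by (simp add: sum.Plus)
  qed
  have lin: "\<forall>u. \<exists>a. \<forall>m\<in>mons d. u m = (\<Sum>t\<in>T. a t * insertion id (coords g0) (v t m))"
  proof
    fix u :: "'v mon \<Rightarrow> 'a"
    define U where "U = (\<Sum>m\<in>mons d. const (u m) * monom m)"
    have U: "homogeneous d U" "\<And>m. m \<in> mons d \<Longrightarrow> lookup U m = u m"
      by (auto simp: U_def lookup_sum_monom finite_mons homogeneous_sum_monom)
    obtain b where b: "homogeneous d b" "keys b \<subseteq> B" "U - b \<in> ideal_gen (range g0)"
      using sp U(1) by (auto simp: spans_mod_def)
    obtain q where q: "\<And>i. homogeneous (d - e) (q i)" "U - b = (\<Sum>i\<in>UNIV. q i * g0 i)"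
      by (rule homogeneous_in_ideal_gen_range[OF g0 b(3) homogeneous_diff[OF U(1) b(1)] ed]) (rule that)
    define a where "a t = (case t of Inl (i, n) \<Rightarrow> lookup (q i) n | Inr m \<Rightarrow> lookup b m)" for t
    have "u m = (\<Sum>t\<in>T. a t * insertion id (coords g0) (v t m))" if m: "m \<in> mons d" for m
    proof -
      have "q i * g0 i = (\<Sum>n\<in>mons (d - e). const (lookup (q i) n) * (monom n * g0 i))" for i
        by (rule arg_cong[OF homogeneous_eq_sum[OF q(1)], of "\<lambda>p. p * g0 i" i, THEN trans])
          (simp only: sum_distrib_right mult.assoc)
      then have "lookup (q i * g0 i) m = (\<Sum>n\<in>mons (d - e). lookup (q i) n * lookup (monom n * g0 i) m)" for i
        by (simp only: lookup_sum lookup_const_mult)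
      then have "lookup (U - b) m = (\<Sum>i\<in>UNIV. \<Sum>n\<in>mons (d - e). lookup (q i) n * lookup (monom n * g0 i) m)"
        by (simp only: q(2) lookup_sum)
      moreover have "m \<notin> B \<Longrightarrow> lookup b m = 0"
        using b(2) by (auto simp: in_keys_iff)
      ultimately show ?thesis
        unfolding sumT[OF m] by (simp add: a_def lookup_minus U(2)[OF m] algebra_simps)
    qed
    then show "\<exists>a. \<forall>m\<in>mons d. u m = (\<Sum>t\<in>T. a t * insertion id (coords g0) (v t m))"
      by (intro exI[of _ a] ballI)
  qed
  obtain P where P': "insertion id (coords g0) P \<noteq> 0 \<and> (\<forall>x. insertion id x P \<noteq> 0 \<longrightarrow>
      (\<forall>u. \<exists>a. \<forall>m\<in>mons d. u m = (\<Sum>t\<in>T. a t * insertion id x (v t m))))"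
    using spanning_open[OF finite_mons fin(3) lin] ..
  note P = P'[THEN conjunct1] P'[THEN conjunct2, rule_format]
  have "spans_mod (ideal_gen (range g)) B d"
    if g: "\<forall>i. homogeneous e (g i)" and nz: "insertion id (coords g) P \<noteq> 0" for g
    unfolding spans_mod_def
  proof (intro allI impI)
    fix u :: "('v, 'a) mpoly" assume u: "homogeneous d u"
    obtain a where a: "\<forall>m\<in>mons d. lookup u m = (\<Sum>t\<in>T. a t * insertion id (coords g) (v t m))"
      using P(2)[OF nz, of "lookup u"] by (rule exE)
    define b where "b = (\<Sum>m\<in>T2. const (a (Inr m)) * monom m)"
    define r where "r = (\<Sum>i\<in>UNIV. \<Sum>n\<in>mons (d - e). const (a (Inl (i, n))) * (monom n * g i))"
    have lb: "lookup b m = (if m \<in> T2 then a (Inr m) else 0)" for m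
      using fin(2) by (simp add: b_def lookup_sum_monom)
    have b: "homogeneous d b" "keys b \<subseteq> B"
      by (auto simp: lb T2_def mons_def in_keys_iff intro!: homogeneousI split: if_splits)
    have "homogeneous d (monom n * g i)" if "n \<in> mons (d - e)" for n i
      using homogeneous_mult[of "d - e" "monom n" e "g i"] that g ed
      by (auto simp: mons_def homogeneous_monom)
    then have r: "homogeneous d r"
      unfolding r_def by (intro homogeneous_sum homogeneous_const_mult)
    have "u - b = r"
    proof (rule homogeneous_eqI[of d])
      show "homogeneous d (u - b)" "homogeneous d r" using u b r by (auto intro: homogeneous_diff)
      fix m :: "'v mon" assume m: "m \<in> mons d"
      then show "lookup (u - b) m = lookup r m"
        using a sumT[OF m] by (simp add: lookup_minus lb T2_def r_def lookup_sum lookup_const_mult)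
    qed
    moreover have "r \<in> ideal_gen (range g)"
      unfolding r_def by (intro ideal_sum ideal_mult ideal_base) auto
    ultimately show "\<exists>b. homogeneous d b \<and> keys b \<subseteq> B \<and> u - b \<in> ideal_gen (range g)" using b by auto
  qed
  with P(1) show ?thesis by (intro exI[of _ P] conjI allI impI)
qed

section \<open>Monomials in four variables\<close>

lemmas four_less = four_order less_trans[OF four_order(1,2)] less_trans[OF four_order(2,3)]
  less_trans[OF less_trans[OF four_order(1,2)] four_order(3)]

lemmas four_neq [simp] = four_less[THEN less_imp_neq] four_less[THEN less_imp_neq, THEN not_sym]

lemma four_cases: obtains "(i::4) = 0" | "i = 1" | "i = 2" | "i = 3"
proof -
  have "(4::4) = 0" by simp
  then show ?thesis using exhaust_4[of i] that by auto
qed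

lemma UNIV_four: "(UNIV :: 4 set) = {0, 1, 2, 3}"
proof -
  have "i \<in> {0, 1, 2, 3}" for i :: 4 by (cases i rule: four_cases) simp_all
  then show ?thesis by blast
qed

lemma all_four: "(\<forall>i::4. P i) \<longleftrightarrow> P 0 \<and> P 1 \<and> P 2 \<and> P 3"
proof -
  have "(\<forall>i\<in>UNIV. P (i::4)) \<longleftrightarrow> P 0 \<and> P 1 \<and> P 2 \<and> P 3" unfolding UNIV_four by simp
  then show ?thesis by simp
qed

lemma ex_four: "(\<exists>i::4. P i) \<longleftrightarrow> P 0 \<or> P 1 \<or> P 2 \<or> P 3"
  using all_four[of "\<lambda>i. \<not> P i"] by blast

lemma sum_four: "(\<Sum>i\<in>UNIV. f (i::4)) = f 0 + f 1 + f 2 + f 3"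
  unfolding UNIV_four by (simp add: add.assoc)

lemma mon_eqI:
  fixes m n :: "4 mon"
  assumes "lookup m 0 = lookup n 0" "lookup m 1 = lookup n 1" "lookup m 2 = lookup n 2" "lookup m 3 = lookup n 3"
  shows "m = n"
proof (rule poly_mapping_eqI)
  show "lookup m k = lookup n k" for k by (cases k rule: four_cases) (use assms in simp_all)
qed

lemma mon_deg_four: "mon_deg m = lookup m 0 + lookup m 1 + lookup m 2 + lookup m 3" for m :: "4 mon"
  by (simp add: mon_deg_superset[of UNIV] sum_four)

text \<open>The monomial \<open>x\<^sub>1\<^sup>a x\<^sub>2\<^sup>b x\<^sub>3\<^sup>c x\<^sub>4\<^sup>e\<close>.\<close>

definition mk :: "nat \<Rightarrow> nat \<Rightarrow> nat \<Rightarrow> nat \<Rightarrow> 4 mon" where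
  "mk a b c e = Poly_Mapping.single 0 a + Poly_Mapping.single 1 b + Poly_Mapping.single 2 c
     + Poly_Mapping.single 3 e"

lemma lookup_mk [simp]:
  "lookup (mk a b c e) 0 = a" "lookup (mk a b c e) 1 = b"
  "lookup (mk a b c e) 2 = c" "lookup (mk a b c e) 3 = e"
  by (simp_all add: mk_def lookup_add lookup_single)

lemma mk_lookup: "m = mk (lookup m 0) (lookup m 1) (lookup m 2) (lookup m 3)"
  by (rule mon_eqI) simp_all

lemma mk_eq_iff [simp]: "mk a b c e = mk a' b' c' e' \<longleftrightarrow> a = a' \<and> b = b' \<and> c = c' \<and> e = e'"
  by (metis lookup_mk)

lemma mon_deg_mk [simp]: "mon_deg (mk a b c e) = a + b + c + e"
  by (simp add: mon_deg_four)

lemma mk_add: "mk a b c e + mk a' b' c' e' = mk (a + a') (b + b') (c + c') (e + e')"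
  by (rule mon_eqI) (simp_all add: lookup_add)

lemma monom_mk: "monom (mk a b c e) = X 0 ^ a * X 1 ^ b * X 2 ^ c * X 3 ^ e"
proof -
  have X: "monom (Poly_Mapping.single i k) = X i ^ k" for i :: 4 and k
    unfolding mon_val_X[symmetric] by simp
  show ?thesis by (simp add: mk_def monom_add X)
qed

lemma card_mons:
  "card (mons d :: 4 mon set) = (\<Sum>a\<le>d. \<Sum>b\<le>d - a. d - a - b + 1)"
proof -
  define T where "T = (SIGMA a:{..d}. SIGMA b:{..d - a}. SIGMA c:{..d - a - b}. {d - a - b - c})"
  have "bij_betw (\<lambda>(a, b, c, e). mk a b c e) T (mons d)"
  proof (rule bij_betw_imageI)
    show "inj_on (\<lambda>(a, b, c, e). mk a b c e) T" by (auto simp: inj_on_def)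
    have "m \<in> (\<lambda>(a, b, c, e). mk a b c e) ` T" if "mon_deg m = d" for m
      using that mk_lookup[of m]
      by (intro image_eqI[where x = "(lookup m 0, lookup m 1, lookup m 2, lookup m 3)"])
         (auto simp: T_def mon_deg_four)
    then show "(\<lambda>(a, b, c, e). mk a b c e) ` T = mons d"
      by (auto simp: mons_def T_def)
  qed
  then have "card (mons d :: 4 mon set) = card T" by (simp add: bij_betw_same_card)
  also have "\<dots> = (\<Sum>a\<le>d. \<Sum>b\<le>d - a. d - a - b + 1)"
    by (simp add: T_def)
  finally show ?thesis .
qed

lemma card_mons_values:
  "card (mons 0 :: 4 mon set) = 1" "card (mons 1 :: 4 mon set) = 4" "card (mons 2 :: 4 mon set) = 10"
  "card (mons 3 :: 4 mon set) = 20" "card (mons 4 :: 4 mon set) = 35" "card (mons 5 :: 4 mon set) = 56"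
  by (simp_all add: card_mons numeral_eq_Suc)

lemma revlex_less_four:
  fixes m n :: "4 mon"
  shows "revlex_less m n \<longleftrightarrow> mon_deg m < mon_deg n \<or> mon_deg m = mon_deg n \<and>
    (lookup m 3 > lookup n 3 \<or> lookup m 3 = lookup n 3 \<and>
    (lookup m 2 > lookup n 2 \<or> lookup m 2 = lookup n 2 \<and>
    (lookup m 1 > lookup n 1 \<or> lookup m 1 = lookup n 1 \<and> lookup m 0 > lookup n 0)))"
proof -
  have "\<not> (1::4) < 0" "\<not> (2::4) < 1" "\<not> (3::4) < 2" "\<not> (2::4) < 0" "\<not> (3::4) < 1" "\<not> (3::4) < 0"
    using four_less by (meson less_asym)+
  with four_less show ?thesis unfolding revlex_less_def ex_four all_four by auto
qed

text \<open>
  The standard monomials: those outside of the ideal generated by the monomials \<open>J_gens\<close> below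
  (see \<open>monom_nonstd_in_J\<close>). The exponents of \<open>x\<^sub>1, x\<^sub>2, x\<^sub>3, x\<^sub>4\<close> have the indices 0 to 3.
\<close>

definition std :: "4 mon set" where
  "std = {m. mon_deg m < 2 \<or> mon_deg m = 2 \<and> (lookup m 3 \<ge> 1 \<or> lookup m 0 = 0 \<and> lookup m 2 \<ge> 1)
     \<or> mon_deg m = 3 \<and> lookup m 3 \<ge> 2 \<or> mon_deg m = 4 \<and> lookup m 3 = 4}"

lemma std_lower_segment:
  assumes "b \<in> std" "n \<notin> std" "mon_deg b = mon_deg n"
  shows "revlex_less b n"
proof -
  have *: "mon_deg n = lookup n 0 + lookup n 1 + lookup n 2 + lookup n 3"
    "mon_deg n = lookup b 0 + lookup b 1 + lookup b 2 + lookup b 3"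
    using assms(3) by (simp_all add: mon_deg_four)
  consider "mon_deg n = 2" | "mon_deg n = 3" | "mon_deg n = 4"
    using assms by (auto simp: std_def)
  then show ?thesis
  proof cases
    case 1
    show ?thesis
    proof (cases "lookup b 3 \<ge> 1")
      case True
      with 1 assms show ?thesis by (simp add: revlex_less_four std_def)
    next
      case False
      then have b: "lookup b 3 = 0" "lookup b 0 = 0" "lookup b 2 \<ge> 1" "lookup b 1 + lookup b 2 = 2"
        using 1 assms * by (auto simp: std_def)
      have n: "lookup n 3 = 0" "lookup n 2 = 0 \<or> lookup n 0 \<ge> 1" "lookup n 0 + lookup n 1 + lookup n 2 = 2"
        using 1 assms * by (auto simp: std_def)
      consider "lookup b 2 > lookup n 2" | "lookup b 2 = lookup n 2" "lookup b 1 > lookup n 1"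
        using b n by linarith
      then show ?thesis by cases (use b n assms(3) in \<open>simp_all add: revlex_less_four\<close>)
    qed
  qed (use assms * in \<open>simp_all add: revlex_less_four std_def\<close>)
qed

lemma revlex_less_asym: "revlex_less m n \<Longrightarrow> \<not> revlex_less n m" for m n :: "4 mon"
  unfolding revlex_less_four by arith

lemma card_std:
  "card (std \<inter> mons 2) \<le> 6" "card (std \<inter> mons 3) \<le> 4" "card (std \<inter> mons 4) \<le> 1"
proof -
  have shift: "m \<in> (\<lambda>n. n + mk 0 0 0 k) ` mons d"
    if "mon_deg m = d + k" "lookup m 3 \<ge> k" for m d k
  proof (intro image_eqI[where x = "mk (lookup m 0) (lookup m 1) (lookup m 2) (lookup m 3 - k)"])
    show "m = mk (lookup m 0) (lookup m 1) (lookup m 2) (lookup m 3 - k) + mk 0 0 0 k"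
      by (rule mon_eqI) (use that in \<open>simp_all add: lookup_add\<close>)
    show "mk (lookup m 0) (lookup m 1) (lookup m 2) (lookup m 3 - k) \<in> mons d"
      using that by (simp add: mons_def mon_deg_four)
  qed
  have c: "card ((\<lambda>n. n + mk 0 0 0 k) ` mons d) \<le> card (mons d :: 4 mon set)" for k d
    by (rule card_image_le[OF finite_mons])
  have "std \<inter> mons 2 \<subseteq> (\<lambda>n. n + mk 0 0 0 1) ` mons 1 \<union> {mk 0 1 1 0, mk 0 0 2 0}"
  proof
    fix m assume m: "m \<in> std \<inter> mons 2"
    show "m \<in> (\<lambda>n. n + mk 0 0 0 1) ` mons 1 \<union> {mk 0 1 1 0, mk 0 0 2 0}"
    proof (cases "lookup m 3 \<ge> 1")
      case True
      with m show ?thesis using shift[of m 1 1] by (auto simp: mons_def)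
    next
      case False
      with m have "lookup m 0 = 0" "lookup m 3 = 0" "lookup m 1 = 1 \<and> lookup m 2 = 1 \<or> lookup m 1 = 0 \<and> lookup m 2 = 2"
        by (auto simp: std_def mons_def mon_deg_four)
      with mk_lookup[of m] show ?thesis by auto
    qed
  qed
  then have "card (std \<inter> mons 2) \<le> card ((\<lambda>n. n + mk 0 0 0 1) ` mons 1 \<union> {mk 0 1 1 0, mk 0 0 2 0})"
    by (rule card_mono[rotated]) (simp add: finite_mons)
  also have "\<dots> \<le> card ((\<lambda>n. n + mk 0 0 0 1) ` mons 1) + card {mk 0 1 1 0, mk 0 0 2 0}"
    by (rule card_Un_le)
  also have "\<dots> \<le> 6" using c[of 1 1] card_mons_values(2) by simp
  finally show "card (std \<inter> mons 2) \<le> 6" .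
  have "std \<inter> mons 3 \<subseteq> (\<lambda>n. n + mk 0 0 0 2) ` mons 1"
    using shift[of _ 1 2] by (auto simp: std_def mons_def)
  then have "card (std \<inter> mons 3) \<le> card ((\<lambda>n. n + mk 0 0 0 2) ` mons 1)"
    by (rule card_mono[rotated]) (simp add: finite_mons)
  then show "card (std \<inter> mons 3) \<le> 4" using c[of 2 1] card_mons_values(2) by simp
  have "std \<inter> mons 4 \<subseteq> (\<lambda>n. n + mk 0 0 0 4) ` mons 0"
    using shift[of _ 0 4] by (auto simp: std_def mons_def)
  then have "card (std \<inter> mons 4) \<le> card ((\<lambda>n. n + mk 0 0 0 4) ` mons 0)"
    by (rule card_mono[rotated]) (simp add: finite_mons)
  then show "card (std \<inter> mons 4) \<le> 1" using c[of 4 0] by (simp add: card_mons_values)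
qed

section \<open>Initial ideals from spanning standard monomials\<close>

interpretation mv: vector_space "\<lambda>(c::'a::field) (p::('v, 'a) mpoly). const c * p"
  by unfold_locales (auto simp: algebra_simps const_add const_mult)

declare mv.scale_scale [simp del]

lemma independent_monom:
  assumes "finite M"
  shows "mv.independent (monom ` M :: ('v, 'a::field) mpoly set)"
proof (rule mv.independent_if_scalars_zero)
  show "finite (monom ` M :: ('v, 'a) mpoly set)" using assms by simp
  fix f :: "('v, 'a) mpoly \<Rightarrow> 'a" and x :: "('v, 'a) mpoly"
  assume s: "(\<Sum>x\<in>monom ` M. const (f x) * x) = 0" and x: "x \<in> monom ` M"
  then obtain m where m: "m \<in> M" "x = monom m" by auto
  have inj: "inj_on (monom :: 'v mon \<Rightarrow> ('v, 'a) mpoly) M" by (rule inj_on_subset[OF inj_monom]) simp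
  have "(\<Sum>m\<in>M. const (f (monom m)) * monom m) = 0"
    using s unfolding sum.reindex[OF inj] o_def .
  then have "lookup (\<Sum>m\<in>M. const (f (monom m)) * monom m) m = 0" by simp
  with m show "f x = 0" using assms by (simp add: lookup_sum_monom)
qed

lemma card_monom: "card (monom ` M :: ('v, 'a::comm_ring_1) mpoly set) = card M"
  by (rule card_image[OF inj_on_subset[OF inj_monom subset_UNIV]])

lemma span_monom:
  fixes p :: "('v, 'a::field) mpoly"
  assumes "finite M"
  shows "p \<in> mv.span (monom ` M) \<longleftrightarrow> keys p \<subseteq> M"
proof
  show "keys p \<subseteq> M" if "p \<in> mv.span (monom ` M)"
    using that
  proof (induction rule: mv.span_induct_alt)
    case base
    show ?case by simp
  next
    case (step c x y)
    then show ?case by (auto simp: in_keys_iff lookup_add lookup_const_mult lookup_monom split: if_splits)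
  qed
  show "p \<in> mv.span (monom ` M)" if "keys p \<subseteq> M"
    by (subst mpoly_eq_sum_superset[OF assms that]) (intro mv.span_sum mv.span_scale mv.span_base imageI)
qed

lemma span_monom_mons: "mv.span (monom ` mons d) = {p :: ('v::finite, 'a::field) mpoly. homogeneous d p}"
  unfolding set_eq_iff span_monom[OF finite_mons] mem_Collect_eq
  by (auto simp: homogeneous_def mons_def)

text \<open>
  Counting: if the forms of degree \<open>d\<close> are spanned by \<open>G\<close> and the monomials in \<open>B\<close>, and no more
  elements are used than there are monomials of degree \<open>d\<close>, then the span of \<open>G\<close> meets the span
  of \<open>B\<close> in 0 only.
\<close>

lemma span_count:
  fixes p :: "('v::finite, 'a::field) mpoly"
  assumes G: "finite G" and B: "B \<subseteq> mons d"
    and sp: "\<And>u. homogeneous d u \<Longrightarrow> u \<in> mv.span (G \<union> monom ` B)"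
    and count: "card G + card B \<le> card (mons d :: 'v mon set)"
    and p: "p \<in> mv.span G" "keys p \<subseteq> B"
  shows "p = 0"
proof (rule ccontr)
  assume "p \<noteq> 0"
  then obtain b where b: "b \<in> keys p" by (metis ex_in_conv keys_eq_empty)
  have finB: "finite B" using B finite_mons finite_subset by blast
  define H where "H = G \<union> monom ` (B - {b})"
  define r where "r = (\<Sum>m\<in>B - {b}. const (lookup p m) * monom m)"
  have "p = (\<Sum>m\<in>B. const (lookup p m) * monom m)" using mpoly_eq_sum_superset[OF finB p(2)] .
  also have "\<dots> = const (lookup p b) * monom b + r"
    unfolding r_def using b p(2) by (intro sum.remove finB) auto
  finally have "const (lookup p b) * monom b = p - r" by (metis add_diff_cancel_right')
  then have "const (inverse (lookup p b)) * (const (lookup p b) * monom b) = const (inverse (lookup p b)) * (p - r)"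
    by simp
  then have "monom b = const (inverse (lookup p b)) * (p - r)"
    using b by (simp add: mult.assoc[symmetric] const_mult[symmetric] in_keys_iff)
  moreover have "p \<in> mv.span H" using p(1) mv.span_mono[of G H] by (auto simp: H_def)
  moreover have "r \<in> mv.span H"
    unfolding r_def by (intro mv.span_sum mv.span_scale mv.span_base) (auto simp: H_def)
  ultimately have "monom b \<in> mv.span H" by (simp add: mv.span_scale mv.span_diff)
  then have "G \<union> monom ` B \<subseteq> mv.span H" by (auto simp: H_def intro: mv.span_base)
  then have "mv.span (G \<union> monom ` B) \<subseteq> mv.span H" by (metis mv.span_minimal mv.subspace_span)
  then have "monom ` (mons d :: 'v mon set) \<subseteq> mv.span H"
    using sp by (auto simp: mons_def homogeneous_monom)
  then have "card (monom ` mons d :: ('v, 'a) mpoly set) \<le> card H"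
    using mv.independent_span_bound[OF _ independent_monom[OF finite_mons], of H d] G finB
    by (simp add: H_def)
  moreover have "card (monom ` mons d :: ('v, 'a) mpoly set) = card (mons d :: 'v mon set)"
    by (rule card_monom)
  moreover have "card H \<le> card G + card (B - {b})"
    unfolding H_def by (rule order_trans[OF card_Un_le]) (simp add: card_image_le finB)
  moreover have "card (B - {b}) < card B"
    using b p(2) finB by (intro psubset_card_mono) auto
  ultimately show False using count by linarith
qed

text \<open>
  The standard monomials span the quotient ring in degrees 2 to 5. In degrees 0 and 1 every
  monomial is standard, and in degrees from 5 on none is.
\<close>

definition good :: "(4, 'a::field) mpoly set \<Rightarrow> bool" where
  "good I \<longleftrightarrow> (\<forall>d\<in>{2, 3, 4, 5}. spans_mod I std d)"

lemma goodE:
  assumes "good I" "d \<in> {2, 3, 4, 5}" "homogeneous d u"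
  obtains b where "homogeneous d b" "keys b \<subseteq> std" "u - b \<in> I"
  using assms unfolding good_def spans_mod_def by blast

text \<open>
  For four quadrics, if the standard monomials span the quotient ring, they are independent there:
  the components of degree 2, 3, 4 of the ideal are spanned by 4, 16 and 34 elements, which are
  the numbers of nonstandard monomials of these degrees.
\<close>

lemma std_independent:
  fixes g :: "4 \<Rightarrow> (4, 'a::field) mpoly"
  assumes g: "\<And>i. homogeneous 2 (g i)" and good: "good (ideal_gen (range g))"
    and p: "p \<in> ideal_gen (range g)" "homogeneous d p" "keys p \<subseteq> std"
  shows "p = 0"
proof -
  let ?I = "ideal_gen (range g)"
  have fin: "finite (std \<inter> mons k)" for k by (simp add: finite_mons)
  have pB: "keys p \<subseteq> std \<inter> mons d" using p by (auto simp: homogeneous_def mons_def)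
  have main: "p = 0" if G: "finite G" "\<And>q. q \<in> ?I \<Longrightarrow> homogeneous d q \<Longrightarrow> q \<in> mv.span G"
    and d: "d \<in> {2, 3, 4, 5}"
    and count: "card G + card (std \<inter> mons d) \<le> card (mons d :: 4 mon set)" for G
  proof (rule span_count[OF G(1) _ _ count G(2)[OF p(1,2)] pB])
    show "std \<inter> mons d \<subseteq> mons d" by simp
    fix u :: "(4, 'a) mpoly" assume u: "homogeneous d u"
    obtain b where b: "homogeneous d b" "keys b \<subseteq> std" "u - b \<in> ?I"
      by (rule goodE[OF good d u])
    then have "b \<in> mv.span (monom ` (std \<inter> mons d))"
      by (subst span_monom[OF fin]) (auto simp: homogeneous_def mons_def)
    moreover have "u - b \<in> mv.span G" using G(2) b u by (simp add: homogeneous_diff)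
    ultimately have "(u - b) + b \<in> mv.span (G \<union> monom ` (std \<inter> mons d))"
      using mv.span_mono[of G "G \<union> monom ` (std \<inter> mons d)"]
        mv.span_mono[of "monom ` (std \<inter> mons d)" "G \<union> monom ` (std \<inter> mons d)"]
      by (intro mv.span_add) auto
    then show "u \<in> mv.span (G \<union> monom ` (std \<inter> mons d))" by simp
  qed
  have ex: "\<exists>q. (\<forall>i. homogeneous (k - 2) (q i)) \<and> r = (\<Sum>i\<in>UNIV. q i * g i)"
    if "r \<in> ?I" "homogeneous k r" "2 \<le> k" for r k
    using homogeneous_in_ideal_gen_range[OF g that] by metis
  have deg2: "q \<in> mv.span (range g)" if q: "q \<in> ?I" "homogeneous 2 q" for q
  proof -
    obtain c where c: "\<forall>i. homogeneous 0 (c i)" "q = (\<Sum>i\<in>UNIV. c i * g i)" using ex[OF q] by auto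
    have "c i * g i \<in> mv.span (range g)" for i
      by (subst homogeneous_0_const[of "c i"]) (use c in \<open>auto intro: mv.span_scale mv.span_base\<close>)
    then show ?thesis by (simp add: c(2) mv.span_sum)
  qed
  consider "d < 2" | "d = 2" | "d = 3" | "d = 4" | "d \<ge> 5" by linarith
  then show ?thesis
  proof cases
    case 1
    then show ?thesis using ideal_low_degree[OF _ p(1,2)] g by blast
  next
    case 2
    show ?thesis
    proof (rule main)
      have "card (range g) \<le> card (UNIV :: 4 set)" by (rule card_image_le) simp
      then show "card (range g) + card (std \<inter> mons d) \<le> card (mons d :: 4 mon set)"
        using card_std(1) 2 by (simp add: card_mons_values)
    qed (use deg2 2 in auto)
  next
    case 3
    let ?G = "(\<lambda>(i, k). X k * g i) ` (UNIV :: (4 \<times> 4) set)"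
    show ?thesis
    proof (rule main)
      have "card ?G \<le> card (UNIV :: (4 \<times> 4) set)" by (rule card_image_le) simp
      then show "card ?G + card (std \<inter> mons d) \<le> card (mons d :: 4 mon set)"
        using card_std(2) 3 by (simp add: card_mons_values)
    next
      fix r assume "r \<in> ?I" "homogeneous d r"
      with 3 obtain q where q: "\<forall>i. homogeneous 1 (q i)" "r = (\<Sum>i\<in>UNIV. q i * g i)"
        using ex[of r 3] by auto
      have lin: "monom m * g i \<in> mv.span ?G" if m: "m \<in> mons 1" for m i
      proof -
        from m have "mon_deg m = 1" by (simp add: mons_def)
        then obtain k where "m = Poly_Mapping.single k 1" by (rule mon_deg_1E)
        then have "monom m * g i = X k * g i" by (simp add: X_def)
        then show ?thesis by (simp only:) (intro mv.span_base image_eqI[of _ _ "(i, k)"]; simp)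
      qed
      have "q i * g i \<in> mv.span ?G" for i
        by (subst homogeneous_eq_sum[of 1 "q i"])
           (use q lin in \<open>auto simp: sum_distrib_right mult.assoc intro!: mv.span_sum mv.span_scale\<close>)
      then show "r \<in> mv.span ?G" by (simp add: q(2) mv.span_sum)
    qed (use 3 in auto)
  next
    case 4
    \<comment> \<open>The commutation of \<open>g\<^sub>i\<close> and \<open>g\<^sub>j\<close>, that is the six Koszul relations, saves six generators.\<close>
    let ?L = "[g 0 * g 0, g 0 * g 1, g 0 * g 2, g 0 * g 3, g 1 * g 1, g 1 * g 2, g 1 * g 3,
       g 2 * g 2, g 2 * g 3, g 3 * g 3]"
    let ?M = "(\<lambda>(i, m). monom m * g i) ` (UNIV \<times> (std \<inter> mons 2))"
    have L: "g i * g j \<in> set ?L" for i j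
      by (cases i rule: four_cases; cases j rule: four_cases) (simp_all add: mult.commute)
    show ?thesis
    proof (rule main[of "set ?L \<union> ?M"])
      have "card ?M \<le> card ((UNIV :: 4 set) \<times> (std \<inter> mons 2))"
        by (rule card_image_le) (simp add: finite_mons)
      then have "card ?M \<le> 24" using card_std(1) by (simp add: card_cartesian_product)
      moreover have "card (set ?L) \<le> 10" using card_length[of ?L] by simp
      moreover have "card (set ?L \<union> ?M) \<le> card (set ?L) + card ?M" by (rule card_Un_le)
      ultimately have "card (set ?L \<union> ?M) \<le> 34" by linarith
      then show "card (set ?L \<union> ?M) + card (std \<inter> mons d) \<le> card (mons d :: 4 mon set)"
        using card_std(3) 4 by (simp only: card_mons_values)
      fix r assume "r \<in> ?I" "homogeneous d r"
      with 4 obtain q where q: "\<forall>i. homogeneous 2 (q i)" "r = (\<Sum>i\<in>UNIV. q i * g i)"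
        using ex[of r 4] by auto
      have "q i * g i \<in> mv.span (set ?L \<union> ?M)" for i
      proof -
        obtain b where b: "homogeneous 2 b" "keys b \<subseteq> std" "q i - b \<in> ?I"
          by (rule goodE[OF good, of 2 "q i"]) (use q(1) in auto)
        obtain c where c: "\<forall>j. homogeneous 0 (c j)" "q i - b = (\<Sum>j\<in>UNIV. c j * g j)"
          using ex[OF b(3) homogeneous_diff[of 2]] q(1) b(1) by auto
        have b': "b = (\<Sum>m\<in>std \<inter> mons 2. const (lookup b m) * monom m)"
          by (rule mpoly_eq_sum_superset[OF fin]) (use b in \<open>auto simp: homogeneous_def mons_def\<close>)
        have "b * g i \<in> mv.span (set ?L \<union> ?M)"
        proof (subst b', unfold sum_distrib_right mult.assoc, intro mv.span_sum mv.span_scale mv.span_base UnI2)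
          fix m assume "m \<in> std \<inter> mons 2"
          then show "monom m * g i \<in> ?M" by (intro image_eqI[of _ _ "(i, m)"]) auto
        qed
        moreover have "c j * g j * g i \<in> mv.span (set ?L \<union> ?M)" for j
        proof -
          have "c j * g j * g i = const (lookup (c j) 0) * (g j * g i)"
            using homogeneous_0_const[of "c j"] c(1) by (metis mult.assoc)
          moreover have "const (lookup (c j) 0) * (g j * g i) \<in> mv.span (set ?L \<union> ?M)"
            using L by (intro mv.span_scale mv.span_base UnI1)
          ultimately show ?thesis by (simp only:)
        qed
        then have "(q i - b) * g i \<in> mv.span (set ?L \<union> ?M)"
          unfolding c(2) sum_distrib_right by (intro mv.span_sum)
        ultimately have "(q i - b) * g i + b * g i \<in> mv.span (set ?L \<union> ?M)" by (rule mv.span_add[rotated])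
        then show ?thesis by (simp add: algebra_simps)
      qed
      then show "r \<in> mv.span (set ?L \<union> ?M)" unfolding q(2) by (intro mv.span_sum)
    qed (simp_all add: 4 fin)
  next
    case 5
    then have "std \<inter> mons d = {}" by (auto simp: std_def mons_def)
    with pB show ?thesis by simp
  qed
qed

text \<open>The monomial generators of the ideal of nonstandard monomials.\<close>

definition J_gens :: "4 mon set" where
  "J_gens = {mk 2 0 0 0, mk 1 1 0 0, mk 0 2 0 0, mk 1 0 1 0, mk 0 1 2 0, mk 0 0 3 0, mk 0 1 1 1,
     mk 0 0 2 1, mk 1 0 0 3, mk 0 1 0 3, mk 0 0 1 3, mk 0 0 0 5}"

lemma monom_nonstd_in_J:
  assumes "m \<notin> std"
  shows "monom m \<in> ideal_gen (monom ` J_gens :: (4, 'a::field) mpoly set)"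
proof -
  obtain a b c e where m: "m = mk a b c e" using mk_lookup by metis
  have div: "monom m \<in> ideal_gen (monom ` J_gens :: (4, 'a) mpoly set)"
    if "mk a' b' c' e' \<in> J_gens" "a' \<le> a" "b' \<le> b" "c' \<le> c" "e' \<le> e" for a' b' c' e'
  proof -
    have "m = mk (a - a') (b - b') (c - c') (e - e') + mk a' b' c' e'"
      using that by (simp add: m mk_add)
    then have "(monom m :: (4, 'a) mpoly) = monom (mk (a - a') (b - b') (c - c') (e - e')) * monom (mk a' b' c' e')"
      by (simp add: monom_add)
    then show ?thesis using that(1) by (simp add: ideal_mult ideal_base)
  qed
  have "2 \<le> a \<or> 1 \<le> a \<and> 1 \<le> b \<or> 2 \<le> b \<or> 1 \<le> a \<and> 1 \<le> c \<or> 1 \<le> b \<and> 2 \<le> c \<or> 3 \<le> c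
     \<or> 1 \<le> b \<and> 1 \<le> c \<and> 1 \<le> e \<or> 2 \<le> c \<and> 1 \<le> e \<or> 1 \<le> a \<and> 3 \<le> e \<or> 1 \<le> b \<and> 3 \<le> e
     \<or> 1 \<le> c \<and> 3 \<le> e \<or> 5 \<le> e"
  proof (rule ccontr)
    assume *: "\<not> ?thesis"
    then have "\<not> 2 \<le> a" "\<not> 2 \<le> b" "\<not> 3 \<le> c" "\<not> 5 \<le> e" by blast+
    then have "a = 0 \<or> a = 1" "b = 0 \<or> b = 1" "c = 0 \<or> c = 1 \<or> c = 2"
      "e = 0 \<or> e = 1 \<or> e = 2 \<or> e = 3 \<or> e = 4" by linarith+
    with * assms show False unfolding std_def m by (elim disjE) simp_all
  qed
  moreover have "2 \<le> a \<Longrightarrow> ?thesis" by (rule div[of 2 0 0 0]) (simp_all add: J_gens_def)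
  moreover have "1 \<le> a \<Longrightarrow> 1 \<le> b \<Longrightarrow> ?thesis" by (rule div[of 1 1 0 0]) (simp_all add: J_gens_def)
  moreover have "2 \<le> b \<Longrightarrow> ?thesis" by (rule div[of 0 2 0 0]) (simp_all add: J_gens_def)
  moreover have "1 \<le> a \<Longrightarrow> 1 \<le> c \<Longrightarrow> ?thesis" by (rule div[of 1 0 1 0]) (simp_all add: J_gens_def)
  moreover have "1 \<le> b \<Longrightarrow> 2 \<le> c \<Longrightarrow> ?thesis" by (rule div[of 0 1 2 0]) (simp_all add: J_gens_def)
  moreover have "3 \<le> c \<Longrightarrow> ?thesis" by (rule div[of 0 0 3 0]) (simp_all add: J_gens_def)
  moreover have "1 \<le> b \<Longrightarrow> 1 \<le> c \<Longrightarrow> 1 \<le> e \<Longrightarrow> ?thesis"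
    by (rule div[of 0 1 1 1]) (simp_all add: J_gens_def)
  moreover have "2 \<le> c \<Longrightarrow> 1 \<le> e \<Longrightarrow> ?thesis" by (rule div[of 0 0 2 1]) (simp_all add: J_gens_def)
  moreover have "1 \<le> a \<Longrightarrow> 3 \<le> e \<Longrightarrow> ?thesis" by (rule div[of 1 0 0 3]) (simp_all add: J_gens_def)
  moreover have "1 \<le> b \<Longrightarrow> 3 \<le> e \<Longrightarrow> ?thesis" by (rule div[of 0 1 0 3]) (simp_all add: J_gens_def)
  moreover have "1 \<le> c \<Longrightarrow> 3 \<le> e \<Longrightarrow> ?thesis" by (rule div[of 0 0 1 3]) (simp_all add: J_gens_def)
  moreover have "5 \<le> e \<Longrightarrow> ?thesis" by (rule div[of 0 0 0 5]) (simp_all add: J_gens_def)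
  ultimately show ?thesis by blast
qed

text \<open>
  A nonstandard monomial of degree at most 5 minus its standard representative has this monomial as
  its leading monomial. Conversely, if a leading monomial is standard, so is every monomial of the
  homogeneous component of the polynomial in the same degree, which is then 0.
\<close>

lemma initial_ideal_eq:
  fixes g :: "4 \<Rightarrow> (4, 'a::field) mpoly"
  assumes g: "\<And>i. homogeneous 2 (g i)" and good: "good (ideal_gen (range g))"
  shows "initial_ideal (ideal_gen (range g)) = ideal_gen (monom ` J_gens)"
proof
  let ?I = "ideal_gen (range g)"
  have "monom m \<in> ideal_gen (monom ` J_gens :: (4, 'a) mpoly set)"
    if f: "f \<in> ?I" and m: "is_leading_mon f m" for f m
  proof (rule monom_nonstd_in_J, rule notI)
    assume std: "m \<in> std"
    let ?p = "hcomp (mon_deg m) f"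
    have "?p \<in> ?I" by (rule hcomp_ideal[OF _ f]) (use g in auto)
    moreover have "keys ?p \<subseteq> std"
    proof
      fix n assume n: "n \<in> keys ?p"
      show "n \<in> std"
      proof (rule ccontr)
        assume nn: "n \<notin> std"
        with std n have "revlex_less m n"
          by (intro std_lower_segment) (auto simp: in_keys_iff lookup_hcomp split: if_splits)
        moreover have "revlex_less n m"
          using m n nn std by (auto simp: is_leading_mon_def in_keys_iff lookup_hcomp split: if_splits)
        ultimately show False using revlex_less_asym by blast
      qed
    qed
    ultimately have "?p = 0" using std_independent[OF g good _ homogeneous_hcomp] by blast
    then have "lookup ?p m = 0" by simp
    then show False using m by (simp add: lookup_hcomp is_leading_mon_def in_keys_iff)
  qed
  then show "initial_ideal ?I \<subseteq> ideal_gen (monom ` J_gens)"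
    unfolding initial_ideal_def by (intro ideal_gen_subset) auto
  have "monom n \<in> initial_ideal ?I" if n: "n \<in> J_gens" for n
  proof -
    have n': "n \<notin> std" "mon_deg n \<in> {2, 3, 4, 5}" using n by (auto simp: J_gens_def std_def)
    obtain b where b: "homogeneous (mon_deg n) b" "keys b \<subseteq> std" "monom n - b \<in> ?I"
      by (rule goodE[OF good n'(2) homogeneous_monom[OF refl]])
    have "lookup b n = 0" using b(2) n'(1) by (auto simp: in_keys_iff)
    moreover have "revlex_less k n" if "lookup b k \<noteq> 0" for k
      using that b n' by (intro std_lower_segment) (auto simp: in_keys_iff homogeneous_def)
    ultimately have "is_leading_mon (monom n - b) n"
      by (auto simp: is_leading_mon_def in_keys_iff lookup_minus lookup_monom)
    with b(3) show ?thesis unfolding initial_ideal_def by (intro ideal_base) auto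
  qed
  then show "ideal_gen (monom ` J_gens) \<subseteq> initial_ideal ?I"
    unfolding initial_ideal_def by (intro ideal_gen_subset) auto
qed

section \<open>Generic initial ideals from one good coordinate system\<close>

lemma good_open:
  fixes g0 :: "4 \<Rightarrow> (4, 'a::field) mpoly"
  assumes g0: "\<And>i. homogeneous 2 (g0 i)" and good: "good (ideal_gen (range g0))"
  obtains P where "insertion id (coords g0) P \<noteq> 0"
    "\<And>g. (\<And>i. homogeneous 2 (g i)) \<Longrightarrow> insertion id (coords g) P \<noteq> 0 \<Longrightarrow> good (ideal_gen (range g))"
proof -
  have "\<exists>P. insertion id (coords g0) P \<noteq> 0 \<and>
     (\<forall>g. (\<forall>i. homogeneous 2 (g i)) \<longrightarrow> insertion id (coords g) P \<noteq> 0 \<longrightarrow>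
        spans_mod (ideal_gen (range g)) std d)" if d: "d \<in> {2, 3, 4, 5}" for d
    by (rule spans_mod_open[OF g0]) (use good d in \<open>auto simp: good_def\<close>)
  then obtain P where P: "\<And>d. d \<in> {2, 3, 4, 5} \<Longrightarrow> insertion id (coords g0) (P d) \<noteq> 0"
     "\<And>d g. d \<in> {2, 3, 4, 5} \<Longrightarrow> (\<forall>i. homogeneous 2 (g i)) \<Longrightarrow> insertion id (coords g) (P d) \<noteq> 0 \<Longrightarrow>
        spans_mod (ideal_gen (range g)) std d" by metis
  have prod: "insertion id (coords g) (\<Prod>d\<in>{2, 3, 4, 5}. P d)
      = (\<Prod>d\<in>{2, 3, 4, 5}. insertion id (coords g) (P d))" for g
    by (rule is_homD(9)[OF is_hom_insertion[OF is_hom_id]])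
  show ?thesis
  proof (rule that[of "\<Prod>d\<in>{2, 3, 4, 5}. P d"])
    show "insertion id (coords g0) (\<Prod>d\<in>{2, 3, 4, 5}. P d) \<noteq> 0"
      unfolding prod using P(1) by (subst prod_zero_iff) auto
    fix g :: "4 \<Rightarrow> (4, 'a) mpoly"
    assume g: "\<And>i. homogeneous 2 (g i)" and "insertion id (coords g) (\<Prod>d\<in>{2, 3, 4, 5}. P d) \<noteq> 0"
    then have "\<forall>d\<in>{2, 3, 4, 5}. insertion id (coords g) (P d) \<noteq> 0"
      unfolding prod by (subst (asm) prod_zero_iff) auto
    then show "good (ideal_gen (range g))"
      unfolding good_def using P(2) g by blast
  qed
qed

lemma lookup_insertion_coeff:
  assumes h: "is_hom h"
  shows "lookup (insertion (const \<circ> h) X p) m = h (lookup p m)"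
proof -
  have "insertion (const \<circ> h) X p = (\<Sum>n\<in>keys p. const (h (lookup p n)) * monom n)"
    by (simp add: insertion_def mon_val_def[symmetric] mon_val_X)
  then show ?thesis
    using is_homD(1)[OF h] by (simp add: lookup_sum_monom in_keys_iff)
qed

text \<open>The coordinates of a matrix are its entries.\<close>

definition entries :: "'a ^ 'n ^ 'n \<Rightarrow> 'n \<times> 'n \<Rightarrow> 'a" where
  "entries A = (\<lambda>(i, j). A $ i $ j)"

text \<open>
  The coefficients of the transformed polynomial are polynomials in the entries of the matrix:
  transform by the generic matrix, whose entries are variables, and specialize the coefficients.
\<close>

lemma lin_act_generic:
  fixes f :: "('n::finite, 'a::field) mpoly"
  obtains F :: "'n mon \<Rightarrow> ('n \<times> 'n, 'a) mpoly" where
    "\<And>A m. lookup (lin_act A f) m = insertion id (entries A) (F m)"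
proof -
  \<comment> \<open>The polynomial transformed by the generic matrix, with coefficients in a polynomial ring.\<close>
  define F :: "('n, ('n \<times> 'n, 'a) mpoly) mpoly" where
    "F = insertion (const \<circ> const) (\<lambda>j. \<Sum>i\<in>UNIV. const (X (i, j)) * X i) f"
  have "lookup (lin_act A f) m = insertion id (entries A) (lookup F m)" for A m
  proof -
    let ?h = "insertion id (entries A) :: ('n \<times> 'n, 'a) mpoly \<Rightarrow> 'a"
    have h: "is_hom ?h" by (rule is_hom_insertion) simp
    let ?g = "insertion (const \<circ> ?h) X :: ('n, ('n \<times> 'n, 'a) mpoly) mpoly \<Rightarrow> ('n, 'a) mpoly"
    have ch: "is_hom (const \<circ> ?h :: _ \<Rightarrow> ('n, 'a) mpoly)" by (rule is_hom_comp[OF is_hom_const h])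
    have g: "is_hom ?g" by (rule is_hom_insertion[OF ch])
    have gc: "?g (const c) = const (?h c)" for c by (simp add: insertion_const[OF ch])
    have "?g F = insertion (?g \<circ> (const \<circ> const)) (\<lambda>j. ?g (\<Sum>i\<in>UNIV. const (X (i, j)) * X i)) f"
      unfolding F_def by (rule hom_insertion[OF g]) (rule is_hom_comp; simp)
    also have "?g \<circ> (const \<circ> const) = const"
      by (auto simp: gc insertion_const)
    also have "(\<lambda>j. ?g (\<Sum>i\<in>UNIV. const (X (i, j)) * X i)) = (\<lambda>j. \<Sum>i\<in>UNIV. const (A $ i $ j) * X i)"
      unfolding is_homD[OF g] gc insertion_X[OF ch] insertion_X[OF is_hom_id] by (simp add: entries_def)
    finally have "?g F = lin_act A f" unfolding lin_act_def .
    then show ?thesis using lookup_insertion_coeff[OF h, of F m] by simp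
  qed
  then show ?thesis by (rule that)
qed

lemma surj_lin_act:
  assumes "invertible A"
  shows "surj (lin_act A :: ('n::finite, 'a::field) mpoly \<Rightarrow> ('n, 'a) mpoly)"
proof -
  obtain B where "A ** B = mat 1" using assms by (auto simp: invertible_def)
  then have "lin_act A (lin_act B f) = f" for f :: "('n, 'a) mpoly"
    by (simp add: lin_act_mult_matrix lin_act_mat_1)
  then show ?thesis by (metis surj_def)
qed

lemma generic_initial_ideal_if_good:
  fixes f :: "4 \<Rightarrow> (4, 'a::field) mpoly"
  assumes f: "\<And>i. homogeneous 2 (f i)" and A: "invertible A"
    and good: "good (ideal_gen (range (\<lambda>i. lin_act A (f i))))"
  shows "is_generic_initial_ideal (ideal_gen (range f)) (ideal_gen (monom ` J_gens))"
proof -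
  have hom: "homogeneous 2 (lin_act A (f i))" for A i by (rule homogeneous_lin_act[OF f])
  obtain P where P: "insertion id (coords (\<lambda>i. lin_act A (f i))) P \<noteq> 0"
    "\<And>g. (\<And>i. homogeneous 2 (g i)) \<Longrightarrow> insertion id (coords g) P \<noteq> 0 \<Longrightarrow> good (ideal_gen (range g))"
    using good_open[OF hom good] by blast
  have "\<exists>F. \<forall>A m. lookup (lin_act A (f i)) m = insertion id (entries A) (F m)" for i
    using lin_act_generic[of "f i"] by metis
  then obtain F where F: "\<And>i A m. lookup (lin_act A (f i)) m = insertion id (entries A) (F i m)"
    by metis
  define Q where "Q = insertion const (\<lambda>(i, m). F i m) P"
  have Q: "insertion id (entries A) Q = insertion id (coords (\<lambda>i. lin_act A (f i))) P" for A
    unfolding Q_def by (subst insertion_insertion) (auto simp: coords_def F split_def)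
  define U where "U = {A \<in> {A. invertible A}. \<exists>p\<in>{Q}. insertion id (entries A) p \<noteq> 0}"
  have "zariski_open_GL U"
    unfolding zariski_open_GL_def zariski_open_in_def U_def entries_def by blast
  moreover have "A \<in> U" using A P(1) by (simp add: U_def Q)
  moreover have "initial_ideal (lin_act B ` ideal_gen (range f)) = ideal_gen (monom ` J_gens)"
    if "B \<in> U" for B
  proof -
    have B: "invertible B" "insertion id (coords (\<lambda>i. lin_act B (f i))) P \<noteq> 0"
      using that by (auto simp: U_def Q)
    have "good (ideal_gen (range (\<lambda>i. lin_act B (f i))))" by (rule P(2)[OF hom B(2)])
    then have "initial_ideal (ideal_gen (range (\<lambda>i. lin_act B (f i)))) = ideal_gen (monom ` J_gens)"
      by (rule initial_ideal_eq[OF hom])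
    then show ?thesis by (simp add: hom_image_ideal[OF lin_act_hom surj_lin_act[OF B(1)]])
  qed
  ultimately show ?thesis unfolding is_generic_initial_ideal_def by blast
qed

lemma generic_sequence_if_good:
  fixes g0 :: "4 \<Rightarrow> (4, 'a::field) mpoly"
  assumes g0: "\<And>i. homogeneous 2 (g0 i)" and good: "good (ideal_gen (range g0))"
  shows "generic_sequence 2 (\<lambda>f :: 4 \<Rightarrow> (4, 'a) mpoly.
    is_generic_initial_ideal (ideal_gen (range f)) (ideal_gen (monom ` J_gens)))"
proof -
  obtain P where P: "insertion id (coords g0) P \<noteq> 0"
    "\<And>g. (\<And>i. homogeneous 2 (g i)) \<Longrightarrow> insertion id (coords g) P \<noteq> 0 \<Longrightarrow> good (ideal_gen (range g))"
    using good_open[OF g0 good] by blast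
  define U where "U = {f \<in> {f. \<forall>i. homogeneous 2 (f i)}. \<exists>p\<in>{P}. insertion id (coords f) p \<noteq> 0}"
  have "zariski_open_in {f :: 4 \<Rightarrow> (4, 'a) mpoly. \<forall>i. homogeneous 2 (f i)}
      (\<lambda>f (i, m). lookup (f i) m) U"
    unfolding zariski_open_in_def U_def coords_def by blast
  moreover have "g0 \<in> U" using g0 P(1) by (simp add: U_def)
  moreover have "is_generic_initial_ideal (ideal_gen (range f)) (ideal_gen (monom ` J_gens))"
    if f: "f \<in> U" for f
  proof (rule generic_initial_ideal_if_good)
    show "homogeneous 2 (f i)" for i using f by (simp add: U_def)
    show "invertible (mat 1 :: 'a ^ 4 ^ 4)" by (auto simp: invertible_def)
    show "good (ideal_gen (range (\<lambda>i. lin_act (mat 1) (f i))))"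
      unfolding lin_act_mat_1 by (rule P(2)) (use f in \<open>auto simp: U_def\<close>)
  qed
  ultimately show ?thesis unfolding generic_sequence_def by blast
qed

section \<open>Degeneration of triangular systems\<close>

text \<open>
  The variables get the weights 0, 1, 2, 3; it only matters that they are increasing.
\<close>

definition weight :: "4 \<Rightarrow> nat" where
  "weight i = (if i = 0 then 0 else if i = 1 then 1 else if i = 2 then 2 else 3)"

lemma weight_simps [simp]: "weight 0 = 0" "weight 1 = 1" "weight 2 = 2" "weight 3 = 3"
  by (simp_all add: weight_def)

text \<open>The weight of a monomial.\<close>

definition mon_weight :: "4 mon \<Rightarrow> nat" where
  "mon_weight m = lookup m 1 + 2 * lookup m 2 + 3 * lookup m 3"

text \<open>The substitution that multiplies every variable by the power of \<open>t\<close> given by its weight.\<close>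

definition torus :: "'a::field \<Rightarrow> 'a ^ 4 ^ 4" where
  "torus t = (\<chi> i j. if i = j then t ^ weight i else 0)"

lemma lin_act_torus: "lin_act (torus t) (monom m) = const (t ^ mon_weight m) * monom m"
proof -
  have X: "lin_act (torus t) (X j) = const (t ^ weight j) * X j" for j
  proof -
    have "const (torus t $ i $ j) * X i = (if i = j then const (t ^ weight j) * X j else 0)" for i
      by (simp add: torus_def)
    then show ?thesis unfolding lin_act_X by simp
  qed
  obtain a b c e where m: "m = mk a b c e" using mk_lookup by metis
  have "lin_act (torus t) (monom m) = const ((t ^ weight 0) ^ a * (t ^ weight 1) ^ b * (t ^ weight 2) ^ c *
      (t ^ weight 3) ^ e) * (X 0 ^ a * X 1 ^ b * X 2 ^ c * X 3 ^ e)"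
    unfolding m monom_mk is_homD[OF lin_act_hom] X const_mult const_power power_mult_distrib
    by (simp only: mult_ac)
  also have "(t ^ weight 0) ^ a * (t ^ weight 1) ^ b * (t ^ weight 2) ^ c * (t ^ weight 3) ^ e = t ^ mon_weight m"
    by (simp add: m mon_weight_def power_add power_mult)
  finally show ?thesis by (simp only: m monom_mk)
qed

lemma invertible_torus: "t \<noteq> 0 \<Longrightarrow> invertible (torus t)"
  by (subst invertible_det_nz, subst det_diagonal) (auto simp: torus_def prod_zero_iff)

text \<open>
  Among the monomials of degree 2 in the variables from the \<open>i\<close>-th one on, the square of the
  \<open>i\<close>-th variable is the only one of least weight.
\<close>

lemma triangular_weight:
  fixes m :: "4 mon"
  assumes m: "mon_deg m = 2" and i: "\<And>j. lookup m j \<noteq> 0 \<Longrightarrow> i \<le> j"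
  shows "m = Poly_Mapping.single i 2 \<or> mon_weight m > 2 * weight i"
proof -
  have z: "lookup m j = 0" if "j < i" for j using i[of j] that leD by blast
  show ?thesis
  proof (cases "\<exists>j. j \<noteq> i \<and> lookup m j \<noteq> 0")
    case True
    then obtain j where j: "j \<noteq> i" "lookup m j \<noteq> 0" by blast
    have nz: "i \<noteq> 0 \<and> lookup m 0 \<noteq> 0 \<or> i \<noteq> 1 \<and> lookup m 1 \<noteq> 0 \<or> i \<noteq> 2 \<and> lookup m 2 \<noteq> 0 \<or>
        i \<noteq> 3 \<and> lookup m 3 \<noteq> 0"
      by (cases j rule: four_cases) (use j in auto)
    have deg: "lookup m 0 + lookup m 1 + lookup m 2 + lookup m 3 = 2" using m by (simp only: mon_deg_four)
    have "mon_weight m > 2 * weight i"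
    proof (cases i rule: four_cases)
      case 1
      with nz show ?thesis by (auto simp: mon_weight_def)
    next
      case 2
      then have "lookup m 0 = 0" using z[of 0] four_less by simp
      moreover have "lookup m 2 \<noteq> 0 \<or> lookup m 3 \<noteq> 0" using nz 2 calculation by auto
      ultimately show ?thesis using deg 2 unfolding mon_weight_def by (simp only: weight_simps) linarith
    next
      case 3
      then have "lookup m 0 = 0" "lookup m 1 = 0" using z[of 0] z[of 1] four_less by simp_all
      moreover have "lookup m 3 \<noteq> 0" using nz 3 calculation by auto
      ultimately show ?thesis using deg 3 unfolding mon_weight_def by simp
    next
      case 4
      then have "lookup m 0 = 0" "lookup m 1 = 0" "lookup m 2 = 0"
        using z[of 0] z[of 1] z[of 2] four_less by simp_all
      with nz 4 show ?thesis by auto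
    qed
    then show ?thesis ..
  next
    case False
    then have s: "m = Poly_Mapping.single i (lookup m i)"
      by (intro poly_mapping_eqI) (auto simp: lookup_single when_def)
    then have "mon_deg m = lookup m i" by (metis mon_deg_single)
    with s m show ?thesis by metis
  qed
qed

lemma mon_weight_single: "mon_weight (Poly_Mapping.single i k) = k * weight i"
  by (cases i rule: four_cases) (simp_all add: mon_weight_def lookup_single)

lemma is_hom_pCons: "is_hom (\<lambda>c::'a::comm_ring_1. [:c:])"
  by (simp add: is_hom_def pCons_one)

lemma is_hom_poly: "is_hom (\<lambda>p. poly p (t::'a::comm_ring_1))"
  by (simp add: is_hom_def)

text \<open>
  If the coefficients of the squares \<open>x\<^sub>i\<^sup>2\<close> do not vanish, the torus elements move a triangular
  system, after rescaling its members, along a curve that tends to nonzero multiples of these squares.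
\<close>

lemma triangular_degeneration:
  fixes f :: "4 \<Rightarrow> (4, 'a::field_char_0) mpoly" and A :: "'a ^ 4 ^ 4"
  assumes f: "\<And>i. homogeneous 2 (f i)" and tri: "\<And>i. vars (f i) \<subseteq> {i..}"
    and c: "\<And>i. lookup (f i) (Poly_Mapping.single i 2) \<noteq> 0"
    and A: "invertible A" and good: "good (ideal_gen (range (\<lambda>i. lin_act A (X i ^ 2))))"
  obtains B where "invertible B" "good (ideal_gen (range (\<lambda>i. lin_act B (f i))))"
proof -
  \<comment> \<open>The transform by \<open>torus t\<close>, divided by \<open>t ^ (2 * weight i)\<close>; it makes sense for \<open>t = 0\<close> as well.\<close>
  define ft where "ft t i = (\<Sum>m\<in>mons 2. const (lookup (f i) m * t ^ (mon_weight m - 2 * weight i)) * monom m)" for t i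
  have wt: "m = Poly_Mapping.single i 2 \<or> mon_weight m > 2 * weight i" if "lookup (f i) m \<noteq> 0" for i m
  proof (rule triangular_weight)
    show "mon_deg m = 2" using homogeneousD[OF f that] .
    show "i \<le> j" if "lookup m j \<noteq> 0" for j
    proof -
      have "j \<in> vars (f i)"
        unfolding vars_def using that \<open>lookup (f i) m \<noteq> 0\<close> by (auto simp: in_keys_iff intro!: bexI[of _ m])
      then show ?thesis using tri[of i] by auto
    qed
  qed
  have wt_single: "mon_weight (Poly_Mapping.single i 2) = 2 * weight i" for i
    by (rule mon_weight_single)
  have ft0: "ft 0 i = const (lookup (f i) (Poly_Mapping.single i 2)) * X i ^ 2" for i
  proof -
    let ?s = "Poly_Mapping.single i 2"
    have "lookup (f i) m * 0 ^ (mon_weight m - 2 * weight i) = (if m = ?s then lookup (f i) ?s else 0)" for m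
      using wt[of i m] by (cases "lookup (f i) m = 0") (auto simp: wt_single power_0_left)
    then have "ft 0 i = (\<Sum>m\<in>mons 2. if m = ?s then const (lookup (f i) ?s) * monom ?s else 0)"
      unfolding ft_def by (intro sum.cong) auto
    also have "\<dots> = const (lookup (f i) ?s) * monom ?s"
      by (subst sum.delta[OF finite_mons]) (simp add: mons_def)
    also have "(monom ?s :: (4, 'a) mpoly) = X i ^ 2" unfolding mon_val_X[symmetric] by simp
    finally show ?thesis .
  qed
  have ft: "lin_act (torus t) (f i) = const (t ^ (2 * weight i)) * ft t i" for t i
  proof -
    have "lin_act (torus t) (f i) = (\<Sum>m\<in>mons 2. const (lookup (f i) m) * (const (t ^ mon_weight m) * monom m))"
      by (subst homogeneous_eq_sum[OF f[of i]]) (simp only: is_homD[OF lin_act_hom] lin_act_const lin_act_torus)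
    also have "\<dots> = (\<Sum>m\<in>mons 2. const (t ^ (2 * weight i)) *
        (const (lookup (f i) m * t ^ (mon_weight m - 2 * weight i)) * monom m))"
    proof (rule sum.cong[OF refl])
      fix m :: "4 mon"
      have "lookup (f i) m * t ^ mon_weight m
          = t ^ (2 * weight i) * (lookup (f i) m * t ^ (mon_weight m - 2 * weight i))"
      proof (cases "lookup (f i) m = 0")
        case False
        with wt[of i m] have "2 * weight i \<le> mon_weight m" by (auto simp: wt_single)
        then show ?thesis by (metis le_add_diff_inverse mult.left_commute power_add)
      qed simp
      then show "const (lookup (f i) m) * (const (t ^ mon_weight m) * monom m)
          = const (t ^ (2 * weight i)) * (const (lookup (f i) m * t ^ (mon_weight m - 2 * weight i)) * monom m)"
        unfolding mult.assoc[symmetric] const_mult[symmetric] by (simp only:)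
    qed
    finally show ?thesis by (simp only: ft_def sum_distrib_left)
  qed
  have ft_hom: "homogeneous 2 (lin_act A (ft t i))" for t i
    unfolding ft_def by (rule homogeneous_lin_act) (rule homogeneous_sum_monom; simp)
  have g0: "good (ideal_gen (range (\<lambda>i. lin_act A (ft 0 i))))"
    using good ideal_gen_range_scale[where c = "\<lambda>i. lookup (f i) (Poly_Mapping.single i 2)"
        and g = "\<lambda>i. lin_act A (X i ^ 2)", OF c]
    by (simp add: ft0 is_homD[OF lin_act_hom])
  obtain P where P: "insertion id (coords (\<lambda>i. lin_act A (ft 0 i))) P \<noteq> 0"
    "\<And>g. (\<And>i. homogeneous 2 (g i)) \<Longrightarrow> insertion id (coords g) P \<noteq> 0 \<Longrightarrow> good (ideal_gen (range g))"
    using good_open[where ?g0.0 = "\<lambda>i. lin_act A (ft 0 i)", OF ft_hom g0] by blast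
  \<comment> \<open>Along the curve, the coordinates and hence the value of \<open>P\<close> are polynomials in the parameter.\<close>
  define Q where "Q = (\<lambda>(i, m). \<Sum>n\<in>mons 2. [:lookup (f i) n * lookup (lin_act A (monom n)) m:] *
     [:0, 1:] ^ (mon_weight n - 2 * weight i))"
  define R where "R = insertion (\<lambda>c. [:c:]) Q P"
  have "poly (Q (i, m)) t = lookup (lin_act A (ft t i)) m" for i m t
    unfolding Q_def ft_def
    by (simp add: poly_sum is_homD[OF lin_act_hom] lookup_sum lookup_const_mult) (simp add: mult_ac)
  then have "(\<lambda>v. poly (Q v) t) = coords (\<lambda>i. lin_act A (ft t i))" for t
    by (auto simp: coords_def)
  moreover have "poly R t = insertion ((\<lambda>p. poly p t) \<circ> (\<lambda>c. [:c:])) (\<lambda>v. poly (Q v) t) P" for t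
    unfolding R_def by (rule hom_insertion[OF is_hom_poly is_hom_pCons])
  moreover have "(\<lambda>p. poly p t) \<circ> (\<lambda>c. [:c:]) = id" for t :: 'a by auto
  ultimately have R: "poly R t = insertion id (coords (\<lambda>i. lin_act A (ft t i))) P" for t by simp
  then have "R \<noteq> 0" using P(1) by force
  \<comment> \<open>As \<open>R\<close> does not vanish at 0, it does not vanish at some other point either.\<close>
  then have "finite (insert 0 {t. poly R t = 0})" by (simp add: poly_roots_finite)
  then obtain t where t: "t \<noteq> 0" "poly R t \<noteq> 0"
    using ex_new_if_finite[OF infinite_UNIV_char_0] by blast
  have "good (ideal_gen (range (\<lambda>i. lin_act A (ft t i))))"
    using P(2)[OF ft_hom] t(2) R by simp
  moreover have "lin_act (A ** torus t) (f i) = const (t ^ (2 * weight i)) * lin_act A (ft t i)" for i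
    by (simp add: lin_act_mult_matrix[symmetric] ft is_homD[OF lin_act_hom])
  ultimately have "good (ideal_gen (range (\<lambda>i. lin_act (A ** torus t) (f i))))"
    using ideal_gen_range_scale[of "\<lambda>i. t ^ (2 * weight i)" "\<lambda>i. lin_act A (ft t i)"] t(1) by simp
  moreover have "invertible (A ** torus t)" by (rule invertible_mult[OF A invertible_torus[OF t(1)]])
  ultimately show ?thesis by (intro that)
qed

section \<open>Good coordinates from Lefschetz elements\<close>

text \<open>
  If \<open>l\<close> has the Lefschetz property in the stated form, and \<open>y z\<close>, \<open>z\<^sup>2\<close> complete the
  multiples of \<open>l\<close> in degree 2, then a change of coordinates that moves \<open>y, z, l\<close> to
  \<open>x\<^sub>2, x\<^sub>3, x\<^sub>4\<close> is good.
\<close>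

lemma good_coordinates:
  fixes f :: "4 \<Rightarrow> (4, 'a::field) mpoly"
  defines "I \<equiv> ideal_gen (range f)"
  assumes lin: "homogeneous 1 y" "homogeneous 1 z" "homogeneous 1 l"
    and indep: "\<And>a b c. const a * y + const b * z + const c * l = 0 \<Longrightarrow> a = 0 \<and> b = 0 \<and> c = 0"
    and h2: "\<And>u. homogeneous 2 u \<Longrightarrow> \<exists>v a b. homogeneous 1 v \<and> u - (v * l + const a * (y * z) + const b * z ^ 2) \<in> I"
    and h3: "\<And>u. homogeneous 3 u \<Longrightarrow> \<exists>v. homogeneous 1 v \<and> u - v * l ^ 2 \<in> I"
    and h4: "\<And>u. homogeneous 4 u \<Longrightarrow> \<exists>c. u - const c * l ^ 4 \<in> I"
    and h5: "\<And>u. homogeneous 5 u \<Longrightarrow> u \<in> I"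
  obtains A where "invertible A" "good (ideal_gen (range (\<lambda>i. lin_act A (f i))))"
proof -
  obtain x where x: "homogeneous 1 x" "x \<notin> mv.span {y, z, l}"
  proof -
    have "\<not> monom ` mons 1 \<subseteq> mv.span {y, z, l}"
    proof
      assume "monom ` mons 1 \<subseteq> mv.span {y, z, l}"
      then have "card (monom ` mons 1 :: (4, 'a) mpoly set) \<le> card {y, z, l}"
        by (intro mv.independent_span_bound[THEN conjunct2] independent_monom finite_mons) simp
      also have "\<dots> \<le> 3" using card_length[of "[y, z, l]"] by simp
      finally show False
        by (simp only: card_monom card_mons_values)
    qed
    then obtain m where m: "m \<in> mons 1" "monom m \<notin> mv.span {y, z, l}" by blast
    then have "homogeneous 1 (monom m :: (4, 'a) mpoly)" by (intro homogeneous_monom) (simp add: mons_def)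
    then show ?thesis using m(2) by (rule that)
  qed
  define fm where "fm j = (if j = 0 then x else if j = 1 then y else if j = 2 then z else l)" for j :: 4
  have fm: "fm 0 = x" "fm 1 = y" "fm 2 = z" "fm 3 = l" by (simp_all add: fm_def)
  have fm_hom: "homogeneous 1 (fm j)" for j using lin x(1) by (simp add: fm_def)
  define N :: "'a ^ 4 ^ 4" where "N = (\<chi> i j. lookup (fm j) (Poly_Mapping.single i 1))"
  have N: "lin_act N (X j) = fm j" for j
  proof (rule homogeneous_eqI[OF _ fm_hom])
    show "homogeneous 1 (lin_act N (X j))" by (rule homogeneous_lin_act) simp
    fix m :: "4 mon" assume "m \<in> mons 1"
    then have "mon_deg m = 1" by (simp add: mons_def)
    then obtain k where k: "m = Poly_Mapping.single k 1" by (rule mon_deg_1E)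
    have "lookup (lin_act N (X j)) m = (\<Sum>i\<in>UNIV. if i = k then N $ i $ j else 0)"
      unfolding lin_act_X lookup_sum lookup_const_mult k unfolding X_def lookup_monom single_1_eq_iff
      by (rule sum.cong) auto
    then show "lookup (lin_act N (X j)) m = lookup (fm j) m" by (simp add: N_def k)
  qed
  have "\<forall>i. c i = 0" if c: "(\<Sum>i\<in>UNIV. c i *s column i N) = 0" for c
  proof -
    have "(\<Sum>i\<in>UNIV. const (c i) * fm i) = 0"
    proof (rule homogeneous_eqI[of 1])
      show "homogeneous 1 (\<Sum>i\<in>UNIV. const (c i) * fm i)"
        by (intro homogeneous_sum homogeneous_const_mult fm_hom)
      fix m :: "4 mon" assume "m \<in> mons 1"
      then have "mon_deg m = 1" by (simp add: mons_def)
      then obtain k where k: "m = Poly_Mapping.single k 1" by (rule mon_deg_1E)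
      have "(\<Sum>i\<in>UNIV. c i *s column i N) $ k = 0" unfolding c by simp
      then show "lookup (\<Sum>i\<in>UNIV. const (c i) * fm i) m = lookup 0 m"
        by (simp add: lookup_sum lookup_const_mult k N_def column_def)
    qed simp
    then have s: "const (c 0) * x + const (c 1) * y + const (c 2) * z + const (c 3) * l = 0"
      by (simp add: sum_four fm)
    have c0: "c 0 = 0"
    proof (rule ccontr)
      assume c0: "c 0 \<noteq> 0"
      have "const (c 1) * y + const (c 2) * z + const (c 3) * l \<in> mv.span {y, z, l}"
        by (intro mv.span_add mv.span_scale mv.span_base) auto
      then have "const (- inverse (c 0)) * (const (c 1) * y + const (c 2) * z + const (c 3) * l) \<in> mv.span {y, z, l}"
        by (rule mv.span_scale)
      moreover have "const (c 1) * y + const (c 2) * z + const (c 3) * l = const (- c 0) * x"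
        using s by (simp add: const_uminus algebra_simps eq_neg_iff_add_eq_0)
      moreover have "const (- inverse (c 0)) * (const (- c 0) * x) = x"
        using c0 by (simp add: mult.assoc[symmetric] const_mult[symmetric])
      ultimately have "x \<in> mv.span {y, z, l}" by (simp only:)
      with x(2) show False ..
    qed
    with s have "const (c 1) * y + const (c 2) * z + const (c 3) * l = 0" by simp
    with indep c0 show ?thesis unfolding all_four by blast
  qed
  then have "\<exists>A. A ** N = mat 1" unfolding matrix_left_invertible_independent_columns by blast
  then obtain A where AN: "A ** N = mat 1" ..
  then have NA: "N ** A = mat 1" by (rule matrix_left_right_inverse[THEN iffD1])
  have A: "invertible A" using AN NA by (auto simp: invertible_def)
  note hom = is_homD[OF lin_act_hom[of A]]
  have A_N: "lin_act A (lin_act N u) = u" for u by (simp add: lin_act_mult_matrix AN lin_act_mat_1)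
  have Afm: "lin_act A y = X 1" "lin_act A z = X 2" "lin_act A l = X 3"
    using A_N[of "X 1"] A_N[of "X 2"] A_N[of "X 3"] by (simp_all add: N fm)
  have I: "lin_act A ` I = ideal_gen (range (\<lambda>i. lin_act A (f i)))"
    unfolding I_def by (rule hom_image_ideal[OF lin_act_hom surj_lin_act[OF A]])
  have mem: "u - lin_act A b \<in> ideal_gen (range (\<lambda>i. lin_act A (f i)))" if "lin_act N u - b \<in> I" for u b
  proof -
    have "lin_act A (lin_act N u - b) \<in> lin_act A ` I" using that by blast
    then show ?thesis by (simp add: I hom A_N)
  qed
  have X3: "X 3 ^ k = monom (mk 0 0 0 k)" for k by (simp add: monom_mk)
  have linX3: "keys (v * X 3 ^ k) \<subseteq> std" if v: "homogeneous 1 v" and k: "k = 1 \<or> k = 2"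
    for v :: "(4, 'a) mpoly" and k
  proof
    fix m assume "m \<in> keys (v * X 3 ^ k)"
    then obtain n where n: "n \<in> keys v" "m = n + mk 0 0 0 k"
      using keys_mult[of v "X 3 ^ k"] unfolding X3 by auto
    then have "mon_deg m = Suc k" "lookup m 3 \<ge> k"
      using v by (auto simp: homogeneous_def mon_deg_add lookup_add)
    with k show "m \<in> std" by (auto simp: std_def)
  qed
  have "spans_mod (ideal_gen (range (\<lambda>i. lin_act A (f i)))) std d" if "d \<in> {2, 3, 4, 5}" for d
    unfolding spans_mod_def
  proof (intro allI impI)
    fix u :: "(4, 'a) mpoly" assume u: "homogeneous d u"
    then have Nu: "homogeneous d (lin_act N u)" by (rule homogeneous_lin_act)
    from that consider "d = 2" | "d = 3" | "d = 4" | "d = 5" by auto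
    then show "\<exists>b. homogeneous d b \<and> keys b \<subseteq> std \<and> u - b \<in> ideal_gen (range (\<lambda>i. lin_act A (f i)))"
    proof cases
      case 1
      obtain v a b where v: "homogeneous 1 v" "lin_act N u - (v * l + const a * (y * z) + const b * z ^ 2) \<in> I"
        using h2[OF Nu[unfolded 1]] by blast
      let ?w = "lin_act A (v * l + const a * (y * z) + const b * z ^ 2)"
      have w: "?w = lin_act A v * X 3 ^ 1 + (const a * monom (mk 0 1 1 0) + const b * monom (mk 0 0 2 0))"
        by (simp add: hom Afm monom_mk)
      have Av: "homogeneous 1 (lin_act A v)" by (rule homogeneous_lin_act[OF v(1)])
      have "keys (const a * monom (mk 0 1 1 0) + const b * monom (mk 0 0 2 0)) \<subseteq> std"
        by (auto simp: in_keys_iff lookup_add lookup_const_mult lookup_monom std_def split: if_splits)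
      with linX3[OF Av, of 1] have "keys ?w \<subseteq> std"
        unfolding w by (rule order_trans[OF keys_add Un_least]) simp_all
      moreover have "homogeneous 2 (lin_act A v * X 3 ^ 1)"
        using homogeneous_mult[OF Av homogeneous_X(1)[of 3]] by (simp add: numeral_2_eq_2)
      then have "homogeneous 2 ?w"
        unfolding w by (intro homogeneous_add homogeneous_const_mult homogeneous_monom) simp_all
      ultimately show ?thesis using mem[OF v(2)] 1 by blast
    next
      case 2
      obtain v where v: "homogeneous 1 v" "lin_act N u - v * l ^ 2 \<in> I"
        using h3[OF Nu[unfolded 2]] by blast
      have Av: "homogeneous 1 (lin_act A v)" by (rule homogeneous_lin_act[OF v(1)])
      have w: "lin_act A (v * l ^ 2) = lin_act A v * X 3 ^ 2" by (simp add: hom Afm)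
      have "homogeneous (1 + 2 * 1) (lin_act A (v * l ^ 2))"
        unfolding w by (intro homogeneous_mult Av homogeneous_power homogeneous_X(1))
      then have "homogeneous 3 (lin_act A v * X 3 ^ 2)" unfolding w by (simp add: numeral_3_eq_3)
      then show ?thesis using mem[OF v(2)] linX3[OF Av, of 2] 2 unfolding w
        by (intro exI[of _ "lin_act A v * X 3 ^ 2"]) simp
    next
      case 3
      obtain c where c: "lin_act N u - const c * l ^ 4 \<in> I"
        using h4[OF Nu[unfolded 3]] by blast
      have w: "lin_act A (const c * l ^ 4) = const c * monom (mk 0 0 0 4)" by (simp add: hom Afm X3)
      have "homogeneous 4 (const c * monom (mk 0 0 0 4) :: (4, 'a) mpoly)"
        by (intro homogeneous_const_mult homogeneous_monom) simp
      moreover have "keys (const c * monom (mk 0 0 0 4) :: (4, 'a) mpoly) \<subseteq> std"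
        by (auto simp: in_keys_iff lookup_const_mult lookup_monom std_def split: if_splits)
      ultimately show ?thesis using mem[OF c] 3 unfolding w by blast
    next
      case 4
      then have "lin_act N u - 0 \<in> I" using h5 Nu by simp
      from mem[OF this] show ?thesis by (intro exI[of _ 0]) (simp add: hom)
    qed
  qed
  then have "good (ideal_gen (range (\<lambda>i. lin_act A (f i))))" unfolding good_def by blast
  then show ?thesis using A that by blast
qed

section \<open>The squares of the variables\<close>

lemma subspace_ideal: "mv.subspace (ideal_gen F)"
  by (rule mv.subspaceI) (auto intro: ideal_add ideal_mult)

lemma subspace_homogeneous: "mv.subspace {p. homogeneous d p}"
  by (rule mv.subspaceI) (auto intro: homogeneous_add homogeneous_const_mult)

lemma homogeneous_in_subspace:
  fixes u :: "('v::finite, 'a::field) mpoly"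
  assumes "mv.subspace T" "\<And>m. mon_deg m = d \<Longrightarrow> monom m \<in> T" "homogeneous d u"
  shows "u \<in> T"
proof -
  have "mv.span (monom ` mons d) \<subseteq> T"
    by (rule mv.span_minimal) (use assms in \<open>auto simp: mons_def\<close>)
  then show ?thesis using assms(3) by (auto simp: span_monom_mons)
qed

text \<open>
  The polynomials that modulo \<open>I\<close> are a multiple \<open>v w\<close>, with \<open>v\<close> of degree \<open>d\<close>, plus a
  combination of \<open>p\<close> and \<open>q\<close>.
\<close>

lemma subspace_multiples_mod:
  assumes I: "mv.subspace I"
  shows "mv.subspace {u. \<exists>v a b. homogeneous d v \<and> u - (v * w + const a * p + const b * q) \<in> I}" (is "mv.subspace ?T")
proof (rule mv.subspaceI)
  have "0 - (0 * w + const 0 * p + const 0 * q) \<in> I" using mv.subspace_0[OF I] by simp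
  then show "0 \<in> ?T" by (intro CollectI exI[of _ 0] exI[of _ 0]) simp
  fix x y assume "x \<in> ?T" "y \<in> ?T"
  then obtain v a b v' a' b' where v: "homogeneous d v" "x - (v * w + const a * p + const b * q) \<in> I"
    "homogeneous d v'" "y - (v' * w + const a' * p + const b' * q) \<in> I" by blast
  have "(x + y) - ((v + v') * w + const (a + a') * p + const (b + b') * q)
     = (x - (v * w + const a * p + const b * q)) + (y - (v' * w + const a' * p + const b' * q))"
    by (simp add: const_add algebra_simps)
  also have "\<dots> \<in> I" by (rule mv.subspace_add[OF I v(2,4)])
  finally show "x + y \<in> ?T" using homogeneous_add[OF v(1,3)] by blast
next
  fix c x assume "x \<in> ?T"
  then obtain v a b where v: "homogeneous d v" "x - (v * w + const a * p + const b * q) \<in> I" by blast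
  have "const c * x - ((const c * v) * w + const (c * a) * p + const (c * b) * q)
     = const c * (x - (v * w + const a * p + const b * q))"
    by (simp add: const_mult algebra_simps)
  also have "\<dots> \<in> I" by (rule mv.subspace_scale[OF I v(2)])
  finally show "const c * x \<in> ?T" using homogeneous_const_mult[OF v(1)] by blast
qed

lemma scale_in_subspaceD:
  assumes "mv.subspace T" "c \<noteq> 0" "const c * p \<in> T"
  shows "p \<in> T"
proof -
  have "const (inverse c) * (const c * p) = const (inverse c * c) * p"
    by (simp only: const_mult mult.assoc)
  then have "const (inverse c) * (const c * p) = p" using assms(2) by simp
  then show ?thesis using mv.subspace_scale[OF assms(1,3)] by metis
qed

lemma numeral_mult_in_subspace:
  fixes p :: "('v, 'a::field_char_0) mpoly"
  assumes "mv.subspace T" "numeral k * p \<in> T"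
  shows "p \<in> T"
  using scale_in_subspaceD[OF assms(1), of "numeral k" p] assms(2) by (simp add: const_numeral)

text \<open>
  Modulo the squares of the variables, only the squarefree monomials survive. In each degree they
  are obtained from the relevant products by solving a linear system.
\<close>

lemma squares_good:
  obtains A :: "'a::field_char_0 ^ 4 ^ 4" where
    "invertible A" "good (ideal_gen (range (\<lambda>i. lin_act A (X i ^ 2))))"
proof -
  define I :: "(4, 'a) mpoly set" where "I = ideal_gen (range (\<lambda>i. X i ^ 2))"
  define A B C D :: "(4, 'a) mpoly" where "A = X 0" "B = X 1" "C = X 2" "D = X 3"
  note ABCD = A_B_C_D_def
  \<comment> \<open>For \<open>z = A + B\<close>, the products \<open>y z\<close> and \<open>z\<^sup>2\<close> would be dependent modulo \<open>I\<close> and \<open>l\<close> for every \<open>y\<close>.\<close>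
  define y z l where "y = C" "z = A + const 2 * B" "l = A + B + C + D"
  note yzl = y_z_l_def
  have I0: "mv.subspace I" unfolding I_def by (rule subspace_ideal)
  have sq: "X i ^ 2 \<in> I" for i unfolding I_def by (intro ideal_base rangeI)
  have sqI: "A ^ 2 * p + B ^ 2 * q + C ^ 2 * r + D ^ 2 * s \<in> I" for p q r s
    unfolding ABCD I_def by (intro ideal_add ideal_mult_right ideal_base rangeI)
  have nonsqf: "monom m \<in> I" if "lookup m i \<ge> 2" for m i
  proof -
    have "m = (m - Poly_Mapping.single i 2) + Poly_Mapping.single i 2"
      by (subst add.commute) (rule mon_split[OF that])
    then have "(monom m :: (4, 'a) mpoly) = monom (m - Poly_Mapping.single i 2) * monom (Poly_Mapping.single i 2)"
      by (metis monom_add)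
    also have "(monom (Poly_Mapping.single i 2) :: (4, 'a) mpoly) = X i ^ 2"
      unfolding mon_val_X[symmetric] by (rule mon_val_single)
    finally show ?thesis unfolding I_def by (auto intro: ideal_mult ideal_base)
  qed
  have sqf: "monom m \<in> I \<or> lookup m 0 < 2 \<and> lookup m 1 < 2 \<and> lookup m 2 < 2 \<and> lookup m 3 < 2" for m
    using nonsqf[of m] by (meson not_less)
  have lin: "homogeneous 1 A" "homogeneous 1 B" "homogeneous 1 C" "homogeneous 1 D"
    "homogeneous 1 y" "homogeneous 1 z" "homogeneous 1 l"
    unfolding yzl ABCD by (intro homogeneous_add homogeneous_const_mult homogeneous_X)+
  have indep: "a = 0 \<and> b = 0 \<and> c = 0" if "const a * y + const b * z + const c * l = 0" for a b c
  proof -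
    have X1: "lookup (X i :: (4, 'a) mpoly) (Poly_Mapping.single k 1) = (if k = i then 1 else 0)" for i k
      unfolding X_def lookup_monom single_1_eq_iff ..
    have "lookup (const a * y + const b * z + const c * l) (Poly_Mapping.single k 1) = 0" for k
      unfolding that by simp
    then have "a * lookup y (Poly_Mapping.single k 1) + b * lookup z (Poly_Mapping.single k 1)
      + c * lookup l (Poly_Mapping.single k 1) = 0" for k
      unfolding lookup_add lookup_const_mult .
    from this[of 0] this[of 2] this[of 3] show ?thesis
      unfolding yzl ABCD lookup_add lookup_const_mult X1 by simp
  qed
  have h5: "u \<in> I" if "homogeneous 5 u" for u
  proof (rule homogeneous_in_subspace[OF I0 _ that])
    show "monom m \<in> I" if "mon_deg m = 5" for m
      using sqf[of m] that by (auto simp: mon_deg_four)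
  qed
  have h4: "\<exists>c. u - const c * l ^ 4 \<in> I" if u: "homogeneous 4 u" for u
  proof -
    let ?T = "{u. \<exists>v a b. homogeneous 0 v \<and> u - (v * l ^ 4 + const a * 0 + const b * 0) \<in> I}"
    have T: "mv.subspace ?T" by (rule subspace_multiples_mod[OF I0])
    have I: "p \<in> ?T" if "p \<in> I" for p by (rule CollectI, rule exI[of _ 0]) (use that in simp)
    have l: "l ^ 4 \<in> ?T"
      by (rule CollectI, rule exI[of _ 1]) (use mv.subspace_0[OF I0] homogeneous_const[of 1] in simp)
    define e where "e = A * B + A * C + A * D + B * C + B * D + C * D"
    have l2: "l ^ 2 = (A ^ 2 + B ^ 2 + C ^ 2 + D ^ 2) + 2 * e"
      by (simp add: yzl e_def algebra_simps power2_eq_square)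
    have e2: "e ^ 2 = 6 * (A * B * C * D) + (A ^ 2 * (B ^ 2 + C ^ 2 + D ^ 2 + 2 * (B * C + B * D + C * D)) +
       B ^ 2 * (C ^ 2 + D ^ 2 + 2 * (A * C + A * D + C * D)) + C ^ 2 * (D ^ 2 + 2 * (A * B + A * D + B * D)) +
       D ^ 2 * (2 * (A * B + A * C + B * C)))" (is "_ = _ + ?r")
      by (simp add: e_def algebra_simps power2_eq_square)
    have "l ^ 4 = (l ^ 2) ^ 2" by simp
    also have "\<dots> = (A ^ 2 * (A ^ 2 + B ^ 2 + C ^ 2 + D ^ 2 + 4 * e) + B ^ 2 * (A ^ 2 + B ^ 2 + C ^ 2 + D ^ 2 + 4 * e)
       + C ^ 2 * (A ^ 2 + B ^ 2 + C ^ 2 + D ^ 2 + 4 * e) + D ^ 2 * (A ^ 2 + B ^ 2 + C ^ 2 + D ^ 2 + 4 * e)) + 4 * e ^ 2"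
      (is "_ = ?s + _")
      unfolding l2 by (simp add: algebra_simps power2_eq_square)
    finally have l4: "24 * (A * B * C * D) = l ^ 4 - ?s - 4 * ?r"
      unfolding e2 by (simp add: algebra_simps)
    have s: "?s \<in> I" by (rule sqI)
    have "?r \<in> I" by (rule sqI)
    then have r: "4 * ?r \<in> I" unfolding I_def by (rule ideal_mult)
    have "24 * (A * B * C * D) \<in> ?T"
      unfolding l4 by (intro mv.subspace_diff[OF T] l I s r)
    then have ABCD': "A * B * C * D \<in> ?T" by (rule numeral_mult_in_subspace[OF T])
    have "u \<in> ?T"
    proof (rule homogeneous_in_subspace[OF T _ u])
      fix m :: "4 mon" assume m: "mon_deg m = 4"
      show "monom m \<in> ?T"
      proof (cases "monom m \<in> (I :: (4, 'a) mpoly set)")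
        case False
        then have "m = mk 1 1 1 1" using sqf[of m] m by (subst mk_lookup) (auto simp: mon_deg_four)
        then have "monom m = A * B * C * D" by (simp add: monom_mk ABCD)
        then show ?thesis using ABCD' by (simp only:)
      qed (rule I)
    qed
    then obtain v where v: "homogeneous 0 v" "u - v * l ^ 4 \<in> I" by auto
    then show ?thesis using homogeneous_0_const[of v] by metis
  qed
  have h3: "\<exists>v. homogeneous 1 v \<and> u - v * l ^ 2 \<in> I" if u: "homogeneous 3 u" for u
  proof -
    let ?T = "{u. \<exists>v a b. homogeneous 1 v \<and> u - (v * l ^ 2 + const a * 0 + const b * 0) \<in> I}"
    have T: "mv.subspace ?T" by (rule subspace_multiples_mod[OF I0])
    have I: "p \<in> ?T" if "p \<in> I" for p by (rule CollectI, rule exI[of _ 0]) (use that in simp)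
    have l: "v * l ^ 2 \<in> ?T" if "homogeneous 1 v" for v
      by (rule CollectI, rule exI[of _ v]) (use that mv.subspace_0[OF I0] in simp)
    define p q r s where "p = A * B * C" "q = A * B * D" "r = A * C * D" "s = B * C * D"
    note pqrs = p_q_r_s_def
    note tdiff = mv.subspace_diff[OF T] and tadd = mv.subspace_add[OF T]
    have "2 * (p + q + r) = A * l ^ 2 - (A ^ 2 * (A + 2 * B + 2 * C + 2 * D) + B ^ 2 * A + C ^ 2 * A + D ^ 2 * A)"
      by (simp add: pqrs yzl algebra_simps power2_eq_square)
    also have "\<dots> \<in> ?T" by (intro tdiff l I sqI lin)
    finally have a: "p + q + r \<in> ?T" by (rule numeral_mult_in_subspace[OF T])
    have "2 * (p + q + s) = B * l ^ 2 - (A ^ 2 * B + B ^ 2 * (2 * A + B + 2 * C + 2 * D) + C ^ 2 * B + D ^ 2 * B)"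
      by (simp add: pqrs yzl algebra_simps power2_eq_square)
    also have "\<dots> \<in> ?T" by (intro tdiff l I sqI lin)
    finally have b: "p + q + s \<in> ?T" by (rule numeral_mult_in_subspace[OF T])
    have "2 * (p + r + s) = C * l ^ 2 - (A ^ 2 * C + B ^ 2 * C + C ^ 2 * (2 * A + 2 * B + C + 2 * D) + D ^ 2 * C)"
      by (simp add: pqrs yzl algebra_simps power2_eq_square)
    also have "\<dots> \<in> ?T" by (intro tdiff l I sqI lin)
    finally have c: "p + r + s \<in> ?T" by (rule numeral_mult_in_subspace[OF T])
    have "2 * (q + r + s) = D * l ^ 2 - (A ^ 2 * D + B ^ 2 * D + C ^ 2 * D + D ^ 2 * (2 * A + 2 * B + 2 * C + D))"
      by (simp add: pqrs yzl algebra_simps power2_eq_square)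
    also have "\<dots> \<in> ?T" by (intro tdiff l I sqI lin)
    finally have d: "q + r + s \<in> ?T" by (rule numeral_mult_in_subspace[OF T])
    have "3 * (p + q + r + s) = (p + q + r) + (p + q + s) + (p + r + s) + (q + r + s)" by (simp add: algebra_simps)
    also have "\<dots> \<in> ?T" by (intro tadd a b c d)
    finally have e: "p + q + r + s \<in> ?T" by (rule numeral_mult_in_subspace[OF T])
    have "(p + q + r + s) - (p + q + r) = s" "(p + q + r + s) - (p + q + s) = r"
      "(p + q + r + s) - (p + r + s) = q" "(p + q + r + s) - (q + r + s) = p" by simp_all
    then have "p \<in> ?T" "q \<in> ?T" "r \<in> ?T" "s \<in> ?T"
      using tdiff[OF e a] tdiff[OF e b] tdiff[OF e c] tdiff[OF e d] by (simp_all only:)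
    note pT = this
    have "u \<in> ?T"
    proof (rule homogeneous_in_subspace[OF T _ u])
      fix m :: "4 mon" assume m: "mon_deg m = 3"
      show "monom m \<in> ?T"
      proof (cases "monom m \<in> (I :: (4, 'a) mpoly set)")
        case False
        obtain a b c e where m': "m = mk a b c e" using mk_lookup by metis
        have "(a, b, c, e) \<in> {(1, 1, 1, 0), (1, 1, 0, 1), (1, 0, 1, 1), (0, 1, 1, 1)}"
          using sqf[of m] m False unfolding m' by (auto simp: numeral_2_eq_2 less_Suc_eq)
        then have "monom m \<in> {p, q, r, s}" unfolding m' by (auto simp: monom_mk pqrs ABCD)
        then show ?thesis using pT by blast
      qed (rule I)
    qed
    then show ?thesis by auto
  qed
  have h2: "\<exists>v a b. homogeneous 1 v \<and> u - (v * l + const a * (y * z) + const b * z ^ 2) \<in> I"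
    if u: "homogeneous 2 u" for u
  proof -
    let ?T = "{u. \<exists>v a b. homogeneous 1 v \<and> u - (v * l + const a * (y * z) + const b * z ^ 2) \<in> I}"
    have T: "mv.subspace ?T" by (rule subspace_multiples_mod[OF I0])
    note tdiff = mv.subspace_diff[OF T] and tadd = mv.subspace_add[OF T]
    have I: "p \<in> ?T" if "p \<in> I" for p
      by (rule CollectI, rule exI[of _ 0], rule exI[of _ 0], rule exI[of _ 0]) (use that in simp)
    have l: "v * l \<in> ?T" if "homogeneous 1 v" for v
      by (rule CollectI, rule exI[of _ v], rule exI[of _ 0], rule exI[of _ 0]) (use that mv.subspace_0[OF I0] in simp)
    have yz: "y * z \<in> ?T"
      by (rule CollectI, rule exI[of _ 0], rule exI[of _ 1], rule exI[of _ 0]) (use mv.subspace_0[OF I0] in simp)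
    have zz: "z ^ 2 \<in> ?T"
      by (rule CollectI, rule exI[of _ 0], rule exI[of _ 0], rule exI[of _ 1]) (use mv.subspace_0[OF I0] in simp)
    have "4 * (A * B) = z ^ 2 - (A ^ 2 * 1 + B ^ 2 * 4 + C ^ 2 * 0 + D ^ 2 * 0)"
      by (simp add: yzl const_numeral algebra_simps power2_eq_square)
    also have "\<dots> \<in> ?T" by (intro tdiff zz I sqI)
    finally have AB: "A * B \<in> ?T" by (rule numeral_mult_in_subspace[OF T])
    have "A * B + A * C + A * D = A * l - (A ^ 2 * 1 + B ^ 2 * 0 + C ^ 2 * 0 + D ^ 2 * 0)"
      by (simp add: yzl algebra_simps power2_eq_square)
    also have "\<dots> \<in> ?T" by (intro tdiff l I sqI lin)
    finally have s1: "A * B + A * C + A * D \<in> ?T" .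
    have "A * B + B * C + B * D = B * l - (A ^ 2 * 0 + B ^ 2 * 1 + C ^ 2 * 0 + D ^ 2 * 0)"
      by (simp add: yzl algebra_simps power2_eq_square)
    also have "\<dots> \<in> ?T" by (intro tdiff l I sqI lin)
    finally have s2: "A * B + B * C + B * D \<in> ?T" .
    have "A * C + B * C + C * D = C * l - (A ^ 2 * 0 + B ^ 2 * 0 + C ^ 2 * 1 + D ^ 2 * 0)"
      by (simp add: yzl algebra_simps power2_eq_square)
    also have "\<dots> \<in> ?T" by (intro tdiff l I sqI lin)
    finally have s3: "A * C + B * C + C * D \<in> ?T" .
    have "A * D + B * D + C * D = D * l - (A ^ 2 * 0 + B ^ 2 * 0 + C ^ 2 * 0 + D ^ 2 * 1)"
      by (simp add: yzl algebra_simps power2_eq_square)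
    also have "\<dots> \<in> ?T" by (intro tdiff l I sqI lin)
    finally have s4: "A * D + B * D + C * D \<in> ?T" .
    have "2 * (C * D) = (A * B + A * B) + ((A * C + B * C + C * D) + (A * D + B * D + C * D))
        - ((A * B + A * C + A * D) + (A * B + B * C + B * D))"
      by (simp add: algebra_simps)
    also have "\<dots> \<in> ?T" by (intro tdiff tadd AB s1 s2 s3 s4)
    finally have CD: "C * D \<in> ?T" by (rule numeral_mult_in_subspace[OF T])
    have "B * C = y * z - ((A * C + B * C + C * D) - C * D)"
      by (simp add: yzl const_numeral algebra_simps)
    also have "\<dots> \<in> ?T" by (intro tdiff yz s3 CD)
    finally have BC: "B * C \<in> ?T" .
    have "A * C = (A * C + B * C + C * D) - C * D - B * C" by simp
    also have "\<dots> \<in> ?T" by (intro tdiff s3 CD BC)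
    finally have AC: "A * C \<in> ?T" .
    have "A * D = (A * B + A * C + A * D) - A * B - A * C" by simp
    also have "\<dots> \<in> ?T" by (intro tdiff s1 AB AC)
    finally have AD: "A * D \<in> ?T" .
    have "B * D = (A * B + B * C + B * D) - A * B - B * C" by simp
    also have "\<dots> \<in> ?T" by (intro tdiff s2 AB BC)
    finally have BD: "B * D \<in> ?T" .
    have "u \<in> ?T"
    proof (rule homogeneous_in_subspace[OF T _ u])
      fix m :: "4 mon" assume m: "mon_deg m = 2"
      show "monom m \<in> ?T"
      proof (cases "monom m \<in> (I :: (4, 'a) mpoly set)")
        case False
        obtain a b c e where m': "m = mk a b c e" using mk_lookup by metis
        have "(a, b, c, e) \<in> {(1, 1, 0, 0), (1, 0, 1, 0), (1, 0, 0, 1), (0, 1, 1, 0), (0, 1, 0, 1), (0, 0, 1, 1)}"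
          using sqf[of m] m False unfolding m' by (auto simp: numeral_2_eq_2 less_Suc_eq)
        then have "monom m \<in> {A * B, A * C, A * D, B * C, B * D, C * D}"
          unfolding m' by (auto simp: monom_mk ABCD)
        moreover have "{A * B, A * C, A * D, B * C, B * D, C * D} \<subseteq> ?T"
          unfolding insert_subset by (intro conjI AB AC AD BC BD CD empty_subsetI)
        ultimately show ?thesis by (rule rev_subsetD)
      qed (rule I)
    qed
    then show ?thesis by (rule CollectD)
  qed
  show ?thesis
    by (rule good_coordinates[where f = "\<lambda>i. X i ^ 2" and y = y and z = z and l = l, folded I_def,
          OF lin(5,6,7) indep h2 h3 h4 h5]) (auto intro: that)
qed

section \<open>Dimensions of components of ideals\<close>

lemma finite_basis:
  fixes V :: "('v::finite, 'a::field) mpoly set"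
  assumes V: "mv.subspace V" "V \<subseteq> {p. homogeneous d p}"
  obtains B where "finite B" "mv.independent B" "mv.span B = V" "card B = mv.dim V"
proof -
  obtain B where B: "B \<subseteq> V" "mv.independent B" "V \<subseteq> mv.span B" "card B = mv.dim V"
    using mv.basis_exists[of V] by blast
  have "finite B"
    using mv.independent_span_bound[of "monom ` mons d" B] B V(2) by (auto simp: finite_mons span_monom_mons)
  moreover have "mv.span B = V" using B(1,3) mv.span_minimal[OF B(1) V(1)] by blast
  ultimately show ?thesis using B that by blast
qed

lemma dim_homogeneous:
  "mv.dim {p :: ('v::finite, 'a::field) mpoly. homogeneous d p} = card (mons d :: 'v mon set)"
proof -
  have "mv.dim {p :: ('v, 'a) mpoly. homogeneous d p} = card (monom ` mons d :: ('v, 'a) mpoly set)"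
    unfolding span_monom_mons[symmetric] by (rule mv.dim_span_eq_card_independent[OF independent_monom[OF finite_mons]])
  then show ?thesis by (simp only: card_monom)
qed

lemma dim_insert_subspace:
  fixes V :: "('v::finite, 'a::field) mpoly set"
  assumes V: "mv.subspace V" "V \<subseteq> {p. homogeneous d p}" and x: "x \<notin> V"
  shows "mv.dim (mv.span (insert x V)) = mv.dim V + 1"
proof -
  obtain B where B: "finite B" "mv.independent B" "mv.span B = V" "card B = mv.dim V"
    using finite_basis[OF V] .
  have "mv.independent (insert x B)" using B x by (intro mv.independent_insertI) auto
  moreover have "mv.span (insert x B) = mv.span (insert x V)"
    unfolding mv.span_insert B(3)[symmetric] mv.span_span ..
  moreover have "card (insert x B) = mv.dim V + 1"
    using B x mv.span_base[of x B] by (subst card_insert_disjoint) auto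
  ultimately show ?thesis using mv.dim_span_eq_card_independent[of "insert x B"] by simp
qed

lemma subspace_eq_homogeneous:
  fixes V :: "('v::finite, 'a::field) mpoly set"
  assumes V: "mv.subspace V" "V \<subseteq> {p. homogeneous d p}" and dim: "mv.dim V = card (mons d :: 'v mon set)"
  shows "V = {p. homogeneous d p}"
proof (rule ccontr)
  assume "V \<noteq> {p. homogeneous d p}"
  then obtain x where x: "homogeneous d x" "x \<notin> V" using V(2) by blast
  obtain B where B: "finite B" "mv.independent B" "mv.span B = V" "card B = mv.dim V"
    using finite_basis[OF V] .
  have i: "mv.independent (insert x B)" using B x by (intro mv.independent_insertI) auto
  have c: "card (insert x B) = mv.dim V + 1"
    using B x mv.span_base[of x B] by (subst card_insert_disjoint) auto
  have "insert x B \<subseteq> mv.span (monom ` mons d)"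
    unfolding span_monom_mons using x V(2) B(3) mv.span_superset[of B] by blast
  then have "card (insert x B) \<le> card (monom ` mons d :: ('v, 'a) mpoly set)"
    using i by (intro mv.independent_span_bound[THEN conjunct2]) (simp_all add: finite_mons)
  then show False using c dim by (simp add: card_monom)
qed

lemma subspace_sum_multiples:
  assumes "mv.subspace U" "mv.subspace V"
  shows "mv.subspace {u + v * w | u v. u \<in> U \<and> v \<in> V}"
proof (rule mv.subspaceI)
  show "0 \<in> {u + v * w | u v. u \<in> U \<and> v \<in> V}"
    using mv.subspace_0[OF assms(1)] mv.subspace_0[OF assms(2)] by force
  fix x y assume "x \<in> {u + v * w | u v. u \<in> U \<and> v \<in> V}" "y \<in> {u + v * w | u v. u \<in> U \<and> v \<in> V}"
  then obtain u v u' v' where *: "x = u + v * w" "y = u' + v' * w" "u \<in> U" "v \<in> V" "u' \<in> U" "v' \<in> V" by blast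
  then have "x + y = (u + u') + (v + v') * w" by (simp add: algebra_simps)
  then show "x + y \<in> {u + v * w | u v. u \<in> U \<and> v \<in> V}"
    using mv.subspace_add[OF assms(1) *(3,5)] mv.subspace_add[OF assms(2) *(4,6)] by blast
next
  fix c x assume "x \<in> {u + v * w | u v. u \<in> U \<and> v \<in> V}"
  then obtain u v where *: "x = u + v * w" "u \<in> U" "v \<in> V" by blast
  then have "const c * x = const c * u + const c * v * w" by (simp add: algebra_simps)
  then show "const c * x \<in> {u + v * w | u v. u \<in> U \<and> v \<in> V}"
    using mv.subspace_scale[OF assms(1) *(2)] mv.subspace_scale[OF assms(2) *(3)] by blast
qed

lemma span_image_mult:
  assumes "x \<in> mv.span ((\<lambda>v. v * w) ` S)"
  shows "\<exists>v\<in>mv.span S. x = v * w"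
  using assms
proof (induction rule: mv.span_induct_alt)
  case base
  show ?case by (rule bexI[of _ 0]) (simp_all add: mv.span_zero)
next
  case (step c x y)
  then obtain s v where "s \<in> S" "x = s * w" "v \<in> mv.span S" "y = v * w" by blast
  then show ?case
    by (intro bexI[of _ "const c * s + v"] mv.span_add mv.span_scale)
       (simp_all add: distrib_right mult.assoc mv.span_base)
qed

text \<open>The rank formula for the multiplication by \<open>w\<close> on \<open>V\<close> modulo \<open>U\<close>.\<close>

lemma dim_sum_multiples:
  fixes U V :: "('v::finite, 'a::field) mpoly set"
  assumes U: "mv.subspace U" "U \<subseteq> {p. homogeneous e p}"
    and V: "mv.subspace V" "V \<subseteq> {p. homogeneous d p}"
  shows "mv.dim {u + v * w | u v. u \<in> U \<and> v \<in> V} + mv.dim {v \<in> V. v * w \<in> U} = mv.dim U + mv.dim V"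
proof -
  let ?K = "{v \<in> V. v * w \<in> U}" and ?S = "{u + v * w | u v. u \<in> U \<and> v \<in> V}"
  have K: "mv.subspace ?K"
  proof (rule mv.subspaceI)
    show "0 \<in> ?K" using mv.subspace_0[OF U(1)] mv.subspace_0[OF V(1)] by simp
    show "x + y \<in> ?K" if "x \<in> ?K" "y \<in> ?K" for x y
      using that mv.subspace_add[OF U(1)] mv.subspace_add[OF V(1)] by (simp add: distrib_right)
    show "const c * x \<in> ?K" if "x \<in> ?K" for c x
      using that mv.subspace_scale[OF U(1)] mv.subspace_scale[OF V(1)] by (simp add: mult.assoc)
  qed
  obtain E where E: "finite E" "mv.independent E" "mv.span E = U" "card E = mv.dim U"
    using finite_basis[OF U] .
  have "?K \<subseteq> {p. homogeneous d p}" using V(2) by blast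
  then obtain C where C: "finite C" "mv.independent C" "mv.span C = ?K" "card C = mv.dim ?K"
    using finite_basis[OF K] by blast
  have "C \<subseteq> V" using C(3) mv.span_superset[of C] by blast
  then obtain D where D: "C \<subseteq> D" "D \<subseteq> V" "mv.independent D" "V \<subseteq> mv.span D"
    using mv.maximal_independent_subset_extend[OF _ C(2)] by blast
  have finD: "finite D"
    using mv.independent_span_bound[of "monom ` mons d" D] D V(2) by (auto simp: finite_mons span_monom_mons)
  have dimV: "card D = mv.dim V" using mv.basis_card_eq_dim[OF D(2,4,3)] .
  have "\<exists>B. finite B \<and> mv.independent B \<and> mv.span B = mv.span (E \<union> (\<lambda>v. v * w) ` D') \<and> card B = card E + card D'"
    if "finite D'" "D' \<subseteq> D - C" for D'
    using that
  proof (induction D' rule: finite_induct)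
    case empty
    show ?case using E by auto
  next
    case (insert x D')
    then obtain B where B: "finite B" "mv.independent B" "mv.span B = mv.span (E \<union> (\<lambda>v. v * w) ` D')"
      "card B = card E + card D'" by auto
    have notin: "x * w \<notin> mv.span B"
    proof
      assume "x * w \<in> mv.span B"
      then obtain u q where uq: "x * w = u + q" "u \<in> mv.span E" "q \<in> mv.span ((\<lambda>v. v * w) ` D')"
        unfolding B(3) mv.span_Un by blast
      obtain v where v: "v \<in> mv.span D'" "q = v * w" using span_image_mult[OF uq(3)] by blast
      have "v \<in> V" using v(1) mv.span_minimal[of D' V] insert.prems D(2) V(1) by blast
      moreover have "x \<in> V" using insert.prems D(2) by blast
      moreover have "(x - v) * w = u" using uq(1) v(2) by (simp add: algebra_simps)
      ultimately have "x - v \<in> mv.span C"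
        unfolding C(3) using uq(2) E(3) mv.subspace_diff[OF V(1)] by simp
      then have "x - v \<in> mv.span (C \<union> D')" "v \<in> mv.span (C \<union> D')"
        using v(1) mv.span_mono[of C "C \<union> D'"] mv.span_mono[of D' "C \<union> D'"] by auto
      then have "(x - v) + v \<in> mv.span (C \<union> D')" by (rule mv.span_add)
      then have "x \<in> mv.span (C \<union> D')" by simp
      moreover have "C \<union> D' \<subseteq> D - {x}" using insert.hyps insert.prems D(1) by blast
      ultimately have "x \<in> mv.span (D - {x})" using mv.span_mono by blast
      then show False using D(3) insert.prems by (auto simp: mv.dependent_def)
    qed
    have "mv.span (insert (x * w) B) = mv.span (E \<union> (\<lambda>v. v * w) ` insert x D')"
    proof -
      have "mv.span (insert (x * w) B) = mv.span (insert (x * w) (E \<union> (\<lambda>v. v * w) ` D'))"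
        unfolding mv.span_insert B(3) ..
      then show ?thesis by simp
    qed
    moreover have "mv.independent (insert (x * w) B)" using mv.independent_insertI[OF notin B(2)] .
    moreover have "card (insert (x * w) B) = card E + card (insert x D')"
    proof -
      have "x * w \<notin> B" using notin mv.span_base by blast
      then show ?thesis by (simp add: card_insert_disjoint B(1,4) insert.hyps)
    qed
    ultimately show ?case using B(1) by (intro exI[of _ "insert (x * w) B"]) simp
  qed
  then obtain B where B: "mv.independent B" "mv.span B = mv.span (E \<union> (\<lambda>v. v * w) ` (D - C))"
     "card B = card E + card (D - C)" using finD by (metis finite_Diff subset_refl)
  let ?G = "E \<union> (\<lambda>v. v * w) ` (D - C)"
  have S: "mv.subspace ?S" by (rule subspace_sum_multiples[OF U(1) V(1)])
  have "mv.span ?G = ?S"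
  proof
    have "E \<subseteq> ?S"
    proof
      fix x assume "x \<in> E"
      then have "x \<in> U" "x = x + 0 * w" using E(3) mv.span_base by auto
      then show "x \<in> ?S" using mv.subspace_0[OF V(1)] by blast
    qed
    moreover have "(\<lambda>v. v * w) ` (D - C) \<subseteq> ?S"
    proof
      fix x assume "x \<in> (\<lambda>v. v * w) ` (D - C)"
      then obtain v where "v \<in> V" "x = 0 + v * w" using D(2) by auto
      then show "x \<in> ?S" using mv.subspace_0[OF U(1)] by blast
    qed
    ultimately show "mv.span ?G \<subseteq> ?S" by (intro mv.span_minimal S) blast
    have UG: "u \<in> mv.span ?G" if "u \<in> U" for u
      using that E(3) mv.span_mono[of E ?G] by blast
    have VG: "v * w \<in> mv.span ?G" if "v \<in> mv.span D" for v
      using that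
    proof (induction rule: mv.span_induct_alt)
      case base
      show ?case by (simp add: mv.span_zero)
    next
      case (step c x y)
      have "x * w \<in> mv.span ?G"
      proof (cases "x \<in> C")
        case True
        then have "x \<in> ?K" using C(3) mv.span_base by blast
        then show ?thesis using UG by blast
      next
        case False
        with step(1) show ?thesis by (intro mv.span_base) blast
      qed
      then have "const c * (x * w) + y * w \<in> mv.span ?G" using step by (intro mv.span_add mv.span_scale)
      then show ?case by (simp add: distrib_right mult.assoc)
    qed
    show "?S \<subseteq> mv.span ?G" using UG VG D(4) by (auto intro!: mv.span_add)
  qed
  then have "mv.dim ?S = card B" using mv.dim_span_eq_card_independent[OF B(1)] B(2) by simp
  moreover have "card (D - C) = card D - card C" by (rule card_Diff_subset[OF C(1) D(1)])
  moreover have "card C \<le> card D" by (rule card_mono[OF finD D(1)])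
  ultimately show ?thesis using B(3) E(4) C(4) dimV by simp
qed

text \<open>The component of degree \<open>d\<close> of a homogeneous ideal.\<close>

definition component :: "('v, 'a::comm_ring_1) mpoly set \<Rightarrow> nat \<Rightarrow> ('v, 'a) mpoly set" where
  "component I d = {p \<in> I. homogeneous d p}"

lemma subspace_component: "mv.subspace (component (ideal_gen F) d)"
  unfolding component_def
  by (rule mv.subspaceI) (auto intro: ideal_add ideal_mult homogeneous_add homogeneous_const_mult)

lemma component_subset: "component I d \<subseteq> {p. homogeneous d p}"
  by (auto simp: component_def)

lemma dim_multiples_component:
  fixes w :: "('v::finite, 'a::field) mpoly"
  assumes w: "homogeneous e w"
  shows "mv.dim {u + v * w | u v. u \<in> component (ideal_gen F) (d + e) \<and> v \<in> {p. homogeneous d p}} +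
     mv.dim {v. homogeneous d v \<and> v * w \<in> ideal_gen F}
    = mv.dim (component (ideal_gen F) (d + e)) + card (mons d :: 'v mon set)"
proof -
  have "{v \<in> {p. homogeneous d p}. v * w \<in> component (ideal_gen F) (d + e)}
      = {v. homogeneous d v \<and> v * w \<in> ideal_gen F}"
    using homogeneous_mult[OF _ w] by (auto simp: component_def)
  then show ?thesis
    using dim_sum_multiples[where U = "component (ideal_gen F) (d + e)" and V = "{p. homogeneous d p}" and w = w,
        OF subspace_component component_subset subspace_homogeneous subset_refl]
    by (simp only: dim_homogeneous)
qed

text \<open>
  The dimensions when a form \<open>g\<close> that is a nonzerodivisor modulo the ideal is added to its generators.
\<close>

lemma dim_component_insert:
  fixes g :: "('v::finite, 'a::field) mpoly"
  assumes F: "\<And>f. f \<in> F \<Longrightarrow> homogeneous e f" and g: "homogeneous e g"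
    and nzd: "\<And>h. h * g \<in> ideal_gen F \<Longrightarrow> h \<in> ideal_gen F"
  shows "mv.dim (component (ideal_gen (insert g F)) (d + e)) + mv.dim (component (ideal_gen F) d)
    = mv.dim (component (ideal_gen F) (d + e)) + card (mons d :: 'v mon set)"
proof -
  have "component (ideal_gen (insert g F)) (d + e)
      = {u + v * g | u v. u \<in> component (ideal_gen F) (d + e) \<and> v \<in> {p. homogeneous d p}}" (is "?L = ?R")
  proof
    have FgF: "ideal_gen F \<subseteq> ideal_gen (insert g F)"
      by (rule ideal_gen_subset) (auto intro: ideal_base)
    have "v * g \<in> ideal_gen (insert g F)" for v by (intro ideal_mult ideal_base) simp
    then show "?R \<subseteq> ?L"
      using FgF homogeneous_mult[OF _ g] by (auto simp: component_def intro!: ideal_add homogeneous_add)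
    show "?L \<subseteq> ?R"
    proof
      fix p assume p: "p \<in> ?L"
      then have hp: "homogeneous (d + e) p" by (simp add: component_def)
      from p obtain k where k: "p - k * g \<in> ideal_gen F"
        by (auto simp: component_def ideal_gen_def ring_module.span_insert)
      let ?u = "hcomp (d + e) (p - k * g)"
      have "hcomp (d + e) p = ?u + hcomp (d + e) (k * g)" by (simp add: hcomp_add[symmetric])
      then have "p = ?u + hcomp d k * g" by (simp add: hcomp_mult[OF g] hcomp_homogeneous[OF hp])
      moreover have "?u \<in> component (ideal_gen F) (d + e)"
        using hcomp_ideal[OF F k] by (simp add: component_def)
      ultimately show "p \<in> ?R" using homogeneous_hcomp by blast
    qed
  qed
  moreover have "{v. homogeneous d v \<and> v * g \<in> ideal_gen F} = component (ideal_gen F) d"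
    unfolding component_def using nzd ideal_mult_right by blast
  ultimately show ?thesis using dim_multiples_component[where F = F and d = d, OF g] by simp
qed

lemma component_low_degree:
  fixes F :: "('v, 'a::field) mpoly set"
  assumes "\<And>f. f \<in> F \<Longrightarrow> homogeneous e f" "d < e"
  shows "component (ideal_gen F) d = {0}"
proof (intro equalityI subsetI)
  fix p assume "p \<in> component (ideal_gen F) d"
  then have "p \<in> ideal_gen F" "homogeneous d p" by (simp_all add: component_def)
  then have "p = 0" using ideal_low_degree[OF assms(1) _ _ assms(2)] by blast
  then show "p \<in> {0}" by simp
qed (simp add: component_def)

lemma dim_zero_space: "mv.dim ({0} :: ('v, 'a::field) mpoly set) = 0"
  using mv.dim_span_eq_card_independent[OF mv.independent_empty] by simp

lemma ideal_gen_empty: "ideal_gen {} = {0}"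
  by (simp add: ideal_gen_def)

text \<open>
  As the forms have dimensions 10, 20, 35, 56 in degrees 2 to 5, the quotient ring by a regular
  sequence of four quadrics has the dimensions 6, 4, 1, 0 there.
\<close>

lemma regular_sequence_dims:
  fixes f :: "4 \<Rightarrow> (4, 'a::field) mpoly"
  assumes f: "\<And>i. homogeneous 2 (f i)" and reg: "regular_sequence f"
  shows "mv.dim (component (ideal_gen (range f)) 2) = 4" "mv.dim (component (ideal_gen (range f)) 3) = 16"
    "mv.dim (component (ideal_gen (range f)) 4) = 34" "mv.dim (component (ideal_gen (range f)) 5) = 56"
proof -
  have less: "{..<0::4} = {}" "{..<1::4} = {0}" "{..<2::4} = {1, 0}" "{..<3::4} = {2, 1, 0}"
  proof -
    have "\<not> (1::4) < 0" "\<not> (2::4) < 1" "\<not> (3::4) < 2" "\<not> (2::4) < 0" "\<not> (3::4) < 1" "\<not> (3::4) < 0"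
      using four_less by (meson less_asym)+
    then have "i \<in> {..<0::4} \<longleftrightarrow> i \<in> {}" "i \<in> {..<1::4} \<longleftrightarrow> i \<in> {0}" "i \<in> {..<2::4} \<longleftrightarrow> i \<in> {1, 0}"
      "i \<in> {..<3::4} \<longleftrightarrow> i \<in> {2, 1, 0}" for i
      using four_less by (cases i rule: four_cases; simp)+
    then show "{..<0::4} = {}" "{..<1::4} = {0}" "{..<2::4} = {1, 0}" "{..<3::4} = {2, 1, 0}" by blast+
  qed
  define F where "F k = (if k = 0 then {} else if k = 1 then {f 0} else if k = 2 then {f 1, f 0}
     else if k = 3 then {f 2, f 1, f 0} else range f)" for k :: nat
  define D where "D k d = mv.dim (component (ideal_gen (F k)) d)" for k d
  have Fh: "homogeneous 2 p" if "p \<in> F k" for p k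
    using that f by (auto simp: F_def split: if_splits)
  have nzd: "h * f i \<in> ideal_gen (f ` {..<i}) \<Longrightarrow> h \<in> ideal_gen (f ` {..<i})" for h i
    using reg by (simp add: regular_sequence_def)
  have range: "range f = insert (f 3) {f 2, f 1, f 0}" unfolding UNIV_four by auto
  have step: "D (k + 1) (d + 2) + D k d = D k (d + 2) + card (mons d :: 4 mon set)" if "k < 4" for k d
  proof -
    have "k = 0 \<or> k = 1 \<or> k = 2 \<or> k = 3" using that by arith
    then consider "k = 0" | "k = 1" | "k = 2" | "k = 3" by blast
    then have "\<exists>i. F (k + 1) = insert (f i) (F k) \<and> F k = f ` {..<i}"
    proof cases
      case 1
      then show ?thesis by (intro exI[of _ 0]) (simp add: F_def less)
    next
      case 2
      then show ?thesis by (intro exI[of _ 1]) (simp add: F_def less)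
    next
      case 3
      then show ?thesis by (intro exI[of _ 2]) (simp add: F_def less)
    next
      case 4
      then show ?thesis by (intro exI[of _ 3]) (simp add: F_def less range)
    qed
    then obtain i where i: "F (k + 1) = insert (f i) (F k)" "F k = f ` {..<i}" by blast
    show ?thesis unfolding D_def i(1)
      by (rule dim_component_insert[where F = "F k" and g = "f i", OF Fh[of _ k] f]) (use nzd[of _ i] i(2) in simp_all)
  qed
  have low: "D k d = 0" if "d < 2" for k d
    unfolding D_def using component_low_degree[OF Fh that] by (simp add: dim_zero_space)
  have D0: "D 0 d = 0" for d
  proof -
    have "component (ideal_gen (F 0)) d = {0}" by (auto simp: component_def F_def ideal_gen_empty)
    then show ?thesis by (simp add: D_def dim_zero_space)
  qed
  have arith: "0 + 1 = (1::nat)" "1 + 1 = (2::nat)" "2 + 1 = (3::nat)" "3 + 1 = (4::nat)"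
    "0 + 2 = (2::nat)" "1 + 2 = (3::nat)" "2 + 2 = (4::nat)" "3 + 2 = (5::nat)" by simp_all
  have k: "0 < (4::nat)" "1 < (4::nat)" "2 < (4::nat)" "3 < (4::nat)" by simp_all
  note s = step[OF k(1), unfolded arith] step[OF k(2), unfolded arith] step[OF k(3), unfolded arith]
    step[OF k(4), unfolded arith]
  have l: "D k 0 = 0" "D k 1 = 0" for k by (simp_all add: low)
  note s0 = s[of 0, unfolded arith card_mons_values D0 l]
  note s1 = s[of 1, unfolded arith card_mons_values D0 l]
  note s2 = s[of 2, unfolded arith card_mons_values D0 l]
  note s3 = s[of 3, unfolded arith card_mons_values D0 l]
  have "D 1 2 = 1" "D 2 2 = 2" "D 3 2 = 3" "D 4 2 = 4" using s0 by linarith+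
  moreover from this have "D 1 3 = 4" "D 2 3 = 8" "D 3 3 = 12" "D 4 3 = 16" using s1 by linarith+
  moreover from calculation have "D 4 4 = 34" "D 4 5 = 56" using s2 s3 by linarith+
  ultimately have e: "D 4 2 = 4 \<and> D 4 3 = 16 \<and> D 4 4 = 34 \<and> D 4 5 = 56" by blast
  then show "mv.dim (component (ideal_gen (range f)) 2) = 4" "mv.dim (component (ideal_gen (range f)) 3) = 16"
    "mv.dim (component (ideal_gen (range f)) 4) = 34" "mv.dim (component (ideal_gen (range f)) 5) = 56"
    by (simp_all add: D_def F_def)
qed

lemma regular_sequence_degree_5:
  fixes f :: "4 \<Rightarrow> (4, 'a::field) mpoly"
  assumes f: "\<And>i. homogeneous 2 (f i)" and reg: "regular_sequence f" and u: "homogeneous 5 u"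
  shows "u \<in> ideal_gen (range f)"
proof -
  have "component (ideal_gen (range f)) 5 = {p. homogeneous 5 p}"
    by (rule subspace_eq_homogeneous[OF subspace_component component_subset])
       (simp only: regular_sequence_dims[OF f reg] card_mons_values)
  then show ?thesis using u by (auto simp: component_def)
qed

section \<open>The strong Lefschetz property\<close>

lemma quot_coset_eq_iff: "quot_coset (ideal_gen F) p = quot_coset (ideal_gen F) q \<longleftrightarrow> p - q \<in> ideal_gen F"
proof
  assume "quot_coset (ideal_gen F) p = quot_coset (ideal_gen F) q"
  moreover have "p \<in> quot_coset (ideal_gen F) p" by (simp add: quot_coset_def)
  ultimately show "p - q \<in> ideal_gen F" by (simp add: quot_coset_def)
next
  assume pq: "p - q \<in> ideal_gen F"
  have "r - p \<in> ideal_gen F \<longleftrightarrow> r - q \<in> ideal_gen F" for r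
    using ideal_add[OF pq, of "r - p"] ideal_diff[OF _ pq, of "r - q"] by auto
  then show "quot_coset (ideal_gen F) p = quot_coset (ideal_gen F) q" by (simp add: quot_coset_def)
qed

lemma quot_mult_coset: "quot_mult (ideal_gen F) p (quot_coset (ideal_gen F) q) = quot_coset (ideal_gen F) (p * q)"
proof -
  have "quot_coset (ideal_gen F) (p * h) = quot_coset (ideal_gen F) (p * q)" if "h \<in> quot_coset (ideal_gen F) q" for h
    using that ideal_mult[of "h - q" F p] unfolding quot_coset_eq_iff by (simp add: quot_coset_def right_diff_distrib)
  moreover have "q \<in> quot_coset (ideal_gen F) q" by (simp add: quot_coset_def)
  ultimately show ?thesis unfolding quot_mult_def by blast
qed

lemma strong_lefschetzD:
  fixes F :: "('v, 'a::comm_ring_1) mpoly set"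
  assumes "strong_lefschetz (ideal_gen F)"
  obtains l where "homogeneous 1 l" "\<And>b t. 1 \<le> b \<Longrightarrow>
     (\<forall>v. homogeneous t v \<longrightarrow> v * l ^ b \<in> ideal_gen F \<longrightarrow> v \<in> ideal_gen F) \<or>
     (\<forall>u. homogeneous (t + b) u \<longrightarrow> (\<exists>v. homogeneous t v \<and> u - v * l ^ b \<in> ideal_gen F))"
proof -
  let ?I = "ideal_gen F"
  obtain l where l': "homogeneous 1 l \<and> (\<forall>b\<ge>1. \<forall>t. inj_on (quot_mult ?I (l ^ b)) (quot_deg ?I t) \<or>
     quot_mult ?I (l ^ b) ` quot_deg ?I t = quot_deg ?I (t + b))"
    using assms unfolding strong_lefschetz_def ..
  note l = l'[THEN conjunct1] l'[THEN conjunct2, rule_format]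
  show ?thesis
  proof (rule that[OF l(1)])
    fix b t :: nat assume b: "1 \<le> b"
    have "\<forall>v. homogeneous t v \<longrightarrow> v * l ^ b \<in> ?I \<longrightarrow> v \<in> ?I"
      if inj: "inj_on (quot_mult ?I (l ^ b)) (quot_deg ?I t)"
    proof (intro allI impI)
      fix v assume v: "homogeneous t v" "v * l ^ b \<in> ?I"
      have "quot_coset ?I v \<in> quot_deg ?I t" "quot_coset ?I 0 \<in> quot_deg ?I t"
        using v(1) by (auto simp: quot_deg_def)
      note in_deg = this
      have "quot_mult ?I (l ^ b) (quot_coset ?I v) = quot_mult ?I (l ^ b) (quot_coset ?I 0)"
        unfolding quot_mult_coset quot_coset_eq_iff using v(2) by (simp add: mult.commute)
      from inj_onD[OF inj this in_deg] have "quot_coset ?I v = quot_coset ?I 0" .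
      then show "v \<in> ?I" by (simp add: quot_coset_eq_iff)
    qed
    moreover have "\<forall>u. homogeneous (t + b) u \<longrightarrow> (\<exists>v. homogeneous t v \<and> u - v * l ^ b \<in> ?I)"
      if surj: "quot_mult ?I (l ^ b) ` quot_deg ?I t = quot_deg ?I (t + b)"
    proof (intro allI impI)
      fix u :: "('v, 'a) mpoly" assume u: "homogeneous (t + b) u"
      then have "quot_coset ?I u \<in> quot_mult ?I (l ^ b) ` quot_deg ?I t"
        unfolding surj by (auto simp: quot_deg_def)
      then obtain v where v: "homogeneous t v" "quot_coset ?I u = quot_coset ?I (l ^ b * v)"
        by (auto simp: quot_deg_def quot_mult_coset)
      then have "u - v * l ^ b \<in> ?I" by (simp add: quot_coset_eq_iff mult.commute)
      with v(1) show "\<exists>v. homogeneous t v \<and> u - v * l ^ b \<in> ?I" by blast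
    qed
    ultimately show "(\<forall>v. homogeneous t v \<longrightarrow> v * l ^ b \<in> ?I \<longrightarrow> v \<in> ?I) \<or>
      (\<forall>u. homogeneous (t + b) u \<longrightarrow> (\<exists>v. homogeneous t v \<and> u - v * l ^ b \<in> ?I))"
      using l(2)[OF b, of t] by blast
  qed
qed

text \<open>By polarization, the forms of degree 2 are spanned by the squares of linear forms.\<close>

lemma square_not_in_subspace:
  fixes T :: "('v::finite, 'a::field_char_0) mpoly set"
  assumes T: "mv.subspace T" and u: "homogeneous 2 u" "u \<notin> T"
  obtains v where "homogeneous 1 v" "v ^ 2 \<notin> T"
proof (rule ccontr)
  assume no: "\<not> thesis"
  have sq: "v ^ 2 \<in> T" if "homogeneous 1 v" for v
    using \<open>\<And>v. homogeneous 1 v \<Longrightarrow> v ^ 2 \<notin> T \<Longrightarrow> thesis\<close>[OF that] no by blast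
  have "u \<in> T"
  proof (rule homogeneous_in_subspace[OF T _ u(1)])
    fix m :: "'v mon" assume m: "mon_deg m = 2"
    then have "m \<noteq> 0" by auto
    then obtain i where i: "lookup m i \<noteq> 0" by (metis poly_mapping_eqI lookup_zero)
    define n where "n = m - Poly_Mapping.single i 1"
    have mn: "m = Poly_Mapping.single i 1 + n"
      unfolding n_def by (rule mon_split) (use i in simp)
    then have "mon_deg n = 1" using m by (simp add: mon_deg_add)
    then obtain j where "n = Poly_Mapping.single j 1" by (rule mon_deg_1E)
    then have mX: "(monom m :: ('v, 'a) mpoly) = X i * X j" by (simp add: mn monom_add X_def)
    have "2 * (X i * X j) = (X i + X j) ^ 2 - X i ^ 2 - (X j ^ 2 :: ('v, 'a) mpoly)"
      by (simp add: power2_eq_square algebra_simps)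
    also have "\<dots> \<in> T"
      by (intro mv.subspace_diff[OF T] sq homogeneous_add homogeneous_X)
    finally have "X i * X j \<in> T" by (rule numeral_mult_in_subspace[OF T])
    then show "monom m \<in> T" by (simp only: mX)
  qed
  with u(2) show False ..
qed

text \<open>
  Let \<open>H\<close> have codimension 2 in the forms of degree 2. By polarization there are linear forms
  \<open>u, v\<close> whose squares are independent modulo \<open>H\<close>. Then \<open>(v, u)\<close>, \<open>(u, v)\<close> or \<open>(u, u + v)\<close>
  can be taken for \<open>(y, z)\<close>.
\<close>

lemma square_and_product_not_in_subspace:
  fixes H :: "('v::finite, 'a::field_char_0) mpoly set"
  assumes H: "mv.subspace H" "H \<subseteq> {p. homogeneous 2 p}"
    and dim: "mv.dim H + 2 = card (mons 2 :: 'v mon set)"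
  obtains y z where "homogeneous 1 y" "homogeneous 1 z" "z ^ 2 \<notin> H" "y * z \<notin> mv.span (insert (z ^ 2) H)"
    "mv.span (insert (y * z) (mv.span (insert (z ^ 2) H))) = {p. homogeneous 2 p}"
proof -
  note result = that
  have sp: "mv.span H = H" using H(1) by simp
  have ins: "x \<in> mv.span (insert a H) \<longleftrightarrow> (\<exists>k. x - const k * a \<in> H)" for x a
    unfolding mv.span_breakdown_eq sp ..
  have insI: "x - const k * a \<in> H \<Longrightarrow> x \<in> mv.span (insert a H)" for x k a using ins by blast
  have sq2: "homogeneous 2 (v * w)" if "homogeneous 1 v" "homogeneous 1 w" for v w :: "('v, 'a) mpoly"
    using homogeneous_mult[OF that] by (simp add: numeral_2_eq_2)
  have sub2: "mv.span (insert a G) \<subseteq> {p. homogeneous 2 p}" if "homogeneous 2 a" "G \<subseteq> {p. homogeneous 2 p}"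
    for a and G :: "('v, 'a) mpoly set"
    by (rule mv.span_minimal[OF _ subspace_homogeneous]) (use that in auto)
  have main: thesis if yz: "homogeneous 1 y" "homogeneous 1 z" "z ^ 2 \<notin> H" "y * z \<notin> mv.span (insert (z ^ 2) H)" for y z
  proof (rule result[OF yz])
    have s: "mv.span (insert (z ^ 2) H) \<subseteq> {p. homogeneous 2 p}"
      using sub2[OF _ H(2), of "z ^ 2"] sq2[OF yz(2,2)] by (simp add: power2_eq_square)
    have "mv.dim (mv.span (insert (y * z) (mv.span (insert (z ^ 2) H)))) = mv.dim H + 1 + 1"
      by (simp only: dim_insert_subspace[OF mv.subspace_span s yz(4)] dim_insert_subspace[OF H yz(3)])
    then show "mv.span (insert (y * z) (mv.span (insert (z ^ 2) H))) = {p. homogeneous 2 p}"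
      using dim by (intro subspace_eq_homogeneous[OF mv.subspace_span sub2[OF sq2[OF yz(1,2)] s]]) simp
  qed
  have "\<exists>p. homogeneous 2 p \<and> p \<notin> T" if "mv.dim T < card (mons 2 :: 'v mon set)" "T \<subseteq> {p. homogeneous 2 p}"
    for T :: "('v, 'a) mpoly set"
    using that dim_homogeneous[where 'a = 'a and 'v = 'v, of 2] by (metis (mono_tags, lifting) mem_Collect_eq nat_neq_iff subsetI subset_antisym)
  note ex = this
  obtain u where u: "homogeneous 1 u" "u ^ 2 \<notin> H"
    using ex[OF _ H(2)] dim square_not_in_subspace[OF H(1)] by (metis less_add_same_cancel1 zero_less_numeral)
  have s: "mv.span (insert (u ^ 2) H) \<subseteq> {p. homogeneous 2 p}"
    using sub2[OF _ H(2), of "u ^ 2"] sq2[OF u(1,1)] by (simp add: power2_eq_square)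
  have "mv.dim (mv.span (insert (u ^ 2) H)) < card (mons 2 :: 'v mon set)"
    using dim_insert_subspace[OF H u(2)] dim by simp
  then obtain v where v: "homogeneous 1 v" "v ^ 2 \<notin> mv.span (insert (u ^ 2) H)"
    using ex[OF _ s] square_not_in_subspace[OF mv.subspace_span] by metis
  have vH: "v ^ 2 \<notin> H" using v(2) mv.span_base[of "v ^ 2" "insert (u ^ 2) H"] by blast
  note add = mv.subspace_add[OF H(1)] and diff = mv.subspace_diff[OF H(1)] and scale = mv.subspace_scale[OF H(1)]
  have indep: "a = 0 \<and> b = 0" if ab: "const a * u ^ 2 + const b * v ^ 2 \<in> H" for a b
  proof -
    have b: "b = 0"
    proof (rule ccontr)
      assume b: "b \<noteq> 0"
      have "const (inverse b) * (const a * u ^ 2 + const b * v ^ 2) = const (inverse b * b) * v ^ 2 - const (- inverse b * a) * u ^ 2"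
        by (simp only: const_mult const_uminus) (simp add: algebra_simps)
      then have "v ^ 2 - const (- inverse b * a) * u ^ 2 \<in> H" using scale[OF ab, of "inverse b"] b by simp
      then show False using v(2) insI by blast
    qed
    moreover have "a = 0"
    proof (rule ccontr)
      assume a: "a \<noteq> 0"
      from ab b have "const a * u ^ 2 \<in> H" by simp
      then show False using scale_in_subspaceD[OF H(1) a] u(2) by blast
    qed
    ultimately show ?thesis by simp
  qed
  show thesis
  proof (cases "v * u \<in> mv.span (insert (u ^ 2) H)")
    case False
    then show thesis using main[of v u] u v by blast
  next
    case True
    then obtain a where a: "v * u - const a * u ^ 2 \<in> H" using ins by blast
    show thesis
    proof (cases "u * v \<in> mv.span (insert (v ^ 2) H)")
      case False
      then show thesis using main[of u v] u v vH by blast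
    next
      case True
      then obtain b where b: "u * v - const b * v ^ 2 \<in> H" using ins by blast
      have "(v * u - const a * u ^ 2) - (u * v - const b * v ^ 2) = const (- a) * u ^ 2 + const b * v ^ 2"
        by (simp add: const_uminus algebra_simps)
      then have "const (- a) * u ^ 2 + const b * v ^ 2 \<in> H" using diff[OF a b] by simp
      then have "b = 0" using indep by blast
      with b have uv: "u * v \<in> H" by simp
      have hom: "homogeneous 1 (u + v)" using u v by (intro homogeneous_add)
      have sq: "(u + v) ^ 2 = u ^ 2 + v ^ 2 + const 2 * (u * v)"
        by (simp add: const_numeral power2_eq_square algebra_simps)
      have "(u + v) ^ 2 \<notin> H"
      proof
        assume "(u + v) ^ 2 \<in> H"
        from diff[OF this scale[OF uv, of 2]] have "const 1 * u ^ 2 + const 1 * v ^ 2 \<in> H" by (simp add: sq)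
        then show False using indep by fastforce
      qed
      moreover have "u * (u + v) \<notin> mv.span (insert ((u + v) ^ 2) H)"
      proof
        assume "u * (u + v) \<in> mv.span (insert ((u + v) ^ 2) H)"
        then obtain k where k: "u * (u + v) - const k * (u + v) ^ 2 \<in> H" using ins by blast
        have "u * (u + v) - const k * (u + v) ^ 2 - const (1 - 2 * k) * (u * v) = const (1 - k) * u ^ 2 + const (- k) * v ^ 2"
          unfolding sq const_diff const_mult const_uminus const_numeral
          by (simp add: power2_eq_square algebra_simps)
        then have "const (1 - k) * u ^ 2 + const (- k) * v ^ 2 \<in> H"
          using diff[OF k scale[OF uv, of "1 - 2 * k"]] by simp
        then have "1 - k = 0 \<and> - k = 0" by (rule indep)
        then show False by auto
      qed
      ultimately show thesis using main[OF u(1) hom] by blast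
    qed
  qed
qed

lemma strong_lefschetz_good:
  fixes f :: "4 \<Rightarrow> (4, 'a::field_char_0) mpoly"
  assumes f: "\<And>i. homogeneous 2 (f i)" and reg: "regular_sequence f"
    and slp: "strong_lefschetz (ideal_gen (range f))"
  obtains A where "invertible A" "good (ideal_gen (range (\<lambda>i. lin_act A (f i))))"
proof -
  define I where "I = ideal_gen (range f)"
  note dims = regular_sequence_dims[OF f reg, folded I_def]
  have I0: "mv.subspace I" unfolding I_def by (rule subspace_ideal)
  obtain l where l: "homogeneous 1 l" and L: "\<And>b t. 1 \<le> b \<Longrightarrow>
     (\<forall>v. homogeneous t v \<longrightarrow> v * l ^ b \<in> I \<longrightarrow> v \<in> I) \<or>
     (\<forall>u. homogeneous (t + b) u \<longrightarrow> (\<exists>v. homogeneous t v \<and> u - v * l ^ b \<in> I))"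
    using strong_lefschetzD[OF slp] unfolding I_def by blast
  \<comment> \<open>The component of degree \<open>t + b\<close> of \<open>I\<close> together with the multiples of \<open>l ^ b\<close>.\<close>
  define M where "M t b = {u + v * l ^ b | u v. u \<in> component I (t + b) \<and> v \<in> {p. homogeneous t p}}" for t b
  have lb: "homogeneous b (l ^ b)" for b using homogeneous_power[OF l, of b] by simp
  have M_sub: "mv.subspace (M t b)" for t b
    unfolding M_def I_def by (rule subspace_sum_multiples[OF subspace_component subspace_homogeneous])
  have M_hom: "M t b \<subseteq> {p. homogeneous (t + b) p}" for t b
    using homogeneous_mult[OF _ lb] by (auto simp: M_def component_def intro!: homogeneous_add)
  have low: "v = 0" if "homogeneous t v" "t < 2" "v \<in> I" for t v
    using ideal_low_degree[of "range f" 2 v t] f that by (auto simp: I_def)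
  have M_dim: "mv.dim (M t b) = mv.dim (component I (t + b)) + card (mons t :: 4 mon set)"
    if "t < 2" "\<And>v. homogeneous t v \<Longrightarrow> v * l ^ b \<in> I \<Longrightarrow> v \<in> I" for t b
  proof -
    have "{v. homogeneous t v \<and> v * l ^ b \<in> I} = {0}"
      using low[OF _ that(1)] that(2) mv.subspace_0[OF I0] by auto
    then show ?thesis
      using dim_multiples_component[where F = "range f" and d = t, OF lb[of b]] by (simp add: M_def I_def dim_zero_space)
  qed
  have M_I: "\<exists>v. homogeneous t v \<and> p - v * l ^ b \<in> I" if "p \<in> M t b" for p t b
    using that by (auto simp: M_def component_def)
  \<comment> \<open>If the dimensions agree, injectivity implies surjectivity.\<close>
  have surj: "\<exists>v. homogeneous t v \<and> u - v * l ^ b \<in> I"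
    if t: "t < 2" "1 \<le> b" and dim: "mv.dim (component I (t + b)) + card (mons t :: 4 mon set) = card (mons (t + b) :: 4 mon set)"
      and u: "homogeneous (t + b) u" for t b u
    using L[OF t(2), of t]
  proof
    assume "\<forall>v. homogeneous t v \<longrightarrow> v * l ^ b \<in> I \<longrightarrow> v \<in> I"
    then have "mv.dim (M t b) = card (mons (t + b) :: 4 mon set)" using M_dim[OF t(1)] dim by simp
    then have "M t b = {p. homogeneous (t + b) p}" by (rule subspace_eq_homogeneous[OF M_sub M_hom])
    then show ?thesis using u M_I by blast
  next
    assume "\<forall>u. homogeneous (t + b) u \<longrightarrow> (\<exists>v. homogeneous t v \<and> u - v * l ^ b \<in> I)"
    then show ?thesis using u by blast
  qed
  have h5: "u \<in> I" if "homogeneous 5 u" for u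
    unfolding I_def by (rule regular_sequence_degree_5[OF f reg that])
  have h4: "\<exists>c. u - const c * l ^ 4 \<in> I" if u: "homogeneous 4 u" for u
  proof -
    obtain v where "homogeneous 0 v" "u - v * l ^ 4 \<in> I"
      using surj[of 0 4 u] u by (auto simp: dims card_mons_values)
    then show ?thesis using homogeneous_0_const[of v] by metis
  qed
  have h3: "\<exists>v. homogeneous 1 v \<and> u - v * l ^ 2 \<in> I" if "homogeneous 3 u" for u
  proof -
    have "1 + 2 = (3::nat)" by simp
    with surj[of 1 2 u] that show ?thesis by (simp only: dims card_mons_values)
  qed
  \<comment> \<open>Surjectivity from degree 1 to degree 2 is impossible: the dimensions are 4 and 6.\<close>
  have inj: "v = 0" if v: "homogeneous 1 v" "v * l \<in> I" for v
  proof -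
    have "\<not> (\<forall>u. homogeneous (1 + 1) u \<longrightarrow> (\<exists>v. homogeneous 1 v \<and> u - v * l ^ 1 \<in> I))"
    proof
      assume s: "\<forall>u. homogeneous (1 + 1) u \<longrightarrow> (\<exists>v. homogeneous 1 v \<and> u - v * l ^ 1 \<in> I)"
      have "{p. homogeneous (1 + 1) p} \<subseteq> M 1 1"
      proof
        fix u assume "u \<in> {p :: (4, 'a) mpoly. homogeneous (1 + 1) p}"
        then have u: "homogeneous (1 + 1) u" by simp
        then obtain v where v: "homogeneous 1 v" "u - v * l ^ 1 \<in> I" using s by blast
        have "u = (u - v * l ^ 1) + v * l ^ 1" by simp
        moreover have "homogeneous (1 + 1) (u - v * l ^ 1)"
          by (intro homogeneous_diff u homogeneous_mult v lb)
        ultimately show "u \<in> M 1 1" using v unfolding M_def component_def by blast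
      qed
      then have "M 1 1 = {p. homogeneous (1 + 1) p}" using M_hom[of 1 1] by blast
      then have "mv.dim (M 1 1) = 10"
        using dim_homogeneous[where 'v = 4 and 'a = 'a, of 2] by (simp only: card_mons_values one_add_one)
      moreover have "mv.dim (M 1 1) \<le> 4 + 4"
        using dim_multiples_component[where F = "range f" and d = 1, OF lb[of 1]] dims(1)
        unfolding M_def I_def by (simp only: card_mons_values one_add_one)
      ultimately show False by simp
    qed
    then have "\<forall>v. homogeneous 1 v \<longrightarrow> v * l ^ 1 \<in> I \<longrightarrow> v \<in> I"
      using L[OF order_refl, of 1] by blast
    then have "v \<in> I" using v by simp
    then show ?thesis using low[OF v(1)] by simp
  qed
  define H where "H = M 1 1"
  have two: "1 + 1 = (2::nat)" by simp
  have H: "mv.subspace H" "H \<subseteq> {p. homogeneous 2 p}"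
    using M_sub[of 1 1] M_hom[of 1 1] unfolding H_def two .
  have "mv.dim H = 4 + 4"
  proof -
    have "v \<in> I" if "homogeneous 1 v" "v * l ^ 1 \<in> I" for v
      using inj[of v] that mv.subspace_0[OF I0] by simp
    then have "mv.dim (M 1 1) = mv.dim (component I (1 + 1)) + card (mons 1 :: 4 mon set)"
      by (intro M_dim) simp_all
    then show ?thesis unfolding H_def two dims card_mons_values .
  qed
  then have dimH: "mv.dim H + 2 = card (mons 2 :: 4 mon set)" by (simp only: card_mons_values)
  obtain y z where yz: "homogeneous 1 y" "homogeneous 1 z" "z ^ 2 \<notin> H" "y * z \<notin> mv.span (insert (z ^ 2) H)"
    "mv.span (insert (y * z) (mv.span (insert (z ^ 2) H))) = {p. homogeneous 2 p}"
    using square_and_product_not_in_subspace[OF H dimH] .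
  have sp: "mv.span H = H" using H(1) by simp
  have h2: "\<exists>v a b. homogeneous 1 v \<and> u - (v * l + const a * (y * z) + const b * z ^ 2) \<in> I"
    if "homogeneous 2 u" for u
  proof -
    have "u \<in> mv.span (insert (y * z) (mv.span (insert (z ^ 2) H)))" using that yz(5) by blast
    then obtain a where "u - const a * (y * z) \<in> mv.span (insert (z ^ 2) H)"
      unfolding mv.span_breakdown_eq[of u] mv.span_span by blast
    then obtain b where "u - const a * (y * z) - const b * z ^ 2 \<in> H"
      unfolding mv.span_breakdown_eq sp by blast
    then obtain v where v: "homogeneous 1 v" "u - const a * (y * z) - const b * z ^ 2 - v * l ^ 1 \<in> I"
      using M_I[of _ 1 1] unfolding H_def by blast
    have "u - (v * l + const a * (y * z) + const b * z ^ 2) = u - const a * (y * z) - const b * z ^ 2 - v * l ^ 1"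
      by simp
    with v show ?thesis by metis
  qed
  have multH: "v * l \<in> H" if "homogeneous 1 v" for v
  proof -
    have "v * l = 0 + v * l ^ 1" by simp
    moreover have "0 \<in> component I (1 + 1)" using mv.subspace_0[OF I0] by (simp add: component_def)
    ultimately show ?thesis unfolding H_def M_def using that by blast
  qed
  have indep: "a = 0 \<and> b = 0 \<and> c = 0" if s: "const a * y + const b * z + const c * l = 0" for a b c
  proof -
    have "const c * z * l \<in> H" by (intro multH homogeneous_const_mult yz)
    moreover have "const a * (y * z) + const b * z ^ 2 = - (const c * z * l)"
    proof -
      have "const a * (y * z) + const b * z ^ 2 + const c * z * l = (const a * y + const b * z + const c * l) * z"
        by (simp add: power2_eq_square algebra_simps)
      then show ?thesis unfolding s by (simp add: eq_neg_iff_add_eq_0)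
    qed
    ultimately have ab: "const a * (y * z) + const b * z ^ 2 \<in> H" using mv.subspace_neg[OF H(1)] by metis
    have a: "a = 0"
    proof (rule ccontr)
      assume a: "a \<noteq> 0"
      have "const (inverse a) * (const a * (y * z) + const b * z ^ 2) = const (inverse a * a) * (y * z) - const (- inverse a * b) * z ^ 2"
        by (simp only: const_mult const_uminus) (simp add: algebra_simps)
      then have "y * z - const (- inverse a * b) * z ^ 2 \<in> H"
        using mv.subspace_scale[OF H(1) ab, of "inverse a"] a by simp
      then show False using yz(4) unfolding mv.span_breakdown_eq sp by blast
    qed
    have b: "b = 0"
    proof (rule ccontr)
      assume b: "b \<noteq> 0"
      from ab a have "const b * z ^ 2 \<in> H" by simp
      then show False using scale_in_subspaceD[OF H(1) b] yz(3) by blast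
    qed
    have "c = 0"
    proof (rule ccontr)
      assume c: "c \<noteq> 0"
      from s a b have "const c * l = 0" by simp
      then have "l = 0" using c by (simp only: mv.scale_eq_0_iff) simp
      then have "(X 0 :: (4, 'a) mpoly) = 0" using inj[of "X 0"] mv.subspace_0[OF I0] by simp
      then show False unfolding X_def by simp
    qed
    with a b show ?thesis by simp
  qed
  show thesis
    by (rule good_coordinates[where f = f and y = y and z = z and l = l, folded I_def,
          OF yz(1,2) l indep h2 h3 h4 h5]) (auto intro: that)
qed

section \<open>Triangular regular sequences\<close>

text \<open>The point with the given coordinates.\<close>

definition pt :: "'a \<Rightarrow> 'a \<Rightarrow> 'a \<Rightarrow> 'a \<Rightarrow> 4 \<Rightarrow> 'a" where
  "pt a b c e = (\<lambda>i. if i = 0 then a else if i = 1 then b else if i = 2 then c else e)"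

lemma mons_2: "(mons 2 :: 4 mon set) = {mk 2 0 0 0, mk 1 1 0 0, mk 1 0 1 0, mk 1 0 0 1, mk 0 2 0 0,
  mk 0 1 1 0, mk 0 1 0 1, mk 0 0 2 0, mk 0 0 1 1, mk 0 0 0 2}" (is "_ = ?R")
proof
  show "mons 2 \<subseteq> ?R"
  proof
    fix m :: "4 mon" assume "m \<in> mons 2"
    moreover obtain a b c e where m: "m = mk a b c e" using mk_lookup by metis
    ultimately have d: "a + b + c + e = 2" by (simp add: mons_def)
    then have "a = 0 \<or> a = 1 \<or> a = 2" "b = 0 \<or> b = 1 \<or> b = 2" "c = 0 \<or> c = 1 \<or> c = 2" by arith+
    then show "m \<in> ?R" using d unfolding m by (elim disjE) simp_all
  qed
qed (auto simp: mons_def)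

lemma insertion_quadric:
  fixes f :: "(4, 'a::comm_ring_1) mpoly"
  assumes "homogeneous 2 f"
  shows "insertion id (pt a b c e) f =
     lookup f (mk 2 0 0 0) * a ^ 2 + lookup f (mk 1 1 0 0) * (a * b) + lookup f (mk 1 0 1 0) * (a * c) +
     lookup f (mk 1 0 0 1) * (a * e) + lookup f (mk 0 2 0 0) * b ^ 2 + lookup f (mk 0 1 1 0) * (b * c) +
     lookup f (mk 0 1 0 1) * (b * e) + lookup f (mk 0 0 2 0) * c ^ 2 + lookup f (mk 0 0 1 1) * (c * e) +
     lookup f (mk 0 0 0 2) * e ^ 2"
proof -
  have v: "mon_val (pt a b c e) (mk i j k l) = a ^ i * b ^ j * c ^ k * e ^ l" for i j k l
    by (simp add: mk_def mon_val_add pt_def)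
  have "insertion id (pt a b c e) f = (\<Sum>m\<in>mons 2. lookup f m * mon_val (pt a b c e) m)"
    using assms by (subst insertion_superset[OF is_hom_id finite_mons[of 2]]) (auto simp: homogeneous_def mons_def)
  then show ?thesis unfolding mons_2 by (simp add: v add.assoc)
qed

lemma quadratic_root:
  fixes c b a :: "'a::alg_closed_field"
  assumes "c \<noteq> 0"
  obtains x where "c * x ^ 2 + b * x + a = 0"
proof -
  have "\<exists>x. (\<Sum>k\<le>2. (if k = 0 then a else if k = 1 then b else c) * x ^ k) = 0"
    by (rule alg_closed) (use assms in auto)
  then show ?thesis using that by (auto simp: numeral_2_eq_2 algebra_simps)
qed

text \<open>
  If the coefficient of the square of the \<open>i\<close>-th variable vanishes, and \<open>i\<close> is minimal, put this
  variable to 1 and the later ones to 0. Then the members of the sequence from the \<open>i\<close>-th one on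
  vanish, and the earlier ones are quadratic equations that can be solved successively for the earlier
  variables.
\<close>

lemma triangular_diagonal:
  fixes f :: "4 \<Rightarrow> (4, 'a::alg_closed_field) mpoly"
  assumes f: "\<And>i. homogeneous 2 (f i)" and reg: "regular_sequence f" and tri: "\<And>i. vars (f i) \<subseteq> {i..}"
  shows "lookup (f i) (Poly_Mapping.single i 2) \<noteq> 0"
proof -
  \<comment> \<open>The quadrics have no common zero outside of the origin.\<close>
  have nozero: "a = 0 \<and> b = 0 \<and> c = 0 \<and> e = 0" if z: "\<And>i. insertion id (pt a b c e) (f i) = 0" for a b c e
  proof -
    have ev: "is_hom (insertion id (pt a b c e))" by (rule is_hom_insertion) simp
    have "insertion id (pt a b c e) p = 0" if "p \<in> ideal_gen (range f)" for p
      using that unfolding ideal_gen_range by (auto simp: is_homD[OF ev] z)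
    moreover have "X i ^ 5 \<in> ideal_gen (range f)" for i
    proof (rule regular_sequence_degree_5[OF f reg])
      show "homogeneous 5 (X i ^ 5 :: (4, 'a) mpoly)"
        using homogeneous_power[OF homogeneous_X(1)[of i], of 5] by simp
    qed
    ultimately have "insertion id (pt a b c e) (X i ^ 5) = 0" for i by blast
    then have "pt a b c e i = 0" for i by (simp add: is_homD[OF ev] insertion_X)
    from this[of 0] this[of 1] this[of 2] this[of 3] show ?thesis by (simp add: pt_def)
  qed
  have coeff: "lookup (f i) m = 0" if "lookup m j \<noteq> 0" "j < i" for i j m
  proof (rule ccontr)
    assume "lookup (f i) m \<noteq> 0"
    then have "j \<in> vars (f i)" unfolding vars_def using that(1) by (auto simp: in_keys_iff intro!: bexI[of _ m])
    then show False using tri[of i] that(2) by auto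
  qed
  note val = insertion_quadric[OF f]
  define q0 q1 q2 q3 where "q0 = lookup (f 0) (mk 2 0 0 0)" "q1 = lookup (f 1) (mk 0 2 0 0)"
    "q2 = lookup (f 2) (mk 0 0 2 0)" "q3 = lookup (f 3) (mk 0 0 0 2)"
  note q = q0_q1_q2_q3_def
  have c1: "lookup (f 1) (mk (Suc i) j k l) = 0" for i j k l
    by (rule coeff[of _ 0]) (use four_less in simp_all)
  have c2: "lookup (f 2) (mk (Suc i) j k l) = 0" "lookup (f 2) (mk i (Suc j) k l) = 0" for i j k l
    by (rule coeff[of _ 0], use four_less in simp, use four_less in simp)
       (rule coeff[of _ 1], use four_less in simp_all)
  have c3: "lookup (f 3) (mk (Suc i) j k l) = 0" "lookup (f 3) (mk i (Suc j) k l) = 0" "lookup (f 3) (mk i j (Suc k) l) = 0"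
    for i j k l
    by (rule coeff[of _ 0], use four_less in simp, use four_less in simp)
       (rule coeff[of _ 1], use four_less in simp, use four_less in simp,
        rule coeff[of _ 2], use four_less in simp_all)
  have v1: "insertion id (pt a b c e) (f 1) = q1 * b ^ 2 + lookup (f 1) (mk 0 1 1 0) * (b * c) +
     lookup (f 1) (mk 0 1 0 1) * (b * e) + lookup (f 1) (mk 0 0 2 0) * c ^ 2 + lookup (f 1) (mk 0 0 1 1) * (c * e) +
     lookup (f 1) (mk 0 0 0 2) * e ^ 2" for a b c e
    unfolding val q using c1[of 1] c1[of 0] by (simp add: numeral_2_eq_2)
  have v2: "insertion id (pt a b c e) (f 2) = q2 * c ^ 2 + lookup (f 2) (mk 0 0 1 1) * (c * e) +
     lookup (f 2) (mk 0 0 0 2) * e ^ 2" for a b c e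
    unfolding val q using c2 by (simp add: numeral_2_eq_2)
  have v3: "insertion id (pt a b c e) (f 3) = q3 * e ^ 2" for a b c e
    unfolding val q using c3 by (simp add: numeral_2_eq_2)
  have s0: "\<exists>a. insertion id (pt a b c e) (f 0) = 0" if nz: "q0 \<noteq> 0" for b c e
  proof -
    let ?g = "lookup (f 0)"
    obtain a where a: "q0 * a ^ 2 + (?g (mk 1 1 0 0) * b + ?g (mk 1 0 1 0) * c + ?g (mk 1 0 0 1) * e) * a +
      (?g (mk 0 2 0 0) * b ^ 2 + ?g (mk 0 1 1 0) * (b * c) + ?g (mk 0 1 0 1) * (b * e) + ?g (mk 0 0 2 0) * c ^ 2 +
       ?g (mk 0 0 1 1) * (c * e) + ?g (mk 0 0 0 2) * e ^ 2) = 0"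
      using quadratic_root[OF nz] by blast
    show ?thesis unfolding val q(1)[symmetric]
      by (rule exI[of _ a], rule trans[OF _ a]) (simp add: algebra_simps)
  qed
  have s1: "\<exists>b. \<forall>a. insertion id (pt a b c e) (f 1) = 0" if nz: "q1 \<noteq> 0" for c e
  proof -
    let ?g = "lookup (f 1)"
    obtain b where b: "q1 * b ^ 2 + (?g (mk 0 1 1 0) * c + ?g (mk 0 1 0 1) * e) * b +
      (?g (mk 0 0 2 0) * c ^ 2 + ?g (mk 0 0 1 1) * (c * e) + ?g (mk 0 0 0 2) * e ^ 2) = 0"
      using quadratic_root[OF nz] by blast
    show ?thesis unfolding v1
      by (rule exI[of _ b], rule allI, rule trans[OF _ b]) (simp add: algebra_simps)
  qed
  have s2: "\<exists>c. \<forall>a b. insertion id (pt a b c e) (f 2) = 0" if nz: "q2 \<noteq> 0" for e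
  proof -
    let ?g = "lookup (f 2)"
    obtain c where c: "q2 * c ^ 2 + (?g (mk 0 0 1 1) * e) * c + ?g (mk 0 0 0 2) * e ^ 2 = 0"
      using quadratic_root[OF nz] by blast
    show ?thesis unfolding v2
      by (rule exI[of _ c], intro allI, rule trans[OF _ c]) (simp add: algebra_simps)
  qed
  have all: "insertion id p (f i) = 0" if "insertion id p (f 0) = 0" "insertion id p (f 1) = 0"
    "insertion id p (f 2) = 0" "insertion id p (f 3) = 0" for p i
    using that by (cases i rule: four_cases) simp_all
  have q0: "q0 \<noteq> 0"
  proof
    assume z: "q0 = 0"
    have "insertion id (pt 1 0 0 0) (f 0) = q0" unfolding val q by simp
    then have "insertion id (pt 1 0 0 0) (f i) = 0" for i
      by - (rule all; simp add: v1 v2 v3 z)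
    from nozero[OF this] show False by simp
  qed
  have q1: "q1 \<noteq> 0"
  proof
    assume z: "q1 = 0"
    obtain a where "insertion id (pt a 1 0 0) (f 0) = 0" using s0[OF q0] by blast
    then have "insertion id (pt a 1 0 0) (f i) = 0" for i
      by - (rule all; simp add: v1 v2 v3 z)
    from nozero[OF this] show False by simp
  qed
  have q2: "q2 \<noteq> 0"
  proof
    assume z: "q2 = 0"
    obtain b where b: "\<forall>a. insertion id (pt a b 1 0) (f 1) = 0" using s1[OF q1] by blast
    obtain a where "insertion id (pt a b 1 0) (f 0) = 0" using s0[OF q0] by blast
    then have "insertion id (pt a b 1 0) (f i) = 0" for i
      using b by - (rule all; simp add: v2 v3 z)
    from nozero[OF this] show False by simp
  qed
  have q3: "q3 \<noteq> 0"
  proof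
    assume z: "q3 = 0"
    obtain c where c: "\<forall>a b. insertion id (pt a b c 1) (f 2) = 0" using s2[OF q2] by blast
    obtain b where b: "\<forall>a. insertion id (pt a b c 1) (f 1) = 0" using s1[OF q1] by blast
    obtain a where "insertion id (pt a b c 1) (f 0) = 0" using s0[OF q0] by blast
    then have "insertion id (pt a b c 1) (f i) = 0" for i
      using b c by - (rule all; simp add: v3 z)
    from nozero[OF this] show False by simp
  qed
  have single: "Poly_Mapping.single 0 k = mk k 0 0 0" "Poly_Mapping.single 1 k = mk 0 k 0 0"
    "Poly_Mapping.single 2 k = mk 0 0 k 0" "Poly_Mapping.single 3 k = mk 0 0 0 k" for k
    by (simp_all add: mk_def)
  show ?thesis
    by (cases i rule: four_cases) (use q0 q1 q2 q3 in \<open>simp_all only: q single not_False_eq_True\<close>)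
qed

section \<open>The generic initial ideal of four quadrics\<close>

lemma J_eq:
  "ideal_gen (monom ` J_gens :: (4, 'a::field) mpoly set) =
    ideal_gen {X 0^2, X 0 * X 1, X 1^2, X 0 * X 2, X 1 * X 2^2, X 2^3, X 1 * X 2 * X 3, X 2^2 * X 3,
      X 0 * X 3^3, X 1 * X 3^3, X 2 * X 3^3, X 3^5}"
  by (simp add: J_gens_def monom_mk)

theorem proposition2p5p1:
  fixes x1 x2 x3 x4 :: "(4, 'a::{alg_closed_field, field_char_0}) mpoly"
    and J :: "(4, 'a) mpoly set"
  assumes vars: "x1 = X 0" "x2 = X 1" "x3 = X 2" "x4 = X 3"
    and J: "J = ideal_gen {x1^2, x1*x2, x2^2, x1*x3, x2*x3^2, x3^3, x2*x3*x4, x3^2*x4,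
                           x1*x4^3, x2*x4^3, x3*x4^3, x4^5}"
  shows
    "(\<forall>f :: 4 \<Rightarrow> (4, 'a) mpoly.
        (\<forall>i. homogeneous 2 (f i)) \<and> regular_sequence f \<and>
        strong_lefschetz (ideal_gen (range f))
        \<longrightarrow> is_generic_initial_ideal (ideal_gen (range f)) J) \<and>
     generic_sequence 2 (\<lambda>f :: 4 \<Rightarrow> (4, 'a) mpoly.
        is_generic_initial_ideal (ideal_gen (range f)) J) \<and>
     (\<forall>f :: 4 \<Rightarrow> (4, 'a) mpoly.
        (\<forall>i. homogeneous 2 (f i)) \<and> regular_sequence f \<and> (\<forall>i. vars (f i) \<subseteq> {i..})
        \<longrightarrow> is_generic_initial_ideal (ideal_gen (range f)) J)"
proof -
  have JJ: "J = ideal_gen (monom ` J_gens)" unfolding J vars J_eq ..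
  obtain A0 :: "'a ^ 4 ^ 4" where A0: "invertible A0" "good (ideal_gen (range (\<lambda>i. lin_act A0 (X i ^ 2))))"
    using squares_good by blast
  have "is_generic_initial_ideal (ideal_gen (range f)) J"
    if f: "\<forall>i. homogeneous 2 (f i)" and reg: "regular_sequence f" and slp: "strong_lefschetz (ideal_gen (range f))"
    for f :: "4 \<Rightarrow> (4, 'a) mpoly"
  proof -
    obtain A where "invertible A" "good (ideal_gen (range (\<lambda>i. lin_act A (f i))))"
      using strong_lefschetz_good[OF f[rule_format] reg slp] .
    then show ?thesis unfolding JJ by (rule generic_initial_ideal_if_good[OF f[rule_format]])
  qed
  moreover have "generic_sequence 2 (\<lambda>f :: 4 \<Rightarrow> (4, 'a) mpoly. is_generic_initial_ideal (ideal_gen (range f)) J)"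
  proof -
    have "homogeneous 2 (lin_act A0 (X i ^ 2))" for i
      using homogeneous_power[OF homogeneous_X(1)[of i], of 2] by (intro homogeneous_lin_act) simp
    then show ?thesis unfolding JJ by (rule generic_sequence_if_good[OF _ A0(2)])
  qed
  moreover have "is_generic_initial_ideal (ideal_gen (range f)) J"
    if f: "\<forall>i. homogeneous 2 (f i)" and reg: "regular_sequence f" and tri: "\<forall>i. vars (f i) \<subseteq> {i..}"
    for f :: "4 \<Rightarrow> (4, 'a) mpoly"
  proof -
    obtain B where "invertible B" "good (ideal_gen (range (\<lambda>i. lin_act B (f i))))"
      using triangular_degeneration[OF f[rule_format] tri[rule_format]
          triangular_diagonal[OF f[rule_format] reg tri[rule_format]] A0] .
    then show ?thesis unfolding JJ by (rule generic_initial_ideal_if_good[OF f[rule_format]])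
  qed
  ultimately show ?thesis by blast
qed

end
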